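(* Let $V$ be a $\mathbb Z_2$-graded $\mathbf k$-module equipped with a nondegenerate even graded symmetric inner product $\langle\cdot,\cdot\rangle$. (i) If $\varphi,\psi\in C(V)$ are cyclic, then $\{\varphi,\psi\}$ is cyclic, and (for homogeneous $v_1,\dots,v_{n+1}$ and $\psi_l$ homogeneous for each $l$) $$\widetilde{\{\varphi,\psi\}}(v_1,\dots,v_{n+1})=\sum_{\substack{k+l=n+1\\ 0\le i\le n}}(-1)^{(|v_1|+\cdots+|v_i|)(|v_{i+1}|+\cdots+|v_{n+1}|)+in+(k-1)|\psi_l|}\;\tilde\varphi_k(\psi_l(v_{i+1},\dots,v_{i+l}),v_{i+l+1},\dots,v_i),$$ where indices of the $v$'s are read cyclically modulo $n+1$. Thus the inner product induces a structure of $\mathbb Z_2\times\mathbb Z$-graded Lie algebra on $CC(V,\mathbf k)$ (with respect to the inner product $\langle(\bar a,r),(\bar b,s)\rangle=(\bar a+r)(\bar b+s)$ on $\mathbb Z_2\times\mathbb Z$), given by $\{\tilde\varphi,\tilde\psi\}=\widetilde{\{\varphi,\psi\}}$. (ii) If $m$ is an $A_\infty$ structure on $V$, then there is a differential $D$ on $CC(V,\mathbf k)$ (that is, $D$ maps $CC(V,\mathbf k)$ to itself and $D^2=0$) given by $$D(\tilde\varphi)(v_1,\dots,v_{n+1})=\sum_{\substack{k+l=n+1\\ 0\le i\le n}}(-1)^{(|v_1|+\cdots+|v_i|)(|v_{i+1}|+\cdots+|v_{n+1}|)+in+(k-1)l}\;\tilde\varphi_k(m_l(v_{i+1},\dots,v_{i+l}),v_{i+l+1},\dots,v_i).$$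 (iii) If moreover the inner product is invariant (i.e. $m$ is cyclic), then $D(\tilde\varphi)=\{\tilde\varphi,\tilde m\}$ for all $\tilde\varphi\in CC(V,\mathbf k)$. Thus $CC(V,\mathbf k)$ inherits the structure of a differential graded Lie algebra.
   Context: $\mathbf k$ is a commutative ring, $V=V_0\oplus V_1$ a $\mathbb Z_2$-graded $\mathbf k$-module, $|v|$ the parity of a homogeneous element, $V^n$ the $n$-th tensor power. $C^k(V)=\mathrm{Hom}(V^k,V)$ and $C(V)=\prod_{k\ge1}C^k(V)=\mathrm{Hom}(\bigoplus_{k\ge 1}V^k,V)$; for $\varphi\in C(V)$, $\varphi_k$ denotes its restriction to $V^k$. A homogeneous $\varphi_k\in C^k(V)$ has parity $|\varphi_k|$, degree $\deg\varphi_k=k-1$ and bidegree $(|\varphi_k|,k-1)\in\mathbb Z_2\times\mathbb Z$. $C^k(V,\mathbf k)=\mathrm{Hom}(V^{k+1},\mathbf k)$, $C(V,\mathbf k)=\prod_{k\ge1}C^k(V,\mathbf k)$, with the same bidegree convention. For homogeneous $\varphi_k\in C^k(V)$, $\psi_l\in C^l(V)$, $n=k+l-1$, put $$(\varphi_k\circ\psi_l)(v_1,\dots,v_n)=\sum_{i=0}^{k-1}(-1)^{(|v_1|+\cdots+|v_i|)|\psi_l|+i(l-1)}\varphi_k(v_1,\dots,v_i,\psi_l(v_{i+1},\dots,v_{i+l}),v_{i+l+1},\dots,v_n),$$ $[\varphi_k,\psi_l]=\varphi_k\circ\psi_l-(-1)^{|\varphi_k||\psi_l|+(k-1)(l-1)}\psi_l\circ\varphi_k$,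 and define the modified Gerstenhaber bracket $\{\varphi_k,\psi_l\}=(-1)^{(k-1)|\psi_l|}[\varphi_k,\psi_l]$. Extend bilinearly and to $C(V)$ by $\{\varphi,\psi\}_n=\sum_{k+l=n+1}\{\varphi_k,\psi_l\}$. Inner product: a bilinear form $V\times V\to\mathbf k$ that is even ($\langle v,w\rangle=0$ if $|v|\neq|w|$), graded symmetric ($\langle v,w\rangle=(-1)^{|v||w|}\langle w,v\rangle$) and nondegenerate ($v\mapsto\langle v,\cdot\rangle$ is an isomorphism $V\to\mathrm{Hom}(V,\mathbf k)$). For $\varphi\in C^k(V)$ put $\tilde\varphi(v_1,\dots,v_{k+1})=\langle\varphi(v_1,\dots,v_k),v_{k+1}\rangle$; this gives an isomorphism $C^k(V)\cong C^k(V,\mathbf k)$. A homogeneous $\varphi\in C^k(V)$ is cyclic if $\langle\varphi(v_1,\dots,v_k),v_{k+1}\rangle=(-1)^{k+|v_1||\varphi|}\langle v_1,\varphi(v_2,\dots,v_{k+1})\rangle$; an element $f\in C^k(V,\mathbf k)$ is cyclic if $f(v_1,\dots,v_{k+1})=(-1)^{k+|v_{k+1}|(|v_1|+\cdots+|v_k|)}f(v_{k+1},v_1,\dots,v_k)$; $\varphi$ is cyclic iff $\tilde\varphi$ is. An element of $C(V)$ is cyclic if all its components are cyclic. $CC(V)\subset C(V)$ and $CC(V,\mathbf k)\subset C(V,\mathbf k)$ are the submodules of cyclic elements. An $A_\infty$ structure on $V$ is $m\in C(V)$ with $|m_k|=k \bmod 2$ such that for all $n\ge1$ $$\sum_{\substack{k+l=n+1\\0\le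 i\le n-k}}(-1)^{(|v_1|+\cdots+|v_i|)k+i(k-1)+(n-k)k}m_l(v_1,\dots,v_i,m_k(v_{i+1},\dots,v_{i+k}),v_{i+k+1},\dots,v_n)=0.$$ The inner product is invariant for $m$ if every $m_k$ is cyclic. Graded Lie algebra with respect to a symmetric $\mathbb Z_2$-valued bilinear form $\langle\cdot,\cdot\rangle$ on the grading group: the bracket is bilinear, additive on (bi)degrees, and for homogeneous elements satisfies $\{u,v\}=-(-1)^{\langle u,v\rangle}\{v,u\}$ and $\{u,\{v,w\}\}=\{\{u,v\},w\}+(-1)^{\langle u,v\rangle}\{v,\{u,w\}\}$ (here $\langle u,v\rangle$ is the form evaluated on the degrees). For direct products such as $C(V)$, these identities are understood for homogeneous components. Differential graded Lie algebra: additionally a map $D$ with $D^2=0$ and $D\{\varphi,\psi\}=\{\varphi,D\psi\}+(-1)^{q}\{D\varphi,\psi\}$, where $q=|\psi|+\deg\psi$ is the total parity of $\psi$. *)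

theory Defs
  imports "HOL.Modules" "HOL-Library.Z2" "HOL-Library.Function_Algebras" "HOL-Library.Product_Plus"
begin

(* Parities, and all exponents of signs, are elements of the field with two elements (type bit);
   signed b x is (-1)^b x. *)

definition signed :: "bit \<Rightarrow> 'a::ab_group_add \<Rightarrow> 'a" where
  "signed b x = (if b = 0 then x else - x)"

definition graded_module ::
  "('k::comm_ring_1 \<Rightarrow> 'v::ab_group_add \<Rightarrow> 'v) \<Rightarrow> (bit \<Rightarrow> 'v set) \<Rightarrow> bool" where
  "graded_module s V \<longleftrightarrow> module s \<and> (\<forall>a. module.subspace s (V a)) \<and>
     (\<forall>v. \<exists>!p. p \<in> V 0 \<times> V 1 \<and> v = fst p + snd p)"

definition part :: "(bit \<Rightarrow> 'v::ab_group_add set) \<Rightarrow> bit \<Rightarrow> 'v \<Rightarrow> 'v" where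
  "part V a v = (THE x. x \<in> V a \<and> v - x \<in> V (a + 1))"

definition ground :: "bit \<Rightarrow> 'k::comm_ring_1 set" where
  "ground a = (if a = 0 then UNIV else {0})"

(* as lists parities of the entries of vs.  The zero vector has both parities. *)
definition homogeneous :: "(bit \<Rightarrow> 'v set) \<Rightarrow> bit list \<Rightarrow> 'v list \<Rightarrow> bool" where
  "homogeneous V as vs \<longleftrightarrow> list_all2 (\<lambda>a v. v \<in> V a) as vs"

definition inner_product ::
  "('k::comm_ring_1 \<Rightarrow> 'v::ab_group_add \<Rightarrow> 'v) \<Rightarrow> (bit \<Rightarrow> 'v set) \<Rightarrow> ('v \<Rightarrow> 'v \<Rightarrow> 'k) \<Rightarrow> bool" where
  "inner_product s V ip \<longleftrightarrow>
     (\<forall>v. module_hom s (*) (ip v)) \<and> (\<forall>w. module_hom s (*) (\<lambda>v. ip v w)) \<and>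
     (\<forall>a b. \<forall>v\<in>V a. \<forall>w\<in>V b. a \<noteq> b \<longrightarrow> ip v w = 0) \<and>
     (\<forall>a b. \<forall>v\<in>V a. \<forall>w\<in>V b. ip v w = signed (a * b) (ip w v)) \<and>
     bij_betw ip UNIV {f. module_hom s (*) f}"

(* Linear maps on the n-th tensor power are identified with n-linear maps, and a family of these,
   one for each n, with a single function on lists; its component of arity n is its restriction to
   lists of length n. *)
definition multilinear ::
  "('k::comm_ring_1 \<Rightarrow> 'v::ab_group_add \<Rightarrow> 'v) \<Rightarrow> ('k \<Rightarrow> 'w::ab_group_add \<Rightarrow> 'w) \<Rightarrow>
   ('v list \<Rightarrow> 'w) \<Rightarrow> bool" where
  "multilinear s t f \<longleftrightarrow> (\<forall>us ws. module_hom s t (\<lambda>v. f (us @ v # ws)))"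

definition cochains ::
  "('k::comm_ring_1 \<Rightarrow> 'v::ab_group_add \<Rightarrow> 'v) \<Rightarrow> ('v list \<Rightarrow> 'v) set" where
  "cochains s = {\<phi>. multilinear s s \<phi> \<and> \<phi> [] = 0}"

(* C^k(V,k) consists of the (k+1)-linear forms, with k at least 1. *)
definition form_cochains ::
  "('k::comm_ring_1 \<Rightarrow> 'v::ab_group_add \<Rightarrow> 'v) \<Rightarrow> ('v list \<Rightarrow> 'k) set" where
  "form_cochains s = {f. multilinear s (*) f \<and> (\<forall>vs. length vs < 2 \<longrightarrow> f vs = 0)}"

definition arity_part :: "nat \<Rightarrow> ('v list \<Rightarrow> 'w::zero) \<Rightarrow> 'v list \<Rightarrow> 'w" where
  "arity_part n f vs = (if length vs = n then f vs else 0)"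

(* f is homogeneous of parity p as a map from tensor powers of V to W. *)
definition has_parity ::
  "(bit \<Rightarrow> 'v set) \<Rightarrow> (bit \<Rightarrow> 'w set) \<Rightarrow> bit \<Rightarrow> ('v list \<Rightarrow> 'w) \<Rightarrow> bool" where
  "has_parity V W p f \<longleftrightarrow> (\<forall>as vs. homogeneous V as vs \<longrightarrow> f vs \<in> W (p + sum_list as))"

(* The component of parity p of f in Hom = Hom_0 + Hom_1. *)
definition parity_part ::
  "(bit \<Rightarrow> 'v::ab_group_add set) \<Rightarrow> (bit \<Rightarrow> 'w::ab_group_add set) \<Rightarrow> bit \<Rightarrow>
   ('v list \<Rightarrow> 'w) \<Rightarrow> 'v list \<Rightarrow> 'w" where
  "parity_part V W p f vs =
     (\<Sum>as | length as = length vs. part W (p + sum_list as) (f (map2 (part V) as vs)))"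

(* The insertion product of the arity k component of \<phi> with the arity l component of \<psi>, the
   latter of parity q, for length vs = k + l - 1.  The outer sum extends the formula for homogeneous
   arguments (see circ_homogeneous) by linearity. *)
definition circ ::
  "(bit \<Rightarrow> 'v::ab_group_add set) \<Rightarrow> nat \<Rightarrow> nat \<Rightarrow> bit \<Rightarrow>
   ('v list \<Rightarrow> 'v) \<Rightarrow> ('v list \<Rightarrow> 'v) \<Rightarrow> 'v list \<Rightarrow> 'v" where
  "circ V k l q \<phi> \<psi> vs =
     (\<Sum>as | length as = length vs. let ws = map2 (part V) as vs in
        \<Sum>i<k. signed (sum_list (take i as) * q + of_nat (i * (l - 1)))
          (\<phi> (take i ws @ \<psi> (take l (drop i ws)) # drop (i + l) ws)))"

definition hom_bracket ::
  "(bit \<Rightarrow> 'v::ab_group_add set) \<Rightarrow> nat \<Rightarrow> bit \<Rightarrow> nat \<Rightarrow> bit \<Rightarrow>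
   ('v list \<Rightarrow> 'v) \<Rightarrow> ('v list \<Rightarrow> 'v) \<Rightarrow> 'v list \<Rightarrow> 'v" where
  "hom_bracket V k p l q \<phi> \<psi> vs = signed (of_nat (k - 1) * q)
     (circ V k l q \<phi> \<psi> vs
      - signed (p * q + of_nat ((k - 1) * (l - 1))) (circ V l k p \<psi> \<phi> vs))"

definition arity_pairs :: "nat \<Rightarrow> (nat \<times> nat) set" where
  "arity_pairs n = {(k, l). 1 \<le> k \<and> 1 \<le> l \<and> k + l = n + 1}"

(* The modified Gerstenhaber bracket. *)
definition bracket ::
  "(bit \<Rightarrow> 'v::ab_group_add set) \<Rightarrow> ('v list \<Rightarrow> 'v) \<Rightarrow> ('v list \<Rightarrow> 'v) \<Rightarrow> 'v list \<Rightarrow> 'v" where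
  "bracket V \<phi> \<psi> vs =
     (\<Sum>(k, l)\<in>arity_pairs (length vs). \<Sum>p\<in>{0, 1}. \<Sum>q\<in>{0, 1}.
        hom_bracket V k p l q (parity_part V V p \<phi>) (parity_part V V q \<psi>) vs)"

definition tilde :: "('v \<Rightarrow> 'v \<Rightarrow> 'k::zero) \<Rightarrow> ('v list \<Rightarrow> 'v) \<Rightarrow> 'v list \<Rightarrow> 'k" where
  "tilde ip \<phi> vs = (if length vs < 2 then 0 else ip (\<phi> (butlast vs)) (last vs))"

(* Cyclicity of a cochain whose components all have parity p; the arity k is Suc (length us). *)
definition cyclic_of_parity ::
  "(bit \<Rightarrow> 'v set) \<Rightarrow> ('v \<Rightarrow> 'v \<Rightarrow> 'k::comm_ring_1) \<Rightarrow> bit \<Rightarrow> ('v list \<Rightarrow> 'v) \<Rightarrow> bool" where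
  "cyclic_of_parity V ip p \<phi> \<longleftrightarrow>
     (\<forall>a as b v us w. homogeneous V (a # as @ [b]) (v # us @ [w]) \<longrightarrow>
        ip (\<phi> (v # us)) w = signed (of_nat (Suc (length us)) + a * p) (ip v (\<phi> (us @ [w]))))"

definition cyclic_cochains ::
  "('k::comm_ring_1 \<Rightarrow> 'v::ab_group_add \<Rightarrow> 'v) \<Rightarrow> (bit \<Rightarrow> 'v set) \<Rightarrow> ('v \<Rightarrow> 'v \<Rightarrow> 'k) \<Rightarrow>
   ('v list \<Rightarrow> 'v) set" where
  "cyclic_cochains s V ip =
     {\<phi> \<in> cochains s. \<forall>p. cyclic_of_parity V ip p (parity_part V V p \<phi>)}"

definition cyclic_forms ::
  "('k::comm_ring_1 \<Rightarrow> 'v::ab_group_add \<Rightarrow> 'v) \<Rightarrow> (bit \<Rightarrow> 'v set) \<Rightarrow> ('v list \<Rightarrow> 'k) set" where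
  "cyclic_forms s V = {f \<in> form_cochains s.
     \<forall>as b us w. us \<noteq> [] \<and> homogeneous V (as @ [b]) (us @ [w]) \<longrightarrow>
        f (us @ [w]) = signed (of_nat (length us) + b * sum_list as) (f (w # us))}"

(* The part of CC(V,k) of bidegree (p, r); it consists of forms in r + 2 arguments. *)
definition cyclic_forms_bideg ::
  "('k::comm_ring_1 \<Rightarrow> 'v::ab_group_add \<Rightarrow> 'v) \<Rightarrow> (bit \<Rightarrow> 'v set) \<Rightarrow> bit \<times> int \<Rightarrow>
   ('v list \<Rightarrow> 'k) set" where
  "cyclic_forms_bideg s V = (\<lambda>(p, r). {f \<in> cyclic_forms s V.
     has_parity V ground p f \<and> (\<forall>vs. int (length vs) \<noteq> r + 2 \<longrightarrow> f vs = 0)})"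

definition form_scale :: "'k::comm_ring_1 \<Rightarrow> ('v list \<Rightarrow> 'k) \<Rightarrow> 'v list \<Rightarrow> 'k" where
  "form_scale c f = (\<lambda>vs. c * f vs)"

definition form_bracket ::
  "('k::comm_ring_1 \<Rightarrow> 'v::ab_group_add \<Rightarrow> 'v) \<Rightarrow> (bit \<Rightarrow> 'v set) \<Rightarrow> ('v \<Rightarrow> 'v \<Rightarrow> 'k) \<Rightarrow>
   ('v list \<Rightarrow> 'k) \<Rightarrow> ('v list \<Rightarrow> 'k) \<Rightarrow> 'v list \<Rightarrow> 'k" where
  "form_bracket s V ip f g =
     tilde ip (bracket V (inv_into (cochains s) (tilde ip) f) (inv_into (cochains s) (tilde ip) g))"

(* The sum over cyclic rotations of the arguments: rotate i vs is v_(i+1), ..., v_(n+1), v_1, ..., v_i.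
   Here as lists the parities of vs, and q l is the parity of the arity l component of \<psi>. *)
definition rotation_sum ::
  "bit list \<Rightarrow> (nat \<Rightarrow> bit) \<Rightarrow> ('v list \<Rightarrow> 'k::comm_ring_1) \<Rightarrow> ('v list \<Rightarrow> 'v) \<Rightarrow> 'v list \<Rightarrow> 'k" where
  "rotation_sum as q f \<psi> vs = (let n = length vs - 1 in
     \<Sum>(k, l)\<in>arity_pairs n. \<Sum>i\<le>n.
       signed (sum_list (take i as) * sum_list (drop i as) + of_nat (i * n) + of_nat (k - 1) * q l)
         (f (\<psi> (take l (rotate i vs)) # drop l (rotate i vs))))"

definition a_infinity ::
  "('k::comm_ring_1 \<Rightarrow> 'v::ab_group_add \<Rightarrow> 'v) \<Rightarrow> (bit \<Rightarrow> 'v set) \<Rightarrow> ('v list \<Rightarrow> 'v) \<Rightarrow> bool" where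
  "a_infinity s V m \<longleftrightarrow> m \<in> cochains s \<and>
     (\<forall>k\<ge>1. has_parity V V (of_nat k) (arity_part k m)) \<and>
     (\<forall>n\<ge>1. \<forall>as vs. length vs = n \<and> homogeneous V as vs \<longrightarrow>
        (\<Sum>(k, l)\<in>arity_pairs n. \<Sum>i\<le>n - k.
           signed (sum_list (take i as) * of_nat k + of_nat (i * (k - 1)) + of_nat ((n - k) * k))
             (m (take i vs @ m (take k (drop i vs)) # drop (i + k) vs))) = 0)"

definition linear_on ::
  "('k \<Rightarrow> 'a::ab_group_add \<Rightarrow> 'a) \<Rightarrow> 'a set \<Rightarrow> ('a \<Rightarrow> 'a) \<Rightarrow> bool" where
  "linear_on sc L f \<longleftrightarrow>
     (\<forall>x\<in>L. \<forall>y\<in>L. f (x + y) = f x + f y) \<and> (\<forall>c. \<forall>x\<in>L. f (sc c x) = sc c (f x))"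

(* L is the direct product (not the direct sum) of its submodules H g. *)
definition graded_product ::
  "('k::comm_ring_1 \<Rightarrow> 'a::ab_group_add \<Rightarrow> 'a) \<Rightarrow> 'a set \<Rightarrow> ('g \<Rightarrow> 'a set) \<Rightarrow> bool" where
  "graded_product sc L H \<longleftrightarrow>
     module sc \<and> module.subspace sc L \<and> (\<forall>g. module.subspace sc (H g) \<and> H g \<subseteq> L) \<and>
     (\<exists>pr. (\<forall>g. linear_on sc L (pr g)) \<and>
           (\<forall>g h. \<forall>x\<in>H g. pr h x = (if h = g then x else 0)) \<and>
           bij_betw (\<lambda>x g. pr g x) L {x. \<forall>g. x g \<in> H g})"

definition graded_lie_algebra ::
  "('k::comm_ring_1 \<Rightarrow> 'a::ab_group_add \<Rightarrow> 'a) \<Rightarrow> 'a set \<Rightarrow> ('g::ab_group_add \<Rightarrow> 'a set) \<Rightarrow>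
   ('g \<Rightarrow> 'g \<Rightarrow> bit) \<Rightarrow> ('a \<Rightarrow> 'a \<Rightarrow> 'a) \<Rightarrow> bool" where
  "graded_lie_algebra sc L H B br \<longleftrightarrow>
     graded_product sc L H \<and>
     (\<forall>g h. B g h = B h g) \<and> (\<forall>g g' h. B (g + g') h = B g h + B g' h) \<and>
     (\<forall>x\<in>L. \<forall>y\<in>L. br x y \<in> L) \<and>
     (\<forall>x\<in>L. linear_on sc L (br x) \<and> linear_on sc L (\<lambda>y. br y x)) \<and>
     (\<forall>g h. \<forall>u\<in>H g. \<forall>v\<in>H h. br u v \<in> H (g + h)) \<and>
     (\<forall>g h. \<forall>u\<in>H g. \<forall>v\<in>H h. br u v = - signed (B g h) (br v u)) \<and>
     (\<forall>g h i. \<forall>u\<in>H g. \<forall>v\<in>H h. \<forall>w\<in>H i.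
        br u (br v w) = br (br u v) w + signed (B g h) (br v (br u w)))"

definition differential_on ::
  "('k \<Rightarrow> 'a::ab_group_add \<Rightarrow> 'a) \<Rightarrow> 'a set \<Rightarrow> ('a \<Rightarrow> 'a) \<Rightarrow> bool" where
  "differential_on sc L D \<longleftrightarrow> linear_on sc L D \<and> (\<forall>x\<in>L. D x \<in> L \<and> D (D x) = 0)"

(* tp g is the total parity of degree g. *)
definition dg_lie_algebra ::
  "('k::comm_ring_1 \<Rightarrow> 'a::ab_group_add \<Rightarrow> 'a) \<Rightarrow> 'a set \<Rightarrow> ('g::ab_group_add \<Rightarrow> 'a set) \<Rightarrow>
   ('g \<Rightarrow> 'g \<Rightarrow> bit) \<Rightarrow> ('g \<Rightarrow> bit) \<Rightarrow> ('a \<Rightarrow> 'a \<Rightarrow> 'a) \<Rightarrow> ('a \<Rightarrow> 'a) \<Rightarrow> bool" where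
  "dg_lie_algebra sc L H B tp br D \<longleftrightarrow>
     graded_lie_algebra sc L H B br \<and> differential_on sc L D \<and>
     (\<forall>g h. \<forall>u\<in>H g. \<forall>v\<in>H h. D (br u v) = br u (D v) + signed (tp h) (br (D u) v))"

definition total_parity :: "bit \<times> int \<Rightarrow> bit" where
  "total_parity = (\<lambda>(a, r). a + of_int r)"

definition bideg_form :: "bit \<times> int \<Rightarrow> bit \<times> int \<Rightarrow> bit" where
  "bideg_form g h = total_parity g * total_parity h"

lemma part_homogeneous:
  assumes "graded_module s V" and "v \<in> V a"
  shows "part V b v = (if b = a then v else 0)"
proof -
  interpret module s using assms by (simp add: graded_module_def)
  have sub: "subspace (V c)" for c using assms by (simp add: graded_module_def)
  have uniq: "\<exists>!p. p \<in> V 0 \<times> V 1 \<and> v = fst p + snd p"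
    using assms by (simp add: graded_module_def)
  have disj: "x = y" if "x \<in> V b" "v - x \<in> V (b + 1)" "y \<in> V b" "v - y \<in> V (b + 1)" for x y
  proof (cases "b = 0")
    case True
    then show ?thesis using uniq that by (auto simp: Ex1_def) (metis add_diff_cancel_left' diff_add_cancel add.commute)
  next
    case False
    then have "b = 1" by simp
    then have "(v - x, x) \<in> V 0 \<times> V 1" "(v - y, y) \<in> V 0 \<times> V 1" using that by auto
    with uniq show ?thesis unfolding Ex1_def by (metis diff_add_cancel fst_conv snd_conv)
  qed
  have "b = a \<or> b + 1 = a" by (cases a; cases b) simp_all
  then have "(if b = a then v else 0) \<in> V b \<and> v - (if b = a then v else 0) \<in> V (b + 1)"
    using assms(2) sub[THEN subspace_0] by auto
  then show ?thesis unfolding part_def using disj by (intro the_equality) auto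
qed

lemma multilinear_zero:
  assumes "multilinear s t f" and "0 \<in> set vs"
  shows "f vs = 0"
proof -
  obtain us ws where vs: "vs = us @ 0 # ws" using assms(2) by (meson split_list)
  interpret module_hom s t "\<lambda>v. f (us @ v # ws)"
    using assms(1) by (simp add: multilinear_def)
  show ?thesis using zero vs by simp
qed

lemma circ_homogeneous:
  assumes V: "graded_module s V" and mult: "multilinear s s \<phi>" "multilinear s s \<psi>"
    and hom: "homogeneous V as vs" and len: "length vs + 1 = k + l"
  shows "circ V k l q \<phi> \<psi> vs =
    (\<Sum>i<k. signed (sum_list (take i as) * q + of_nat (i * (l - 1)))
       (\<phi> (take i vs @ \<psi> (take l (drop i vs)) # drop (i + l) vs)))"
proof -
  have [simp]: "length as = length vs"
    using hom by (simp add: homogeneous_def list_all2_lengthD)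
  have nth: "vs ! j \<in> V (as ! j)" if "j < length vs" for j
    using hom that by (simp add: homogeneous_def list_all2_conv_all_nth)
  have same: "map2 (part V) as vs = vs"
    by (rule nth_equalityI) (auto simp: part_homogeneous[OF V nth])
  have vanish: "\<phi> (take i ws @ \<psi> (take l (drop i ws)) # drop (i + l) ws) = 0"
    if bs: "length bs = length vs" "bs \<noteq> as" "ws = map2 (part V) bs vs" for bs ws i
  proof -
    obtain j where "j < length vs" "bs ! j \<noteq> as ! j"
      using bs nth_equalityI[of bs as] by auto
    then have "ws ! j = 0" "j < length ws" using that by (auto simp: part_homogeneous[OF V nth])
    then have "0 \<in> set ws" by (metis nth_mem)
    also have "ws = take i ws @ take l (drop i ws) @ drop (i + l) ws"
      by (metis append_take_drop_id drop_drop add.commute)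
    finally consider "0 \<in> set (take i ws)" | "0 \<in> set (take l (drop i ws))"
      | "0 \<in> set (drop (i + l) ws)" by (metis Un_iff set_append)
    then show ?thesis
      by cases (auto intro!: multilinear_zero[OF mult(1)] simp: multilinear_zero[OF mult(2)])
  qed
  have fin: "finite {bs :: bit list. length bs = length vs}"
  proof -
    have "(UNIV :: bit set) = {0, 1}" by (auto intro: bit_not_zero_iff[THEN iffD1])
    then have "finite (UNIV :: bit set)" by (metis finite.emptyI finite_insert)
    from finite_lists_length_eq[OF this] show ?thesis by simp
  qed
  have zero: "signed b (0 :: 'b) = 0" for b by (simp add: signed_def)
  show ?thesis
    unfolding circ_def Let_def
    by (subst sum.remove[OF fin, of "as"]) (auto simp: same vanish zero intro!: sum.neutral)
qed

end

(* After shifting all parities by one and twisting cochains by signs (the functions eps and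
   operator), the modified Gerstenhaber bracket becomes the commutator of Koszul-signed insertion
   operators, cyclicity becomes Koszul-signed invariance under rotation, and the inner product
   becomes symplectic. A cochain psi then acts on cyclic forms as a derivation of cyclic words.
   Applying two derivations in turn gives one nested insertion plus two insertions at disjoint
   places, and the latter part is graded symmetric; hence the action of a bracket is the graded
   commutator of the actions, and an A-infinity structure acts with square zero (even if 2 is not
   invertible, since the disjoint insertions cancel in pairs). For cyclic phi and psi, the bracket
   corresponds to psi acting on the form of phi, so that this one identity contains the Jacobi
   identity, the equation D^2 = 0 and the Leibniz rule for D. *)

theory Submission
  imports Defs
begin

text \<open>\<open>eps\<close> is the sign of the isomorphism between the tensor powers of V and of
  its shift, with exponent the sum of (n - j)|v_j|. Up to factors depending only on the word and on
  total parities, it turns the insertion of a factor of parity q into one of arity k into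
  Koszul-signed insertion times (-1)^((k-1)q), and precisely this factor distinguishes the modified
  bracket from the Gerstenhaber bracket. Only the total parity (parity plus degree) survives the
  shift; it may be constant while the parities of the components vary with the arity, as for an
  A-infinity structure. Sums over parities are therefore reindexed by total parities, and all
  arities are treated at once. The obstacle is that signs depend on parities, which a vector does
  not determine: zero has both, a general vector neither. Hence the calculus runs on words of
  labelled letters, and multilinear extension carries the results back to vectors. For cyclic
  cochains it is Hamiltonian mechanics: the form of a cochain is a Hamiltonian of its operator, and
  Poisson brackets of Hamiltonians belong to commutators.\<close>

declare add_bit_eq_xor [simp del] mult_bit_eq_and [simp del]

section \<open>Signs with exponents in the field with two elements\<close>

lemma bit_self: "(x::bit) + x = 0" "x + (x + y) = y" "x * x = x" "x * (x * y) = x * y" "- x = x" "x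
    - y = x + y"
  by (cases x; cases y; simp)+

text \<open>Normalises sign exponents: products are multiplied out and sorted, equal summands cancel
  in pairs, squares collapse. For this \<open>+\<close> and \<open>*\<close> on \<open>bit\<close>
  must stay ring operations and not be rewritten to bitwise ones.\<close>

lemmas bit_ring = distrib_left distrib_right ac_simps bit_self

lemma signed_0 [simp]: "signed 0 x = x" and signed_1 [simp]: "signed 1 x = - x"
  and signed_zero [simp]: "signed b 0 = 0"
  by (simp_all add: signed_def)

lemma signed_signed [simp]: "signed a (signed b x) = signed (a + b) x"
  by (cases a; cases b; simp add: signed_def)

lemma signed_add: "signed b (x + y) = signed b x + signed b y"
  by (simp add: signed_def)

lemma signed_diff: "signed b (x - y) = signed b x - signed b y"
  by (simp add: signed_def)

lemma signed_uminus: "signed b (- x) = signed (b + 1) x" and uminus_signed: "- signed b x = signed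
    (b + 1) x"
  by (cases b; simp add: signed_def)+

lemma signed_sum: "signed b (\<Sum>i\<in>I. f i) = (\<Sum>i\<in>I. signed b (f i))"
  by (simp add: signed_def sum_negf)

lemma signed_cong: "a = b \<Longrightarrow> signed a x = signed b x"
  by simp

section \<open>Sums over splittings and rotations of a list\<close>

text \<open>Empty pieces are included, so a list of n entries has n + 1 splittings. Recursion on the
  list replaces index arithmetic by structural induction.\<close>

fun split_sum :: "('x list \<Rightarrow> 'x list \<Rightarrow> 'a::comm_monoid_add) \<Rightarrow> 'x list \<Rightarrow> 'a" where
  "split_sum G [] = G [] []"
| "split_sum G (x # xs) = G [] (x # xs) + split_sum (\<lambda>a b. G (x # a) b) xs"

lemma split_sum_cong:
  "(\<And>a b. xs = a @ b \<Longrightarrow> G a b = H a b) \<Longrightarrow> split_sum G xs = split_sum H xs"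
proof (induction xs arbitrary: G H)
  case (Cons x xs)
  have "split_sum (\<lambda>a. G (x # a)) xs = split_sum (\<lambda>a. H (x # a)) xs"
    by (rule Cons.IH) (simp add: Cons.prems)
  then show ?case by (simp add: Cons.prems)
qed simp

lemma split_sum_add: "split_sum (\<lambda>a b. G a b + H a b) xs = split_sum G xs + split_sum H xs"
  by (induction xs arbitrary: G H) (simp_all add: ac_simps)

lemma split_sum_zero [simp]: "split_sum (\<lambda>a b. 0) xs = 0"
  by (induction xs) simp_all

lemma split_sum_signed: "split_sum (\<lambda>a b. signed c (G a b)) xs = signed c (split_sum G xs)"
  by (induction xs arbitrary: G) (simp_all add: signed_add)

lemma split_sum_uminus:
  fixes G :: "'x list \<Rightarrow> 'x list \<Rightarrow> 'a::ab_group_add"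
  shows "split_sum (\<lambda>a b. - G a b) xs = - split_sum G xs"
  by (induction xs arbitrary: G) (simp_all)

lemma split_sum_sum:
  "split_sum (\<lambda>a b. \<Sum>i\<in>I. G i a b) xs = (\<Sum>i\<in>I. split_sum (G i) xs)"
  by (induction xs arbitrary: G) (simp_all add: sum.distrib)

lemma split_sum_add_fun: "split_sum (\<lambda>a b. G a b + H a b) = (\<lambda>xs. split_sum G xs + split_sum H xs)"
  and split_sum_zero_fun [simp]: "split_sum (\<lambda>a b. 0) = (\<lambda>xs. 0)"
  by (simp_all add: fun_eq_iff split_sum_add)

lemma split_sum_signed_fun: "split_sum (\<lambda>a b. signed c (G a b)) = (\<lambda>xs. signed c (split_sum G xs))"
  by (simp add: fun_eq_iff split_sum_signed)

lemma split_sum_map: "split_sum G (map h xs) = split_sum (\<lambda>a b. G (map h a) (map h b)) xs"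
  by (induction xs arbitrary: G) simp_all

text \<open>The cut falls before or after the marked entry x; this decides which piece contains a
  given letter.\<close>

lemma split_sum_append:
  "split_sum G (us @ x # ws) =
     split_sum (\<lambda>a b. G a (b @ x # ws)) us + split_sum (\<lambda>a b. G (us @ x # a) b) ws"
  by (induction us arbitrary: G) (simp_all add: ac_simps)

text \<open>Both sides run over the ways to cut xs into three pieces.\<close>

lemma split_sum_assoc:
  "split_sum (\<lambda>a bc. split_sum (\<lambda>b c. G a b c) bc) xs
   = split_sum (\<lambda>ab c. split_sum (\<lambda>a b. G a b c) ab) xs"
proof (induction xs arbitrary: G)
  case (Cons x xs)
  show ?case
    by (simp add: split_sum_add ac_simps Cons[of "\<lambda>a. G (x # a)"])
qed simp

lemma split_sum_atMost:
  "split_sum G xs = (\<Sum>i\<le>length xs. G (take i xs) (drop i xs))"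
proof (induction xs arbitrary: G)
  case (Cons x xs)
  show ?case
    by (simp add: Cons sum.atMost_Suc_shift del: sum.atMost_Suc)
qed simp

text \<open>A letter \<open>(a, v)\<close> stands for a vector of parity a; its weight is its parity after the shift.\<close>

definition letter_wt :: "bit \<times> 'v \<Rightarrow> bit" where
  "letter_wt x = fst x + 1"

definition wt :: "(bit \<times> 'v) list \<Rightarrow> bit" where
  "wt xs = sum_list (map letter_wt xs)"

lemma wt_Nil [simp]: "wt [] = 0"
  and wt_Cons [simp]: "wt (x # xs) = letter_wt x + wt xs"
  and wt_append [simp]: "wt (xs @ ys) = wt xs + wt ys"
  by (simp_all add: wt_def)

text \<open>The Koszul-signed sum over all rotations. The first letter is kept aside because n
  letters have only n rotations: cutting the other n - 1 letters gives each of them once, whereas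
  cutting all n letters would count the unrotated word twice. The sign is that of moving the block b
  in front of x # a.\<close>

fun cyclic_sum :: "((bit \<times> 'v) list \<Rightarrow> 'a::ab_group_add) \<Rightarrow> (bit \<times> 'v) list \<Rightarrow> 'a" where
  "cyclic_sum G [] = 0"
| "cyclic_sum G (x # xs) =
     split_sum (\<lambda>a b. signed (wt b * (letter_wt x + wt a)) (G (b @ x # a))) xs"

definition koszul_cyclic :: "((bit \<times> 'v) list \<Rightarrow> 'a::ab_group_add) \<Rightarrow> bool" where
  "koszul_cyclic F \<longleftrightarrow> (\<forall>xs x. F (xs @ [x]) = signed (letter_wt x * wt xs) (F (x # xs)))"

lemma koszul_cyclic_append:
  assumes "koszul_cyclic F"
  shows "F (xs @ ys) = signed (wt xs * wt ys) (F (ys @ xs))"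
proof (induction ys arbitrary: xs rule: rev_induct)
  case (snoc y ys)
  have "F (xs @ ys @ [y]) = signed (letter_wt y * wt (xs @ ys)) (F ((y # xs) @ ys))"
    using assms unfolding koszul_cyclic_def by (metis append_Cons append_assoc)
  also have "\<dots> = signed (wt xs * wt (ys @ [y])) (F (ys @ y # xs))"
    unfolding snoc by (simp, rule signed_cong, simp add: bit_ring)
  finally show ?case by simp
qed simp

text \<open>Rotating the word only permutes its rotations, and the Koszul signs of successive
  rotations compose.\<close>

lemma cyclic_sum_cyclic: "koszul_cyclic (cyclic_sum G)"
  unfolding koszul_cyclic_def
proof (intro allI)
  fix xs x
  show "cyclic_sum G (xs @ [x]) = signed (letter_wt x * wt xs) (cyclic_sum G (x # xs))"
  proof (cases xs)
    case (Cons y ys)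
    have "split_sum (\<lambda>a b. signed ((wt b + letter_wt x) * (letter_wt y + wt a)) (G (b @ x # y # a))) ys
      = split_sum (\<lambda>a b. signed (letter_wt x * wt xs + wt b * (letter_wt x + (letter_wt y + wt a)))
          (G (b @ x # y # a))) ys"
      by (rule split_sum_cong, rule signed_cong) (auto simp: Cons bit_ring)
    then show ?thesis
      by (simp add: Cons split_sum_append[of _ ys x "[]"] signed_add split_sum_signed[symmetric]
          bit_self ac_simps)
  qed simp
qed

lemma cyclic_sum_cong: "(\<And>xs. G xs = H xs) \<Longrightarrow> cyclic_sum G xs = cyclic_sum H xs"
  by (metis ext)

lemma cyclic_sum_add: "cyclic_sum (\<lambda>xs. G xs + H xs) xs = cyclic_sum G xs + cyclic_sum H xs"
  by (cases xs) (simp_all add: signed_add split_sum_add)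

lemma cyclic_sum_signed: "cyclic_sum (\<lambda>xs. signed c (G xs)) xs = signed c (cyclic_sum G xs)"
  by (cases xs) (simp_all add: split_sum_signed[symmetric] ac_simps)

lemma cyclic_sum_sum: "cyclic_sum (\<lambda>xs. \<Sum>i\<in>I. G i xs) xs = (\<Sum>i\<in>I. cyclic_sum (G i) xs)"
  by (cases xs) (simp_all add: signed_sum split_sum_sum)

lemma cyclic_sum_zero [simp]: "cyclic_sum (\<lambda>xs. 0) xs = 0"
  by (cases xs) simp_all

lemma cyclic_sum_atMost:
  assumes "length xs = Suc n"
  shows "cyclic_sum G xs = (\<Sum>i\<le>n. signed (wt (take i xs) * wt (drop i xs)) (G (rotate i xs)))"
proof -
  define h where "h i = signed (wt (take i xs) * wt (drop i xs)) (G (drop i xs @ take i xs))" for i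
  obtain y ys where xs: "xs = y # ys" and len: "length ys = n"
    using assms by (cases xs) auto
  \<comment> \<open>The recursive definition produces the rotations by 1, ..., n + 1; the last of
    them is the rotation by 0, so the index range can be shifted.\<close>
  have "cyclic_sum G xs = (\<Sum>i\<le>n. h (Suc i))"
    unfolding xs h_def cyclic_sum.simps split_sum_atMost len
    by (rule sum.cong) (simp_all add: mult.commute del: wt_append)
  also have "\<dots> = (\<Sum>i\<le>n. h i)"
  proof -
    have "h 0 + (\<Sum>i\<le>n. h (Suc i)) = (\<Sum>i\<le>n. h i) + h (Suc n)"
      by (metis sum.atMost_Suc_shift sum.atMost_Suc)
    moreover have "h (Suc n) = h 0" by (simp add: h_def assms)
    ultimately show ?thesis by simp
  qed
  finally show ?thesis
    unfolding h_def using assms by (simp add: rotate_drop_take)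
qed

text \<open>Cutting the cyclic word of xs into two arcs: the first letter lies in one of the two
  arcs, and xs is cut accordingly into three pieces.\<close>

lemma cyclic_sum_split_sum:
  "cyclic_sum (split_sum H) (x # xs) =
     split_sum (\<lambda>a. split_sum (\<lambda>b c. signed ((wt b + wt c) * (letter_wt x + wt a)) (H b (c @ x # a))
       + signed (wt c * (letter_wt x + wt a + wt b)) (H (c @ x # a) b))) xs"
proof -
  have 1: "split_sum (\<lambda>a b. split_sum (\<lambda>c d. signed ((wt c + wt d) * (letter_wt x + wt a)) (H c (d @
      x # a))) b) xs
      = split_sum (\<lambda>a b. signed (wt b * (letter_wt x + wt a)) (split_sum (\<lambda>c d. H c (d @ x # a)) b)) xs"
    by (rule split_sum_cong, unfold split_sum_signed[symmetric], rule split_sum_cong) auto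
  have "split_sum (\<lambda>a. split_sum (\<lambda>b c. signed (wt c * (letter_wt x + wt a + wt b)) (H (c @ x # a)
      b))) xs
      = split_sum (\<lambda>a b. split_sum (\<lambda>c d. signed (wt b * (letter_wt x + wt c + wt d)) (H (b @ x # c)
          d)) a) xs"
    by (rule split_sum_assoc)
  also have "\<dots> = split_sum (\<lambda>a b. signed (wt b * (letter_wt x + wt a)) (split_sum (\<lambda>c d. H (b @ x #
      c) d) a)) xs"
    by (rule split_sum_cong, unfold split_sum_signed[symmetric], rule split_sum_cong) (auto simp:
        ac_simps)
  finally show ?thesis
    by (simp add: split_sum_append signed_add split_sum_add_fun split_sum_add 1)
qed

text \<open>In the expansion \<open>cyclic_sum_split_sum\<close> each pair of arcs occurs in both
  orders, so exchanging the arcs exchanges the two summands.\<close>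

lemma cyclic_sum_swap:
  "cyclic_sum (split_sum H) xs = cyclic_sum (split_sum (\<lambda>a b. signed (wt a * wt b) (H b a))) xs"
proof (cases xs)
  case (Cons x ys)
  show ?thesis
    unfolding Cons cyclic_sum_split_sum signed_signed
    apply (intro split_sum_cong)
    apply (rule trans[OF add.commute])
    apply (intro arg_cong2[where f="(+)"] signed_cong)
     apply (simp_all add: bit_ring)
    done
qed simp

text \<open>The hypothesis makes the two summands of \<open>cyclic_sum_split_sum\<close> opposite to
  each other, so the terms cancel one by one; \<open>cyclic_sum_swap\<close> alone would only show
  that twice the sum vanishes.\<close>

lemma cyclic_sum_antisym:
  assumes "\<And>a b. H b a = - signed (wt a * wt b) (H a b)"
  shows "cyclic_sum (split_sum H) xs = 0"
proof (cases xs)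
  case (Cons x ys)
  have "signed ((wt b + wt c) * (letter_wt x + wt a)) (H b (c @ x # a))
       + signed (wt c * (letter_wt x + wt a + wt b)) (H (c @ x # a) b) = 0" for a b c
  proof -
    have "signed ((wt b + wt c) * (letter_wt x + wt a)) (H b (c @ x # a))
      = - signed (wt c * (letter_wt x + wt a + wt b)) (H (c @ x # a) b)"
      by (subst assms) (simp only: uminus_signed signed_signed wt_append wt_Cons,
        rule signed_cong, simp add: bit_ring)
    then show ?thesis by simp
  qed
  then show ?thesis unfolding Cons cyclic_sum_split_sum by simp
qed simp

section \<open>Derivations acting on cyclic words\<close>

text \<open>The Lie derivative of the function F along the vector field P: in turn each arc y of the
  cyclic word is replaced by the letter P y. Rotating y to the front beforehand avoids a sign for P
  passing other letters.\<close>

definition lie_der ::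
  "((bit \<times> 'v) list \<Rightarrow> bit \<times> 'v) \<Rightarrow> ((bit \<times> 'v) list \<Rightarrow> 'a::ab_group_add) \<Rightarrow> (bit \<times> 'v) list \<Rightarrow> 'a" where
  "lie_der P F = cyclic_sum (split_sum (\<lambda>y z. F (P y # z)))"

lemma lie_der_cyclic: "koszul_cyclic (lie_der P F)"
  unfolding lie_der_def by (rule cyclic_sum_cyclic)

definition weight :: "bit \<Rightarrow> ((bit \<times> 'v) list \<Rightarrow> bit \<times> 'v) \<Rightarrow> bool" where
  "weight t P \<longleftrightarrow> (\<forall>xs. letter_wt (P xs) = t + wt xs)"

text \<open>The insertion of Q into F on the shifted module; for Q of weight u the sign is the
  Koszul sign of Q passing the prefix p.\<close>

definition nest_sum ::
  "bit \<Rightarrow> ((bit \<times> 'v) list \<Rightarrow> 'a::ab_group_add) \<Rightarrow> ((bit \<times> 'v) list \<Rightarrow> bit \<times> 'v) \<Rightarrow> (bit \<times> 'v) list \<Rightarrow> 'a"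
      where
  "nest_sum u F Q = split_sum (\<lambda>p. split_sum (\<lambda>y r. signed (u * wt p) (F (p @ Q y # r))))"

text \<open>P and Q act at disjoint places, each on an initial segment of its own arc; the sign is
  that of Q passing the arc a.\<close>

definition double_sum ::
  "((bit \<times> 'v) list \<Rightarrow> 'a::ab_group_add) \<Rightarrow> ((bit \<times> 'v) list \<Rightarrow> bit \<times> 'v) \<Rightarrow> bit \<Rightarrow> ((bit \<times> 'v) list \<Rightarrow>
      bit \<times> 'v) \<Rightarrow>
   (bit \<times> 'v) list \<Rightarrow> (bit \<times> 'v) list \<Rightarrow> 'a" where
  "double_sum F P u Q a b =
     split_sum (\<lambda>y z. split_sum (\<lambda>y' z'. signed (u * wt a) (F (P y # z @ Q y' # z'))) b) a"

lemma split_sum_commute: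
  "split_sum (\<lambda>a b. split_sum (\<lambda>c d. G a b c d) ys) xs = split_sum (\<lambda>c d. split_sum (\<lambda>a b. G a b c
      d) xs) ys"
  by (induction xs arbitrary: G) (simp_all add: split_sum_add)

text \<open>Cyclicity of F rotates the word until the letter made by Q comes first. The exchanged
  blocks have weights t + wt b and u + wt a; their product contains the sign t * u of exchanging the
  operators and the sign of exchanging the arcs, and its mixed terms match the signs inside the two
  double sums.\<close>

lemma double_sum_swap:
  assumes "koszul_cyclic F" "weight t P" "weight u Q"
  shows "double_sum F P u Q b a = signed (t * u + wt a * wt b) (double_sum F Q t P a b)"
proof -
  have "signed (u * wt b) (F (P y # z @ Q y' # z'))
      = signed (t * u + wt a * wt b) (signed (t * wt a) (F (Q y' # z' @ P y # z)))"
    if "b = y @ z" "a = y' @ z'" for y z y' z'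
  proof -
    have w: "letter_wt (P y) = t + wt y" "letter_wt (Q y') = u + wt y'"
      using assms by (simp_all add: weight_def)
    have "F ((P y # z) @ (Q y' # z')) = signed (wt (P y # z) * wt (Q y' # z')) (F ((Q y' # z') @ (P
        y # z)))"
      by (rule koszul_cyclic_append[OF assms(1)])
    then show ?thesis
      by (simp add: that w) (rule signed_cong, simp add: bit_ring)
  qed
  then have "double_sum F P u Q b a
      = split_sum (\<lambda>y z. split_sum (\<lambda>y' z'. signed (t * u + wt a * wt b) (signed (t * wt a) (F (Q y'
          # z' @ P y # z)))) a) b"
    unfolding double_sum_def by (intro split_sum_cong) simp
  then show ?thesis
    unfolding double_sum_def
    by (simp only: split_sum_signed) (subst split_sum_commute, simp add: split_sum_signed)
qed

text \<open>The letter produced by Q is either an argument of P or another letter of the word.\<close>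

lemma lie_der_lie_der:
  assumes Q: "weight u Q"
  shows "lie_der Q (lie_der P F) xs =
    cyclic_sum (split_sum (\<lambda>b z. nest_sum u (\<lambda>ys. F (P ys # z)) Q b)) xs
    + cyclic_sum (split_sum (double_sum F P u Q)) xs"
proof -
  have w: "letter_wt (Q y) = u + wt y" for y using Q by (simp add: weight_def)
  \<comment> \<open>Here c = y @ a, and the rotated word is p @ Q y # a. In \<open>?W1\<close> the
    arc of P ends inside p, so P does not see Q y; in \<open>?W2\<close> it ends inside a, so Q y is
    among the arguments of P.\<close>
  let ?W1 = "\<lambda>c p. split_sum (\<lambda>y a. split_sum (\<lambda>y' z. signed (wt p * (u + wt c)) (F (P y' # z @ Q y
      # a))) p) c"
  let ?W2 = "\<lambda>c p. split_sum (\<lambda>y a. split_sum (\<lambda>r z. signed (wt p * (u + wt c)) (F (P (p @ Q y # r)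
      # z))) a) c"
  have 1: "lie_der P F (Q y # zs) = split_sum (\<lambda>a p.
      split_sum (\<lambda>y' z. signed (wt p * (u + wt y + wt a)) (F (P y' # z @ Q y # a))) p
      + split_sum (\<lambda>r z. signed (wt p * (u + wt y + wt a)) (F (P (p @ Q y # r) # z))) a) zs" for y zs
    by (simp add: lie_der_def split_sum_append signed_add split_sum_signed w)
  let ?K1 = "\<lambda>y a p. split_sum (\<lambda>y' z. signed (wt p * (u + wt y + wt a)) (F (P y' # z @ Q y # a))) p"
  let ?K2 = "\<lambda>y a p. split_sum (\<lambda>r z. signed (wt p * (u + wt y + wt a)) (F (P (p @ Q y # r) # z))) a"
  have "split_sum (\<lambda>y zs. lie_der P F (Q y # zs)) ys = split_sum ?W1 ys + split_sum ?W2 ys" for ys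
  proof -
    have "split_sum (\<lambda>y zs. lie_der P F (Q y # zs)) ys
        = split_sum (\<lambda>c p. split_sum (\<lambda>y a. ?K1 y a p + ?K2 y a p) c) ys"
      unfolding 1 by (rule split_sum_assoc)
    also have "\<dots> = split_sum (\<lambda>c p. ?W1 c p + ?W2 c p) ys"
    proof (rule split_sum_cong)
      fix c p
      show "split_sum (\<lambda>y a. ?K1 y a p + ?K2 y a p) c = ?W1 c p + ?W2 c p"
        unfolding split_sum_add[symmetric]
        by (rule split_sum_cong) (simp add: add.assoc)
    qed
    finally show ?thesis by (simp add: split_sum_add)
  qed
  then have "lie_der Q (lie_der P F) xs = cyclic_sum (split_sum ?W1) xs + cyclic_sum (split_sum ?W2) xs"
    unfolding lie_der_def[of Q] cyclic_sum_add[symmetric] by (rule cyclic_sum_cong)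
  \<comment> \<open>Exchanging the arcs puts p in front, and its sign wt p * wt c reduces the
    exponent to u * wt p.\<close>
  also have "cyclic_sum (split_sum ?W1) xs = cyclic_sum (split_sum (double_sum F P u Q)) xs"
    unfolding double_sum_def
    apply (subst cyclic_sum_swap)
    apply (intro arg_cong2[where f=cyclic_sum] refl ext split_sum_cong)
    apply (subst (2) split_sum_commute)
    apply (subst split_sum_signed[symmetric], intro split_sum_cong)+
    apply simp
    apply (rule signed_cong)
    apply (simp add: bit_ring)
    done
  also have "cyclic_sum (split_sum ?W2) xs = cyclic_sum (split_sum (\<lambda>b z. nest_sum u (\<lambda>ys. F (P ys #
      z)) Q b)) xs"
    (is "_ = cyclic_sum (split_sum ?N) xs")
  proof -
    have "split_sum (\<lambda>p c. signed (wt p * wt c) (?W2 c p)) ys = split_sum ?N ys" for ys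
    proof -
      have "split_sum (\<lambda>p c. signed (wt p * wt c) (?W2 c p)) ys
        = split_sum (\<lambda>p c. split_sum (\<lambda>y a. split_sum (\<lambda>r z. signed (u * wt p) (F (P (p @ Q y # r) #
            z))) a) c) ys"
        apply (intro split_sum_cong)
        apply (subst split_sum_signed[symmetric], intro split_sum_cong)+
        apply simp
        apply (rule signed_cong)
        apply (simp add: bit_ring)
        done
      also have "\<dots> = split_sum ?N ys"
        unfolding nest_sum_def split_sum_assoc ..
      finally show ?thesis .
    qed
    from cyclic_sum_cong[OF this] show ?thesis by (subst cyclic_sum_swap)
  qed
  finally show ?thesis by (simp add: add.commute)
qed

text \<open>By \<open>cyclic_sum_swap\<close> and \<open>double_sum_swap\<close> the two double sums
  differ by the sign t * u alone, because the signs of exchanging the arcs occur twice. They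
  therefore cancel in the commutator.\<close>

lemma lie_der_commutator:
  assumes F: "koszul_cyclic F" and P: "weight t P" and Q: "weight u Q"
  shows "lie_der Q (lie_der P F) xs - signed (t * u) (lie_der P (lie_der Q F) xs) =
    cyclic_sum (split_sum (\<lambda>b z. nest_sum u (\<lambda>ys. F (P ys # z)) Q b
       - signed (t * u) (nest_sum t (\<lambda>ys. F (Q ys # z)) P b))) xs"
proof -
  have "cyclic_sum (split_sum (double_sum F P u Q)) xs
      = signed (t * u) (cyclic_sum (split_sum (double_sum F Q t P)) xs)"
    apply (subst cyclic_sum_swap)
    apply (subst double_sum_swap[OF F P Q])
    apply (simp add: split_sum_signed_fun cyclic_sum_signed bit_self)
    done
  moreover have "cyclic_sum (split_sum (\<lambda>b z. nest_sum u (\<lambda>ys. F (P ys # z)) Q b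
       - signed (t * u) (nest_sum t (\<lambda>ys. F (Q ys # z)) P b))) xs
    = cyclic_sum (split_sum (\<lambda>b z. nest_sum u (\<lambda>ys. F (P ys # z)) Q b)) xs
      - signed (t * u) (cyclic_sum (split_sum (\<lambda>b z. nest_sum t (\<lambda>ys. F (Q ys # z)) P b)) xs)"
    unfolding diff_conv_add_uminus split_sum_add cyclic_sum_add uminus_signed split_sum_signed
        cyclic_sum_signed ..
  ultimately show ?thesis
    by (simp add: lie_der_lie_der[OF P] lie_der_lie_der[OF Q] signed_add)
qed

text \<open>\<open>lie_der_commutator\<close> with P = Q would give only twice this identity. Weight
  1 makes the double sum antisymmetric under exchange of its arcs, so it vanishes outright.\<close>

lemma lie_der_square:
  assumes F: "koszul_cyclic F" and P: "weight 1 P"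
  shows "lie_der P (lie_der P F) xs = cyclic_sum (split_sum (\<lambda>b z. nest_sum 1 (\<lambda>ys. F (P ys # z)) P
      b)) xs"
proof -
  have "double_sum F P 1 P b a = - signed (wt a * wt b) (double_sum F P 1 P a b)" for a b
    using double_sum_swap[OF F P P, of b a] by (simp add: uminus_signed add.commute)
  from cyclic_sum_antisym[of "double_sum F P 1 P", OF this] show ?thesis
    by (simp add: lie_der_lie_der[OF P])
qed

text \<open>F and G are Hamiltonians of P and Q with respect to \<omega>, and the Lie derivative of
  F along Q is their Poisson bracket. Arcs that avoid w give the insertions of Q into P directly.
  For arcs that contain w, antisymmetry of \<omega> and cyclicity of G turn the term into an
  insertion of P into Q.\<close>

lemma lie_der_hamiltonian:
  assumes F: "koszul_cyclic F" and G: "koszul_cyclic G"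
    and P: "weight t P" and Q: "weight u Q"
    and FP: "\<And>xs x. F (xs @ [x]) = \<omega> (P xs) x" and GQ: "\<And>xs x. G (xs @ [x]) = \<omega> (Q xs) x"
    and \<omega>: "\<And>x y. \<omega> y x = - signed (letter_wt x * letter_wt y) (\<omega> x y)"
  shows "lie_der Q F (xs @ [w]) =
    nest_sum u (\<lambda>ys. \<omega> (P ys) w) Q xs - signed (t * u) (nest_sum t (\<lambda>ys. \<omega> (Q ys) w) P xs)"
proof -
  have wP: "letter_wt (P y) = t + wt y" and wQ: "letter_wt (Q y) = u + wt y" for y
    using P Q by (simp_all add: weight_def)
  \<comment> \<open>With w as the distinguished first letter of the cyclic sum, the two terms below
    are those where the arc of Q avoids w and where it contains w.\<close>
  have "lie_der Q F (xs @ [w]) = signed (letter_wt w * wt xs) (lie_der Q F (w # xs))"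
    using lie_der_cyclic unfolding koszul_cyclic_def by blast
  also have "lie_der Q F (w # xs) =
      split_sum (\<lambda>a p. split_sum (\<lambda>y z. signed (wt p * (letter_wt w + wt a)) (F (Q y # z @ w # a))) p) xs
      + split_sum (\<lambda>a p. split_sum (\<lambda>r z. signed (wt p * (letter_wt w + wt a)) (F (Q (p @ w # r) #
          z))) a) xs"
    by (simp add: lie_der_def split_sum_append signed_add split_sum_signed split_sum_add)
  also have "split_sum (\<lambda>a p. split_sum (\<lambda>y z. signed (wt p * (letter_wt w + wt a)) (F (Q y # z @ w
      # a))) p) xs
    = signed (letter_wt w * wt xs) (nest_sum u (\<lambda>ys. \<omega> (P ys) w) Q xs)"
  proof -
    have "signed (wt p * (letter_wt w + wt a)) (F (Q y # z @ w # a))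
       = signed (letter_wt w * wt xs) (signed (u * wt a) (\<omega> (P (a @ Q y # z)) w))"
      if "xs = a @ p" "p = y @ z" for a p y z
    proof -
      have "F ((Q y # z @ [w]) @ a) = signed (wt (Q y # z @ [w]) * wt a) (F (a @ (Q y # z @ [w])))"
        by (rule koszul_cyclic_append[OF F])
      also have "F (a @ (Q y # z @ [w])) = \<omega> (P (a @ Q y # z)) w"
        using FP[of "a @ Q y # z" w] by simp
      finally show ?thesis
        by (simp add: that wQ) (rule signed_cong, simp add: bit_ring)
    qed
    then show ?thesis
      unfolding nest_sum_def split_sum_signed[symmetric] by (intro split_sum_cong) simp
  qed
  also have "split_sum (\<lambda>a p. split_sum (\<lambda>r z. signed (wt p * (letter_wt w + wt a)) (F (Q (p @ w #
      r) # z))) a) xs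
    = - signed (letter_wt w * wt xs + t * u) (nest_sum t (\<lambda>ys. \<omega> (Q ys) w) P xs)"
  proof -
    have "signed (wt p * (letter_wt w + (wt r + wt z))) (F (Q (p @ w # r) # z))
       = - signed (letter_wt w * (wt r + wt z + wt p) + t * u) (signed (t * wt r) (\<omega> (Q (r @ P z #
           p)) w))" for p r z
    proof -
      let ?c = "Q (p @ w # r)"
      \<comment> \<open>The letter \<open>?c\<close> made by Q moves to the last place, where F
        pairs it with P z. Reversing \<omega> gives a value of G with last letter P z, and rotating
        G brings w to the last place.\<close>
      have "F (?c # z) = signed (letter_wt ?c * wt z) (F (z @ [?c]))"
        using koszul_cyclic_append[OF F, of "[?c]" z] by simp
      also have "F (z @ [?c]) = - signed (letter_wt (P z) * letter_wt ?c) (\<omega> ?c (P z))"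
        unfolding FP by (subst \<omega>) (simp add: mult.commute)
      also have "\<omega> ?c (P z) = G ((p @ [w]) @ (r @ [P z]))"
        using GQ[of "p @ w # r" "P z"] by simp
      also have "\<dots> = signed (wt (p @ [w]) * wt (r @ [P z])) (G ((r @ P z # p) @ [w]))"
        using koszul_cyclic_append[OF G, of "p @ [w]" "r @ [P z]"] by simp
      finally show ?thesis
        by (simp add: GQ[of "r @ P z # p" w, simplified] uminus_signed signed_uminus wP wQ)
           (rule signed_cong, simp add: bit_ring)
    qed
    then have "split_sum (\<lambda>a p. split_sum (\<lambda>r z. signed (wt p * (letter_wt w + wt a)) (F (Q (p @ w #
        r) # z))) a) xs
      = split_sum (\<lambda>a p. split_sum (\<lambda>r z. - signed (letter_wt w * wt xs + t * u) (signed (t * wt r)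
          (\<omega> (Q (r @ P z # p)) w))) a) xs"
      by (intro split_sum_cong) (auto simp: add.assoc)
    then show ?thesis
      unfolding nest_sum_def split_sum_assoc split_sum_signed split_sum_uminus .
  qed
  finally show ?thesis
    by (simp add: signed_add signed_uminus uminus_signed bit_ring)
qed

section \<open>Multilinear maps on a graded module\<close>

lemma hom_zero: "module s \<Longrightarrow> module t \<Longrightarrow> module_hom s t (\<lambda>x. 0)"
  by (simp add: module_hom_iff module.scale_zero_right)

lemma hom_add: "module_hom s t f \<Longrightarrow> module_hom s t g \<Longrightarrow> module_hom s t (\<lambda>x. f x + g x)"
  by (auto simp: module_hom_iff module.scale_right_distrib ac_simps)

lemma hom_uminus: "module_hom s t f \<Longrightarrow> module_hom s t (\<lambda>x. - f x)"
  by (auto simp: module_hom_iff module.scale_minus_right)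

lemma hom_signed: "module_hom s t f \<Longrightarrow> module_hom s t (\<lambda>x. signed c (f x))"
  by (cases c) (simp_all add: hom_uminus)

lemma signed_inject: "signed c x = signed c y \<longleftrightarrow> x = y"
  by (simp add: signed_def)

lemma hom_diff: "module_hom s t f \<Longrightarrow> module_hom s t g \<Longrightarrow> module_hom s t (\<lambda>x. f x - g x)"
  using hom_add[OF _ hom_uminus, of s t f g] by simp

lemma hom_comp: "module_hom s t f \<Longrightarrow> module_hom t u g \<Longrightarrow> module_hom s u (\<lambda>x. g (f x))"
  by (auto simp: module_hom_iff)

lemma hom_sum:
  assumes "module s" "module t" "\<And>i. i \<in> I \<Longrightarrow> module_hom s t (f i)"
  shows "module_hom s t (\<lambda>x. \<Sum>i\<in>I. f i x)"
  using assms(3) by (induction I rule: infinite_finite_induct) (auto intro: hom_add hom_zero assms)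

lemma hom_split_sum:
  assumes "module s" "module t" "\<And>a b. xs = a @ b \<Longrightarrow> module_hom s t (H a b)"
  shows "module_hom s t (\<lambda>v. split_sum (\<lambda>a b. H a b v) xs)"
  unfolding split_sum_atMost by (intro hom_sum assms) simp

lemma hom_0: "module_hom s t f \<Longrightarrow> f 0 = 0"
  by (metis add_cancel_right_right module_hom_iff)

lemma hom_signed_arg: "module_hom s t f \<Longrightarrow> f (signed c x) = signed c (f x)"
  by (simp add: signed_def module_hom.neg)

lemma hom_sum_arg: "module_hom s t f \<Longrightarrow> f (\<Sum>i\<in>I. g i) = (\<Sum>i\<in>I. f (g i))"
  by (rule module_hom.sum)

lemma hom_split_sum_arg: "module_hom s t f \<Longrightarrow> f (split_sum G xs) = split_sum (\<lambda>a b. f (G a b)) xs"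
  unfolding split_sum_atMost by (rule module_hom.sum)

lemma module_mult: "module ((*) :: 'k::comm_ring_1 \<Rightarrow> 'k \<Rightarrow> 'k)"
  by unfold_locales (simp_all add: algebra_simps)

lemma UNIV_bit: "(UNIV :: bit set) = {0, 1}"
  by (auto intro: bit_not_zero_iff[THEN iffD1])

lemma finite_bit_lists: "finite {as :: bit list. length as = n}"
proof -
  have "finite (UNIV :: bit set)" by (simp add: UNIV_bit)
  from finite_lists_length_eq[OF this] show ?thesis by simp
qed

lemma multilinear_homD: "multilinear s t f \<Longrightarrow> module_hom s t (\<lambda>v. f (us @ v # ws))"
  by (simp add: multilinear_def)

text \<open>Each entry contributes its parity once for every entry to its right.\<close>

fun eps :: "bit list \<Rightarrow> bit" where
  "eps [] = 0"
| "eps (a # as) = of_nat (length as) * a + eps as"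

lemma eps_append: "eps (as @ bs) = eps as + of_nat (length bs) * sum_list as + eps bs"
  by (induction as) (simp_all add: bit_ring)

lemma wt_eq: "wt xs = sum_list (map fst xs) + of_nat (length xs)"
  by (induction xs) (simp_all add: letter_wt_def ac_simps)

locale graded_space =
  fixes s :: "'k::comm_ring_1 \<Rightarrow> 'v::ab_group_add \<Rightarrow> 'v" and V :: "bit \<Rightarrow> 'v set"
  assumes graded: "graded_module s V"
begin

section \<open>Homogeneous parts, and extension of formulas from homogeneous arguments\<close>

lemma module_s: "module s" using graded by (simp add: graded_module_def)

lemma V_0: "0 \<in> V a" and V_add: "x \<in> V a \<Longrightarrow> y \<in> V a \<Longrightarrow> x + y \<in> V a"
  and V_scale: "x \<in> V a \<Longrightarrow> s c x \<in> V a"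
  using graded module.subspace_0[OF module_s] module.subspace_add[OF module_s]
      module.subspace_scale[OF module_s]
  by (auto simp: graded_module_def)

lemma V_uminus: "x \<in> V a \<Longrightarrow> - x \<in> V a"
  using V_scale[of x a "-1"] by (simp add: module.scale_minus_left[OF module_s] module.scale_one[OF
      module_s])

lemma V_signed: "x \<in> V a \<Longrightarrow> signed c x \<in> V a"
  by (simp add: signed_def V_uminus)

lemma V_sum: "(\<And>i. i \<in> I \<Longrightarrow> f i \<in> V a) \<Longrightarrow> (\<Sum>i\<in>I. f i) \<in> V a"
  by (induction I rule: infinite_finite_induct) (auto intro: V_0 V_add)

lemma V_split_sum: "(\<And>a b. xs = a @ b \<Longrightarrow> G a b \<in> V c) \<Longrightarrow> split_sum G xs \<in> V c"
  unfolding split_sum_atMost by (rule V_sum) simp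

lemmas part_hom = part_homogeneous[OF graded]

lemma V_decomp: "\<exists>x y. x \<in> V 0 \<and> y \<in> V 1 \<and> v = x + y"
  using graded unfolding graded_module_def by (metis mem_Sigma_iff prod.collapse)

lemma part_eqI:
  assumes "x \<in> V a" "y \<in> V (a + 1)" "v = x + y"
  shows "part V a v = x"
  unfolding part_def
proof (rule the_equality)
  show "x \<in> V a \<and> v - x \<in> V (a + 1)" using assms by simp
  fix z assume z: "z \<in> V a \<and> v - z \<in> V (a + 1)"
  then have "z - x \<in> V a" using V_add[of z a "- x"] V_uminus assms by simp
  moreover have "- (v - z) \<in> V (a + 1)" using V_uminus z by blast
  then have "y + - (v - z) \<in> V (a + 1)" by (rule V_add[OF assms(2)])
  then have "z - x \<in> V (a + 1)" using assms(3) by (simp add: algebra_simps)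
  ultimately have "part V a (z - x) = z - x" "part V a (z - x) = 0"
    using part_hom[of "z - x" a a] part_hom[of "z - x" "a + 1" a] by simp_all
  then show "z = x" by simp
qed

lemma part_decomp: "part V a v \<in> V a" "part V 0 v + part V 1 v = v"
proof -
  obtain x y where v: "x \<in> V 0" "y \<in> V 1" "v = x + y" using V_decomp by blast
  then have "part V 0 v = x" "part V 1 v = y"
    using part_eqI[of x 0 y v] part_eqI[of y 1 x v] by (simp_all add: ac_simps)
  with v show "part V a v \<in> V a" "part V 0 v + part V 1 v = v"
    by (cases a; simp)+
qed

lemma part_linear: "module_hom s s (part V a)"
proof -
  have c: "part V a v + part V (a + 1) v = v" for v
    using part_decomp(2)[of v] by (cases a) (simp_all add: add.commute)
  have "part V a (x + y) = part V a x + part V a y" for x y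
    by (rule part_eqI[of _ _ "part V (a + 1) x + part V (a + 1) y"])
      (simp_all add: V_add part_decomp(1), metis c add.assoc add.commute)
  moreover have "part V a (s k x) = s k (part V a x)" for k x
    by (rule part_eqI[of _ _ "s k (part V (a + 1) x)"])
      (simp_all add: V_scale part_decomp(1), metis c module.scale_right_distrib[OF module_s])
  ultimately show ?thesis by (simp add: module_hom_iff module_s)
qed

lemma part_part: "part V b (part V a v) = (if b = a then part V a v else 0)"
  by (rule part_hom[OF part_decomp(1)])

text \<open>Projecting each letter to its parity makes the statements below hold for all words of
  letters, without a homogeneity hypothesis.\<close>

definition proj :: "(bit \<times> 'v) list \<Rightarrow> 'v list" where
  "proj xs = map (\<lambda>(a, v). part V a v) xs"

definition projx :: "(bit \<times> 'v) list \<Rightarrow> (bit \<times> 'v) list" where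
  "projx xs = map (\<lambda>(a, v). (a, part V a v)) xs"

lemma proj_simps [simp]: "proj [] = []" "proj (x # xs) = part V (fst x) (snd x) # proj xs"
  "proj (xs @ ys) = proj xs @ proj ys" "length (proj xs) = length xs"
  by (simp_all add: proj_def split_beta)

lemma proj_zip: "homogeneous V as vs \<Longrightarrow> proj (zip as vs) = vs"
  unfolding homogeneous_def by (induction as vs rule: list_all2_induct) (simp_all add: part_hom)

lemma homogeneous_proj: "homogeneous V (map fst xs) (proj xs)"
  unfolding homogeneous_def by (induction xs) (simp_all add: part_decomp)

lemma homogeneous_length: "homogeneous V as vs \<Longrightarrow> length as = length vs"
  by (simp add: homogeneous_def list_all2_lengthD)

lemma homogeneous_zip: "homogeneous V as vs \<Longrightarrow> map fst (zip as vs) = as \<and> map snd (zip as vs) = vs"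
  by (simp add: homogeneous_length)

lemma multilinear_eqI:
  assumes f: "multilinear s t f" and g: "multilinear s t g"
    and eq: "\<And>as vs. homogeneous V as vs \<Longrightarrow> f vs = g vs"
  shows "f = g"
proof
  fix vs
  \<comment> \<open>Entries are decomposed from left to right: \<open>us\<close> is the prefix
    already replaced by homogeneous parts, with parities \<open>as\<close>.\<close>
  have "f (us @ vs) = g (us @ vs)" if "homogeneous V as us" for us as
    using that
  proof (induction vs arbitrary: us as)
    case Nil
    then show ?case using eq by simp
  next
    case (Cons v vs)
    have *: "f (us @ part V a v # vs) = g (us @ part V a v # vs)" for a
      using Cons.IH[of "as @ [a]" "us @ [part V a v]"] Cons.prems
      by (simp add: homogeneous_def list_all2_appendI part_decomp)
    have "h (us @ v # vs) = h (us @ part V 0 v # vs) + h (us @ part V 1 v # vs)"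
      if "multilinear s t h" for h
      using multilinear_homD[OF that, of us vs] part_decomp(2)[of v]
      unfolding module_hom_iff by metis
    then show ?case using * f g by metis
  qed
  from this[of "[]" "[]"] show "f vs = g vs" by (simp add: homogeneous_def)
qed

text \<open>A formula T with signs that depend on parities makes sense for homogeneous arguments
  only; this is its multilinear extension. The definitions of \<open>parity_part\<close>,
  \<open>circ\<close> and \<open>derivation\<close> are all instances.\<close>

definition extend :: "(bit list \<Rightarrow> 'v list \<Rightarrow> 'w::ab_group_add) \<Rightarrow> 'v list \<Rightarrow> 'w" where
  "extend T vs = (\<Sum>as | length as = length vs. T as (map2 (part V) as vs))"

lemma extend_multilinear:
  assumes t: "module t"
    and lin: "\<And>as us ws. length as = Suc (length us + length ws) \<Longrightarrow> module_hom s t (\<lambda>v. T as (us @ v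
        # ws))"
  shows "multilinear s t (extend T)"
  unfolding multilinear_def
proof (intro allI)
  fix us ws
  have "module_hom s t (\<lambda>v. T as (map2 (part V) as (us @ v # ws)))"
    if "length as = Suc (length us + length ws)" for as
  proof -
    define bs cs where "bs = take (length us) as" and "cs = drop (Suc (length us)) as"
    have len: "length bs = length us" "length cs = length ws" using that by (simp_all add: bs_def cs_def)
    have as: "as = bs @ as ! length us # cs"
      using that unfolding bs_def cs_def by (simp add: id_take_nth_drop)
    have "map2 (part V) as (us @ v # ws) = map2 (part V) bs us @ part V (as ! length us) v # map2
        (part V) cs ws" for v
      by (subst as) (simp add: len)
    then show ?thesis
      using hom_comp[OF part_linear lin] that len by simp
  qed
  then show "module_hom s t (\<lambda>v. extend T (us @ v # ws))"
    unfolding extend_def by (simp) (intro hom_sum module_s t, simp)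
qed

text \<open>A pattern of parities other than \<open>as\<close> projects some entry to 0, so a single
  summand survives. Zero entries, which admit several patterns, cause no conflict: there every T
  vanishes.\<close>

lemma extend_homogeneous:
  assumes hom: "homogeneous V as vs"
    and T0: "\<And>bs ws. length bs = length ws \<Longrightarrow> 0 \<in> set ws \<Longrightarrow> T bs ws = 0"
  shows "extend T vs = T as vs"
proof -
  have len: "length as = length vs" by (rule homogeneous_length[OF hom])
  have nth: "vs ! j \<in> V (as ! j)" if "j < length vs" for j
    using hom that by (simp add: homogeneous_def list_all2_conv_all_nth)
  have same: "map2 (part V) as vs = vs"
    by (rule nth_equalityI) (auto simp: part_hom[OF nth] len)
  have "T bs (map2 (part V) bs vs) = 0" if bs: "length bs = length vs" "bs \<noteq> as" for bs
  proof -
    obtain j where j: "j < length vs" "bs ! j \<noteq> as ! j"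
      using bs len nth_equalityI[of bs as] by auto
    then have "map2 (part V) bs vs ! j = 0" using bs by (simp add: part_hom[OF nth])
    then have "0 \<in> set (map2 (part V) bs vs)" using j bs by (metis length_map map_fst_zip length_zip
        min.idem nth_mem)
    then show ?thesis using bs by (intro T0) simp_all
  qed
  then show ?thesis
    unfolding extend_def using len same
    by (subst sum.remove[OF finite_bit_lists, of as]) (auto intro!: sum.neutral)
qed

text \<open>Multilinearity in the vectors with all labels held fixed; a vector is not tied to the
  parity on its label.\<close>

definition alinear :: "('k \<Rightarrow> 'w::ab_group_add \<Rightarrow> 'w) \<Rightarrow> ((bit \<times> 'v) list \<Rightarrow> 'w) \<Rightarrow> bool" where
  "alinear t G \<longleftrightarrow> (\<forall>us a ws. module_hom s t (\<lambda>v. G (us @ (a, v) # ws)))"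

lemma alinear_hom: "alinear t G \<Longrightarrow> module_hom s t (\<lambda>v. G (us @ (a, v) # ws))"
  by (simp add: alinear_def)

lemma alinear_hom_Cons: "alinear t G \<Longrightarrow> module_hom s t (\<lambda>v. G ((a, v) # ws))"
  using alinear_hom[of t G "[]"] by simp

lemma alinear_Cons: "alinear t G \<Longrightarrow> alinear t (\<lambda>z. G (x # z))"
  using alinear_hom[of t G "x # us" for us] by (simp add: alinear_def)

lemma alinear_0:
  assumes "alinear t G" "0 \<in> set vs" "length as = length vs"
  shows "G (zip as vs) = 0"
proof -
  obtain us ws where vs: "vs = us @ 0 # ws" using assms(2) by (meson split_list)
  then have "as = take (length us) as @ as ! length us # drop (Suc (length us)) as"
    using assms(3) by (simp add: id_take_nth_drop)
  then have "zip as vs = zip (take (length us) as) us @ (as ! length us, 0) # zip (drop (Suc (length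
      us)) as) ws"
    using assms(3) vs
    by (metis (no_types, lifting) length_append length_take min.absorb2 le_add1 zip_Cons_Cons zip_append)
  then show ?thesis using hom_0[OF alinear_hom[OF assms(1)]] by metis
qed

lemma alinear_split_sum:
  assumes "module t" "\<And>b. alinear t (\<lambda>a. G a b)" "\<And>a. alinear t (G a)"
  shows "alinear t (split_sum G)"
  unfolding alinear_def split_sum_append
  by (intro allI hom_add hom_split_sum module_s assms alinear_hom
      alinear_hom[OF assms(2)] alinear_hom[OF assms(3)])

lemma alinear_cyclic_sum:
  assumes t: "module t" and G: "alinear t G"
  shows "alinear t (cyclic_sum G)"
  unfolding alinear_def
proof (intro allI)
  fix us a ws
  show "module_hom s t (\<lambda>v. cyclic_sum G (us @ (a, v) # ws))"
  proof (cases us)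
    case Nil
    then show ?thesis
      using alinear_hom[OF G]
      by (simp add: letter_wt_def) (intro hom_split_sum module_s t hom_signed, simp)
  next
    case (Cons x us')
    have "module_hom s t (\<lambda>v. G ((b @ (a, v) # ws) @ x # c))" "module_hom s t (\<lambda>v. G (b @ x # us' @
        (a, v) # c))" for b c
      using alinear_hom[OF G, of b a "ws @ x # c"] alinear_hom[OF G, of "b @ x # us'" a c] by simp_all
    then show ?thesis
      unfolding Cons append_Cons cyclic_sum.simps split_sum_append
      by (simp add: letter_wt_def) (intro hom_add hom_split_sum module_s t hom_signed; simp)
  qed
qed

text \<open>The map f transported to the shifted module, as a function of words.\<close>

definition koszul :: "('v list \<Rightarrow> 'w::ab_group_add) \<Rightarrow> (bit \<times> 'v) list \<Rightarrow> 'w" where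
  "koszul f xs = signed (eps (map fst xs)) (f (proj xs))"

text \<open>The component of \<psi> of total parity t, as an operator of weight t on the shifted
  module. In the arity of xs this component has parity \<open>t + of_nat (length xs) + 1\<close>,
  which is why this term enters the sign. The label of the value is prescribed by the weight, so
  that \<open>weight_operator\<close> holds even where the vector is 0.\<close>

definition operator :: "bit \<Rightarrow> ('v list \<Rightarrow> 'v) \<Rightarrow> (bit \<times> 'v) list \<Rightarrow> bit \<times> 'v" where
  "operator t \<psi> xs = (t + wt xs + 1,
     signed (eps (map fst xs) + t + of_nat (length xs) + 1) (part V (t + wt xs + 1) (\<psi> (proj xs))))"

lemma weight_operator: "weight t (operator t \<psi>)"
  unfolding weight_def operator_def letter_wt_def by (simp add: bit_ring wt_def letter_wt_def)

lemma alinear_koszul: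
  assumes "multilinear s t f"
  shows "alinear t (koszul f)"
  using hom_signed[OF hom_comp[OF part_linear multilinear_homD[OF assms]]]
  by (simp add: alinear_def koszul_def)

lemma alinear_operator:
  assumes G: "alinear t G" and \<psi>: "multilinear s s \<psi>"
  shows "alinear t (\<lambda>ys. G (p @ operator u \<psi> ys # z))"
  unfolding alinear_def operator_def
  by (auto simp: letter_wt_def intro!: hom_comp[OF _ alinear_hom[OF G]] hom_signed hom_comp[OF _
      part_linear]
    hom_comp[OF part_linear] multilinear_homD[OF \<psi>])

lemma alinear_lie_der:
  assumes t: "module t" and F: "alinear t F" and \<psi>: "multilinear s s \<psi>"
  shows "alinear t (lie_der (operator u \<psi>) F)"
  unfolding lie_der_def
  using alinear_operator[OF F \<psi>, of "[]"] alinear_Cons[OF F]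
  by (intro alinear_cyclic_sum alinear_split_sum t) simp_all

lemma projx_simps [simp]: "proj (projx xs) = proj xs" "map fst (projx xs) = map fst xs"
  "wt (projx xs) = wt xs" "length (projx xs) = length xs"
  by (induction xs) (simp_all add: projx_def part_part letter_wt_def split_beta)

lemma operator_projx: "operator t f (projx xs) = operator t f xs"
  by (simp add: operator_def)

lemma projx_Cons: "projx (x # xs) = (fst x, part V (fst x) (snd x)) # projx xs"
  by (simp add: projx_def split_beta)

lemma cyclic_sum_projx:
  assumes "\<And>xs. G (projx xs) = G xs"
  shows "cyclic_sum G (projx xs) = cyclic_sum G xs"
proof (cases xs)
  case (Cons x ys)
  have "projx (b @ x # a) = projx b @ (fst x, part V (fst x) (snd x)) # projx a" for a b
    by (simp add: projx_def split_beta)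
  then have "G (projx b @ (fst x, part V (fst x) (snd x)) # projx a) = G (b @ x # a)" for a b
    using assms by metis
  then have *: "split_sum (\<lambda>a b. signed (wt b * (letter_wt x + wt a)) (G (b @ x # a))) ys =
     split_sum (\<lambda>a b. signed (wt (projx b) * (letter_wt (fst x, part V (fst x) (snd x)) + wt (projx a)))
         (G (projx b @ (fst x, part V (fst x) (snd x)) # projx a))) ys"
    by (simp add: letter_wt_def)
  show ?thesis
    unfolding Cons projx_Cons cyclic_sum.simps *
    unfolding projx_def split_sum_map ..
qed (simp add: projx_def)

text \<open>Operators and \<open>koszul f\<close> only look at projected vectors, so projecting the
  letters beforehand changes nothing.\<close>

lemma lie_der_projx:
  "lie_der (operator u \<psi>) (koszul f) (projx xs) = lie_der (operator u \<psi>) (koszul f) xs"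
  unfolding lie_der_def
proof (rule cyclic_sum_projx)
  fix xs
  have 1: "koszul f (operator u \<psi> (projx a) # projx b) = koszul f (operator u \<psi> a # b)" for a b
    by (simp add: operator_projx koszul_def)
  show "split_sum (\<lambda>y z. koszul f (operator u \<psi> y # z)) (projx xs) = split_sum (\<lambda>y z. koszul f
      (operator u \<psi> y # z)) xs"
    unfolding projx_def split_sum_map unfolding projx_def[symmetric] 1 ..
qed

text \<open>Homogeneous arguments determine a multilinear map, and labelled words include them;
  identities of cochains can thus be checked after the transport.\<close>

lemma koszul_inject:
  assumes "multilinear s t f" "multilinear s t g" "koszul f = koszul g"
  shows "f = g"
proof (rule multilinear_eqI[OF assms(1,2)])
  fix as vs assume "homogeneous V as vs"
  then have "proj (zip as vs) = vs" by (rule proj_zip)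
  then show "f vs = g vs" using assms(3) by (metis koszul_def signed_inject)
qed

text \<open>The action of \<psi> on f, carried back from the shifted module. Both total parities are
  summed because \<psi> may be inhomogeneous.\<close>

definition derivation :: "('v list \<Rightarrow> 'v) \<Rightarrow> ('v list \<Rightarrow> 'w::ab_group_add) \<Rightarrow> 'v list \<Rightarrow> 'w" where
  "derivation \<psi> f = extend (\<lambda>as vs. signed (eps as) (\<Sum>t\<in>{0, 1}. lie_der (operator t \<psi>) (koszul f)
      (zip as vs)))"

lemma derivation_multilinear:
  assumes t: "module t" and f: "multilinear s t f" and \<psi>: "multilinear s s \<psi>"
  shows "multilinear s t (derivation \<psi> f)"
  unfolding derivation_def
proof (rule extend_multilinear[OF t])
  fix as :: "bit list" and us ws :: "'v list" assume len: "length as = Suc (length us + length ws)"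
  have as: "as = take (length us) as @ as ! length us # drop (Suc (length us)) as"
    using len by (simp add: id_take_nth_drop)
  have "zip as (us @ v # ws) = zip (take (length us) as) us @ (as ! length us, v) # zip (drop (Suc
      (length us)) as) ws" for v
    using len by (subst as) simp
  then show "module_hom s t (\<lambda>v. signed (eps as) (\<Sum>t\<in>{0, 1}. lie_der (operator t \<psi>) (koszul f) (zip
      as (us @ v # ws))))"
    using alinear_hom[OF alinear_lie_der[OF t alinear_koszul[OF f] \<psi>]]
    by (simp only:) (intro hom_signed hom_sum module_s t)
qed

lemma derivation_homogeneous:
  assumes "module t" and "multilinear s t f" and "multilinear s s \<psi>" and "homogeneous V as vs"
  shows "derivation \<psi> f vs = signed (eps as) (\<Sum>t\<in>{0, 1}. lie_der (operator t \<psi>) (koszul f) (zip as vs))"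
  unfolding derivation_def
  by (rule extend_homogeneous[OF assms(4)])
    (simp add: alinear_0[OF alinear_lie_der[OF assms(1) alinear_koszul[OF assms(2)] assms(3)]])

lemma koszul_derivation:
  assumes "module t" and "multilinear s t f" and "multilinear s s \<psi>"
  shows "koszul (derivation \<psi> f) = (\<lambda>xs. \<Sum>t\<in>{0, 1}. lie_der (operator t \<psi>) (koszul f) xs)"
proof
  fix xs
  have "zip (map fst xs) (proj xs) = projx xs"
    by (induction xs) (simp_all add: projx_def split_beta)
  then show "koszul (derivation \<psi> f) xs = (\<Sum>t\<in>{0, 1}. lie_der (operator t \<psi>) (koszul f) xs)"
    unfolding koszul_def[of "derivation \<psi> f"] derivation_homogeneous[OF assms homogeneous_proj]
    by (simp only: lie_der_projx signed_signed bit_self signed_0)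
qed

text \<open>Let the last of n + 1 arguments have parity b, and let S be the sum of the other
  parities. Moving it to the front changes \<open>eps\<close> by S + n b; added to the exponent n +
  b S of cyclicity this gives (b + 1)(S + n), the product of the shifted parities.\<close>

lemma koszul_cyclic_koszul:
  assumes "f \<in> form_cochains s"
  shows "f \<in> cyclic_forms s V \<longleftrightarrow> koszul_cyclic (koszul f)"
proof
  assume f: "f \<in> cyclic_forms s V"
  show "koszul_cyclic (koszul f)"
    unfolding koszul_cyclic_def
  proof (intro allI)
    fix xs x
    show "koszul f (xs @ [x]) = signed (letter_wt x * wt xs) (koszul f (x # xs))"
    proof (cases "xs = []")
      case False
      have "homogeneous V (map fst xs @ [fst x]) (proj xs @ [part V (fst x) (snd x)])"
        using homogeneous_proj[of "xs @ [x]"] by simp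
      moreover have "proj xs \<noteq> []" using False by (metis proj_simps(4) length_0_conv)
      ultimately have "f (proj xs @ [part V (fst x) (snd x)]) = signed (of_nat (length xs) + fst x *
          sum_list (map fst xs))
          (f (part V (fst x) (snd x) # proj xs))"
        using f unfolding cyclic_forms_def by fastforce
      then show ?thesis
        by (simp add: koszul_def) (rule signed_cong, simp add: eps_append wt_eq letter_wt_def bit_ring)
    qed simp
  qed
next
  assume cyc: "koszul_cyclic (koszul f)"
  have "f (us @ [w]) = signed (of_nat (length us) + b * sum_list as) (f (w # us))"
    if "us \<noteq> []" "homogeneous V (as @ [b]) (us @ [w])" for as b us w
  proof -
    have len: "length as = length us" using homogeneous_length[OF that(2)] by simp
    have hom: "homogeneous V as us" "w \<in> V b"
      using that(2) len by (simp_all add: homogeneous_def list_all2_append)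
    have "koszul f (zip as us @ [(b, w)]) = signed (letter_wt (b, w) * wt (zip as us)) (koszul f
        ((b, w) # zip as us))"
      using cyc unfolding koszul_cyclic_def by blast
    then have "signed (eps (as @ [b])) (koszul f (zip as us @ [(b, w)])) =
        signed (eps (as @ [b])) (signed (letter_wt (b, w) * wt (zip as us)) (koszul f ((b, w) # zip
            as us)))" by simp
    then show ?thesis
      by (simp add: koszul_def proj_zip[OF hom(1)] part_hom[OF hom(2)] homogeneous_zip[OF hom(1)]
          bit_self len)
        (rule signed_cong, simp add: eps_append wt_eq letter_wt_def homogeneous_zip[OF hom(1)] len
            bit_ring)
  qed
  then show "f \<in> cyclic_forms s V" using assms unfolding cyclic_forms_def by blast
qed

lemma form_cochainsD: "f \<in> form_cochains s \<Longrightarrow> multilinear s (*) f" "f \<in> form_cochains s \<Longrightarrow> length vs <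
    2 \<Longrightarrow> f vs = 0"
  by (auto simp: form_cochains_def)

lemma cochainsD: "\<psi> \<in> cochains s \<Longrightarrow> multilinear s s \<psi>" "\<psi> \<in> cochains s \<Longrightarrow> \<psi> [] = 0"
  by (auto simp: cochains_def)

lemma operator_Nil: "\<psi> \<in> cochains s \<Longrightarrow> snd (operator t \<psi> []) = 0"
  by (simp add: operator_def cochainsD hom_0[OF part_linear])

text \<open>Splittings include the empty arc, on which a cochain would act in arity 0; this removes
  such terms.\<close>

lemma alinear_operator_Nil:
  assumes "alinear t F" "\<psi> \<in> cochains s"
  shows "F (us @ operator u \<psi> [] # ws) = 0"
  using hom_0[OF alinear_hom[OF assms(1)]] operator_Nil[OF assms(2)] by (metis prod.collapse)

text \<open>\<open>lie_der\<close> sums over all rotations, so its values are cyclic for every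
  cochain \<psi>; this is why D exists without invariance of the inner product. On fewer than two
  arguments, either \<psi> acts in arity 0 or f receives a single argument.\<close>

lemma derivation_cyclic:
  assumes f: "f \<in> form_cochains s" and \<psi>: "\<psi> \<in> cochains s"
  shows "derivation \<psi> f \<in> cyclic_forms s V"
proof -
  note ml = module_mult form_cochainsD(1)[OF f] cochainsD(1)[OF \<psi>]
  have [simp]: "koszul f (operator t \<psi> [] # z) = 0" for t z
    using alinear_operator_Nil[OF alinear_koszul[OF ml(2)] \<psi>, of "[]"] by simp
  have [simp]: "koszul f [x] = 0" for x
    by (simp add: koszul_def form_cochainsD(2)[OF f])
  have "derivation \<psi> f us = 0" if "length us < 2" for us
  proof -
    have "lie_der (operator t \<psi>) (koszul f) (zip as vs) = 0" if "length as = length vs" "length vs <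
        2" for as t and vs :: "'v list"
    proof (cases "zip as vs")
      case (Cons x xs)
      then have "xs = []" using that by (metis length_Cons length_0_conv length_zip min.idem
          less_2_cases_iff One_nat_def Suc_inject less_nat_zero_code nat.distinct(1))
      then show ?thesis unfolding Cons lie_der_def
        by simp
    next
      case Nil
      show ?thesis unfolding Nil by (simp add: lie_der_def)
    qed
    then show ?thesis using that unfolding derivation_def extend_def by (simp add: sum.neutral)
  qed
  then have form: "derivation \<psi> f \<in> form_cochains s"
    using derivation_multilinear[OF ml] by (simp add: form_cochains_def)
  show ?thesis
    unfolding koszul_cyclic_koszul[OF form] koszul_derivation[OF ml]
    using lie_der_cyclic[of "operator _ \<psi>" "koszul f"]
    unfolding koszul_cyclic_def by (simp add: signed_add)
qed

end

section \<open>The bracket of cochains\<close>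

lemma lie_der_add: "lie_der P (\<lambda>xs. F xs + G xs) xs = lie_der P F xs + lie_der P G xs"
  unfolding lie_der_def split_sum_add_fun cyclic_sum_add ..

lemma mult_signed: "c * signed b x = signed b (c * x)" for c x :: "'k::comm_ring_1"
  by (simp add: signed_def)

lemma lie_der_scale:
  fixes F :: "(bit \<times> 'v) list \<Rightarrow> 'k::comm_ring_1"
  shows "lie_der P (\<lambda>xs. c * F xs) xs = c * lie_der P F xs"
proof -
  have 1: "c * split_sum G ys = split_sum (\<lambda>a b. c * G a b) ys" for G :: "'x list \<Rightarrow> 'x list \<Rightarrow> 'k" and ys
    by (simp add: split_sum_atMost sum_distrib_left)
  have "c * cyclic_sum G xs = cyclic_sum (\<lambda>ys. c * G ys) xs" for G :: "(bit \<times> 'v) list \<Rightarrow> 'k"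
    by (cases xs) (simp_all add: 1 mult_signed)
  then show ?thesis by (simp add: lie_der_def 1)
qed

lemma lie_der_eqI:
  "(\<And>y z. F (P y # z) = G (Q y # z)) \<Longrightarrow> lie_der P F xs = lie_der Q G xs"
  unfolding lie_der_def by simp

lemma finite_arity_pairs: "finite (arity_pairs n)"
  by (rule finite_subset[of _ "{..n} \<times> {..n}"]) (auto simp: arity_pairs_def)

lemma sum_arity_pairs_swap: "(\<Sum>(k, l)\<in>arity_pairs n. h k l) = (\<Sum>(k, l)\<in>arity_pairs n. h l k)"
  by (rule sum.reindex_bij_witness[of _ prod.swap prod.swap]) (auto simp: arity_pairs_def)

text \<open>A position i and an arity l determine a cut into prefix, block and suffix, and k + l = n
  + 1 turns i < k into i + l \<le> n, where n is the length of xs. The hypothesis discards the empty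
  block, that is, l = 0.\<close>

lemma split_sum_arity_pairs:
  assumes "\<And>p r. T p [] r = 0"
  shows "(\<Sum>(k, l)\<in>arity_pairs (length xs). \<Sum>i<k. T (take i xs) (take l (drop i xs)) (drop (i + l) xs))
    = split_sum (\<lambda>p. split_sum (\<lambda>y r. T p y r)) xs"
proof -
  let ?g = "\<lambda>i l. T (take i xs) (take l (drop i xs)) (drop (i + l) xs)"
  have "split_sum (\<lambda>p. split_sum (\<lambda>y r. T p y r)) xs = (\<Sum>i\<le>length xs. \<Sum>l\<le>length xs - i. ?g i l)"
    by (simp add: split_sum_atMost add.commute)
  also have "\<dots> = (\<Sum>i\<le>length xs. \<Sum>l\<in>{1..length xs - i}. ?g i l)"
    by (rule sum.cong[OF refl], rule sum.mono_neutral_right) (auto simp: assms not_less_eq_eq)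
  also have "\<dots> = (\<Sum>(i, l)\<in>(SIGMA i:{..length xs}. {1..length xs - i}). ?g i l)"
    by (simp add: sum.Sigma)
  also have "\<dots> = (\<Sum>((k, l), i)\<in>(SIGMA kl:arity_pairs (length xs). {..<fst kl}). ?g i l)"
    by (rule sum.reindex_bij_witness[of _ "\<lambda>((k, l), i). (i, l)" "\<lambda>(i, l). ((length xs + 1 - l, l), i)"])
      (auto simp: arity_pairs_def)
  also have "\<dots> = (\<Sum>kl\<in>arity_pairs (length xs). \<Sum>i<fst kl. ?g i (snd kl))"
    by (subst sum.Sigma) (auto simp: finite_arity_pairs split_beta)
  also have "\<dots> = (\<Sum>(k, l)\<in>arity_pairs (length xs). \<Sum>i<k. ?g i l)"
    by (simp add: split_beta)
  finally show ?thesis by simp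
qed

text \<open>Replaces the parity of a component by its total parity, from which it differs by a
  constant in each arity.\<close>

lemma sum_bit_shift: "(\<Sum>p\<in>{0, 1::bit}. h p) = (\<Sum>p\<in>{0, 1}. h (p + c))"
  by (cases c) (simp_all add: add.commute)

lemma sum_bit_single: "(\<And>a. a \<noteq> b \<Longrightarrow> h a = 0) \<Longrightarrow> (\<Sum>a\<in>{0, 1::bit}. h a) = h b"
  by (cases b) simp_all

lemma of_nat_pred: "1 \<le> k \<Longrightarrow> of_nat (k - 1) = of_nat k + (1::bit)"
  by (cases k) (simp_all add: bit_ring)

text \<open>The varied argument lies before the inserted block, inside it or after it.\<close>

lemma insertion_linear:
  assumes \<phi>: "multilinear s t \<phi>" and \<psi>: "multilinear s s \<psi>"
  shows "module_hom s t (\<lambda>v. \<phi> (take i (us @ v # ws) @ \<psi> (take l (drop i (us @ v # ws))) # drop (i +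
      l) (us @ v # ws)))"
proof -
  consider "length us < i" | "i \<le> length us" "length us < i + l" | "i + l \<le> length us" by linarith
  then show ?thesis
  proof cases
    case 1
    then obtain d where i: "i = Suc (length us + d)" using less_iff_Suc_add by blast
    show ?thesis
      unfolding i using multilinear_homD[OF \<phi>, of us]
      by (simp add: Suc_diff_le)
  next
    case 2
    then obtain d where d: "i + l = Suc (length us + d)" using less_iff_Suc_add by blast
    with 2 have l: "l = length us - i + Suc d" by linarith
    show ?thesis
      using 2 hom_comp[OF multilinear_homD[OF \<psi>] multilinear_homD[OF \<phi>]]
      by (simp add: d) (simp add: l Suc_diff_le)
  next
    case 3
    then show ?thesis
      using multilinear_homD[OF \<phi>, of "take i us @ \<psi> (take l (drop i us)) # drop (i + l) us"]
      by (simp add: le_diff_conv2 le_diff_conv)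
  qed
qed

context graded_space
begin

section \<open>Bilinearity of the action and multilinearity of the bracket\<close>

lemma koszul_add: "koszul (f + g) = (\<lambda>xs. koszul f xs + koszul g xs)"
  by (simp add: koszul_def fun_eq_iff signed_add)

lemma koszul_scale: "koszul (form_scale c f) = (\<lambda>xs. c * koszul f xs)"
  by (simp add: koszul_def fun_eq_iff form_scale_def signed_def)

lemma koszul_diff_signed: "koszul (f - signed c g) xs = koszul f xs - signed c (koszul g xs)"
  by (cases c) (simp_all add: koszul_def signed_add signed_diff signed_uminus uminus_signed)

lemma derivation_add: "derivation \<psi> (f + g) = derivation \<psi> f + derivation \<psi> g"
  unfolding derivation_def extend_def koszul_add lie_der_add sum.distrib signed_add
  by (simp add: fun_eq_iff)

lemma derivation_scale: "derivation \<psi> (form_scale c f) = form_scale c (derivation \<psi> f)"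
  unfolding derivation_def extend_def koszul_scale lie_der_scale
  by (simp add: fun_eq_iff form_scale_def sum_distrib_left mult_signed distrib_left)

lemma operator_add: "operator t (\<psi> + \<chi>) ys = (fst (operator t \<psi> ys), snd (operator t \<psi> ys) + snd
    (operator t \<chi> ys))"
  by (simp add: operator_def module_hom.add[OF part_linear] signed_add)

lemma operator_scale: "operator t (\<lambda>vs. s c (\<psi> vs)) ys = (fst (operator t \<psi> ys), s c (snd (operator
    t \<psi> ys)))"
  by (simp add: operator_def module_hom.scale[OF part_linear] signed_def module.scale_minus_right[OF
      module_s])

lemma fst_operator: "fst (operator t \<psi> ys) = t + wt ys + 1"
  by (simp add: operator_def)

lemma derivation_add_left:
  assumes "multilinear s t f"
  shows "derivation (\<psi> + \<chi>) f = derivation \<psi> f + derivation \<chi> f"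
proof -
  have "lie_der (operator t (\<psi> + \<chi>)) (koszul f) xs = lie_der (operator t \<psi>) (koszul f) xs + lie_der
      (operator t \<chi>) (koszul f) xs" for t xs
  proof -
    have "koszul f (operator t (\<psi> + \<chi>) y # z) = koszul f (operator t \<psi> y # z) + koszul f (operator t
        \<chi> y # z)" for y z
      using module_hom.add[OF alinear_hom_Cons[OF alinear_koszul[OF assms]]]
      by (metis operator_add fst_operator prod.collapse)
    then show ?thesis
      unfolding lie_der_def by (simp add: split_sum_add_fun cyclic_sum_add)
  qed
  then show ?thesis
    unfolding derivation_def extend_def by (simp add: fun_eq_iff sum.distrib signed_add)
qed

lemma derivation_scale_left:
  assumes "multilinear s (*) f"
  shows "derivation (\<lambda>vs. s c (\<psi> vs)) f = form_scale c (derivation \<psi> f)"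
proof -
  have "lie_der (operator t (\<lambda>vs. s c (\<psi> vs))) (koszul f) xs = lie_der (operator t \<psi>) (\<lambda>xs. c *
      koszul f xs) xs" for t xs
    using module_hom.scale[OF alinear_hom_Cons[OF alinear_koszul[OF assms]]]
    by (intro lie_der_eqI) (metis operator_scale prod.collapse)
  then show ?thesis
    unfolding derivation_def extend_def lie_der_scale
    by (simp add: fun_eq_iff form_scale_def sum_distrib_left mult_signed distrib_left)
qed

lemma parity_part_extend: "parity_part V W p f = extend (\<lambda>as ws. part W (p + sum_list as) (f ws))"
  by (simp add: fun_eq_iff parity_part_def extend_def)

lemma parity_part_multilinear:
  assumes W: "graded_module t W" and f: "multilinear s t f"
  shows "multilinear s t (parity_part V W p f)"
proof -
  interpret W: graded_space t W using W by unfold_locales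
  show ?thesis
    unfolding parity_part_extend
    by (intro extend_multilinear W.module_s hom_comp[OF multilinear_homD[OF f] W.part_linear])
qed

lemma parity_part_homogeneous:
  assumes W: "graded_module t W" and f: "multilinear s t f" and hom: "homogeneous V as vs"
  shows "parity_part V W p f vs = part W (p + sum_list as) (f vs)"
proof -
  interpret W: graded_space t W using W by unfold_locales
  show ?thesis
    unfolding parity_part_extend
    by (rule extend_homogeneous[OF hom]) (simp add: multilinear_zero[OF f] hom_0[OF W.part_linear])
qed

lemma circ_extend: "circ V k l q \<phi> \<psi> = extend (\<lambda>as ws. \<Sum>i<k. signed (sum_list (take i as) * q +
    of_nat (i * (l - 1)))
          (\<phi> (take i ws @ \<psi> (take l (drop i ws)) # drop (i + l) ws)))"
  by (simp add: fun_eq_iff circ_def extend_def Let_def)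

lemma circ_multilinear:
  assumes "multilinear s s \<phi>" "multilinear s s \<psi>"
  shows "multilinear s s (circ V k l q \<phi> \<psi>)"
  unfolding circ_extend
  by (intro extend_multilinear hom_sum module_s hom_signed insertion_linear assms)

lemma bracket_cochain:
  assumes "\<phi> \<in> cochains s" "\<psi> \<in> cochains s"
  shows "bracket V \<phi> \<psi> \<in> cochains s"
proof -
  note ml = parity_part_multilinear[OF graded cochainsD(1)[OF assms(1)]] parity_part_multilinear[OF
      graded cochainsD(1)[OF assms(2)]]
  have "multilinear s s (bracket V \<phi> \<psi>)"
    unfolding multilinear_def bracket_def hom_bracket_def split_beta
    by (simp only: length_append length_Cons)
      (intro allI hom_sum module_s hom_signed hom_diff multilinear_homD circ_multilinear ml)
  moreover have "arity_pairs 0 = {}" by (auto simp: arity_pairs_def)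
  ultimately show ?thesis by (simp add: cochains_def bracket_def)
qed

abbreviation opv :: "bit \<Rightarrow> ('v list \<Rightarrow> 'v) \<Rightarrow> (bit \<times> 'v) list \<Rightarrow> 'v" where
  "opv t \<psi> xs \<equiv> snd (operator t \<psi> xs)"

lemma alinear_opv:
  assumes "multilinear s s \<psi>"
  shows "alinear s (opv t \<psi>)"
  using hom_signed[OF hom_comp[OF hom_comp[OF part_linear multilinear_homD[OF assms]] part_linear]]
  by (simp add: alinear_def operator_def letter_wt_def)

lemma opv_in: "opv t \<psi> xs \<in> V (t + wt xs + 1)"
  by (simp add: operator_def V_signed part_decomp)

text \<open>All signs of a nested insertion collected. \<open>sum_list (map fst p) * q + of_nat
  (length p) * (of_nat (length y) + 1)\<close> is the exponent in the insertion product,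
  \<open>t * wt p\<close> the Koszul exponent, and \<open>of_nat (length p + length r) * q\<close>
  the exponent (k - 1) q of the modified bracket. The rest depends only on the word and the total
  parities.\<close>

lemma opv_insert:
  assumes \<phi>: "multilinear s s \<phi>" and q: "q = t + of_nat (length y) + 1"
  shows "opv a \<phi> (p @ operator t \<psi> y # r) =
    signed (eps (map fst (p @ y @ r)) + a + t + of_nat (length (p @ y @ r)) + 1 + of_nat (length p +
        length r) * q
        + t * wt p + sum_list (map fst p) * q + of_nat (length p) * (of_nat (length y) + 1))
      (part V (a + t + wt (p @ y @ r) + 1) (\<phi> (proj p @ part V (q + sum_list (map fst y)) (\<psi> (proj
          y)) # proj r)))"
proof -
  have b: "t + wt y + 1 = q + sum_list (map fst y)" by (simp add: wt_eq q ac_simps)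
  show ?thesis
    by (simp add: operator_def b hom_signed_arg[OF part_linear] part_part hom_signed_arg[OF
        multilinear_homD[OF \<phi>]])
      (rule arg_cong2[where f=signed] arg_cong2[where f="part V"] refl;
       simp add: letter_wt_def wt_eq eps_append q bit_ring)
qed

lemma circ_term:
  assumes \<phi>: "multilinear s s \<phi>" and \<psi>: "multilinear s s \<psi>"
    and q: "q = t + of_nat (length y) + 1" and p: "p = a + of_nat (length u + length r)"
  shows "signed (sum_list (map fst u) * q + of_nat (length u) * (of_nat (length y) + 1))
      (parity_part V V p \<phi> (proj u @ parity_part V V q \<psi> (proj y) # proj r))
    = signed (eps (map fst (u @ y @ r)) + a + t + of_nat (length (u @ y @ r)) + 1 + of_nat (length u
        + length r) * q)
       (signed (t * wt u) (opv a \<phi> (u @ operator t \<psi> y # r)))"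
proof -
  have y: "parity_part V V q \<psi> (proj y) = part V (q + sum_list (map fst y)) (\<psi> (proj y))"
    by (rule parity_part_homogeneous[OF graded \<psi> homogeneous_proj])
  let ?x = "(q + sum_list (map fst y), \<psi> (proj y))"
  have "parity_part V V p \<phi> (proj (u @ ?x # r)) = part V (p + sum_list (map fst (u @ ?x # r))) (\<phi>
      (proj (u @ ?x # r)))"
    by (rule parity_part_homogeneous[OF graded \<phi> homogeneous_proj])
  then show ?thesis
    unfolding opv_insert[OF \<phi> q] y
    by (simp) (rule arg_cong2[where f=signed] arg_cong2[where f="part V"] refl;
       simp add: letter_wt_def wt_eq q p bit_ring)
qed

text \<open>Here p and q are the parities in arities k and l of components with total parities a and
  t. The factor with exponent \<open>(of_nat k + 1) * q\<close> is the one that the modified bracket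
  cancels.\<close>

lemma circ_sum:
  assumes \<phi>: "multilinear s s \<phi>" and \<psi>: "multilinear s s \<psi>"
    and kl: "(k, l) \<in> arity_pairs (length xs)"
    and p: "p = a + of_nat k + 1" and q: "q = t + of_nat l + 1"
  shows "circ V k l q (parity_part V V p \<phi>) (parity_part V V q \<psi>) (proj xs) =
    signed (eps (map fst xs) + a + t + of_nat (length xs) + 1 + (of_nat k + 1) * q)
      (\<Sum>i<k. signed (t * wt (take i xs)) (opv a \<phi> (take i xs @ operator t \<psi> (take l (drop i xs)) #
          drop (i + l) xs)))"
proof -
  have k: "1 \<le> k" "1 \<le> l" "k + l = length xs + 1" using kl by (auto simp: arity_pairs_def)
  have "signed (sum_list (take i (map fst xs)) * q + of_nat (i * (l - 1)))
       (parity_part V V p \<phi> (take i (proj xs) @ parity_part V V q \<psi> (take l (drop i (proj xs))) #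
           drop (i + l) (proj xs)))
    = signed (eps (map fst xs) + a + t + of_nat (length xs) + 1 + (of_nat k + 1) * q)
      (signed (t * wt (take i xs)) (opv a \<phi> (take i xs @ operator t \<psi> (take l (drop i xs)) # drop (i
          + l) xs)))"
    if "i < k" for i
  proof -
    define u y r where uyr: "u = take i xs" "y = take l (drop i xs)" "r = drop (i + l) xs"
    have xs: "xs = u @ y @ r" unfolding uyr by (metis append_take_drop_id drop_drop add.commute)
    have len: "length u = i" "length y = l" "length u + length r = k - 1"
      using that k unfolding uyr by auto
    have lr: "of_nat (length u + length r) = of_nat k + (1::bit)" unfolding len(3) of_nat_pred[OF
        k(1)] ..
    have "p = a + of_nat (length u + length r)" unfolding lr p by (simp add: ac_simps)
    moreover have "q = t + of_nat (length y) + 1" by (simp add: q len)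
    ultimately have *: "signed (sum_list (map fst u) * q + of_nat (length u) * (of_nat (length y) + 1))
      (parity_part V V p \<phi> (proj u @ parity_part V V q \<psi> (proj y) # proj r))
    = signed (eps (map fst (u @ y @ r)) + a + t + of_nat (length (u @ y @ r)) + 1 + (of_nat k + 1) * q)
       (signed (t * wt u) (opv a \<phi> (u @ operator t \<psi> y # r)))"
      unfolding lr[symmetric] using circ_term[OF \<phi> \<psi>] by blast
    have "take i (proj xs) = proj u" "take l (drop i (proj xs)) = proj y" "drop (i + l) (proj xs) =
        proj r"
      "take i (map fst xs) = map fst u"
      by (simp_all add: uyr proj_def take_map drop_map)
    with * show ?thesis
      unfolding xs[symmetric] uyr[symmetric] len(1,2) of_nat_mult of_nat_pred[OF k(2)] by simp
  qed
  then show ?thesis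
    unfolding circ_homogeneous[OF graded parity_part_multilinear[OF graded \<phi>]
        parity_part_multilinear[OF graded \<psi>]
       homogeneous_proj proj_simps(4)[THEN arg_cong[where f="\<lambda>n. n + 1"], THEN trans, OF
           k(3)[symmetric]]]
      signed_sum by (intro sum.cong) simp_all
qed

definition commutator :: "bit \<Rightarrow> bit \<Rightarrow> ('v list \<Rightarrow> 'v) \<Rightarrow> ('v list \<Rightarrow> 'v) \<Rightarrow> (bit \<times> 'v) list \<Rightarrow> 'v" where
  "commutator a t \<phi> \<psi> xs = nest_sum t (opv a \<phi>) (operator t \<psi>) xs
     - signed (a * t) (nest_sum a (opv t \<psi>) (operator a \<phi>) xs)"

lemma nest_sum_arity_pairs:
  assumes "\<phi> \<in> cochains s" "\<psi> \<in> cochains s"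
  shows "(\<Sum>(k, l)\<in>arity_pairs (length xs). \<Sum>i<k. signed (t * wt (take i xs))
      (opv a \<phi> (take i xs @ operator t \<psi> (take l (drop i xs)) # drop (i + l) xs)))
   = nest_sum t (opv a \<phi>) (operator t \<psi>) xs"
  unfolding nest_sum_def
  by (rule split_sum_arity_pairs) (simp add: alinear_operator_Nil[OF alinear_opv[OF cochainsD(1)[OF
      assms(1)]] assms(2)])

lemma bracket_commutator:
  assumes \<phi>: "\<phi> \<in> cochains s" and \<psi>: "\<psi> \<in> cochains s"
  shows "bracket V \<phi> \<psi> (proj xs) =
    (\<Sum>a\<in>{0, 1}. \<Sum>t\<in>{0, 1}. signed (eps (map fst xs) + a + t + of_nat (length xs) + 1) (commutator a
        t \<phi> \<psi> xs))"
proof -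
  let ?e = "\<lambda>a t. eps (map fst xs) + a + t + of_nat (length xs) + 1"
  let ?A = "\<lambda>\<phi> \<psi> a t k l. \<Sum>i<k. signed (t * wt (take i xs)) (opv a \<phi> (take i xs @ operator t \<psi> (take
      l (drop i xs)) # drop (i + l) xs))"
  \<comment> \<open>For p = a + k + 1 and q = t + l + 1, the exponents of the second product add up
    to (p + k - 1)(q + l - 1) = a t, apart from the exponent shared with the first product.\<close>
  have hb: "hom_bracket V k (a + (of_nat k + 1)) l (t + (of_nat l + 1)) (parity_part V V (a +
      (of_nat k + 1)) \<phi>) (parity_part V V (t + (of_nat l + 1)) \<psi>) (proj xs)
      = signed (?e a t) (?A \<phi> \<psi> a t k l - signed (a * t) (?A \<psi> \<phi> t a l k))"
    if kl: "(k, l) \<in> arity_pairs (length xs)" for k l a t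
  proof -
    have k: "1 \<le> k" "1 \<le> l" using kl by (auto simp: arity_pairs_def)
    have lk: "(l, k) \<in> arity_pairs (length xs)" using kl by (auto simp: arity_pairs_def)
    show ?thesis
      unfolding hom_bracket_def
        circ_sum[OF cochainsD(1)[OF \<phi>] cochainsD(1)[OF \<psi>] kl add.assoc[symmetric] add.assoc[symmetric]]
        circ_sum[OF cochainsD(1)[OF \<psi>] cochainsD(1)[OF \<phi>] lk add.assoc[symmetric] add.assoc[symmetric]]
        signed_diff of_nat_mult of_nat_pred[OF k(1)] of_nat_pred[OF k(2)] signed_signed
      by (rule arg_cong2[where f="(-)"]; rule signed_cong; simp add: bit_ring)
  qed
  have "bracket V \<phi> \<psi> (proj xs) = (\<Sum>(k, l)\<in>arity_pairs (length xs). \<Sum>a\<in>{0, 1}. \<Sum>t\<in>{0, 1}.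
     signed (?e a t) (?A \<phi> \<psi> a t k l - signed (a * t) (?A \<psi> \<phi> t a l k)))"
    unfolding bracket_def proj_simps(4)
  proof (intro sum.cong refl, unfold split_beta)
    fix kl assume "kl \<in> arity_pairs (length xs)"
    then have kl: "(fst kl, snd kl) \<in> arity_pairs (length xs)" by simp
    show "(\<Sum>p\<in>{0, 1}. \<Sum>q\<in>{0, 1}. hom_bracket V (fst kl) p (snd kl) q (parity_part V V p \<phi>)
        (parity_part V V q \<psi>) (proj xs))
      = (\<Sum>a\<in>{0, 1}. \<Sum>t\<in>{0, 1}. signed (?e a t) (?A \<phi> \<psi> a t (fst kl) (snd kl) - signed (a * t) (?A \<psi>
          \<phi> t a (snd kl) (fst kl))))"
      by (subst sum_bit_shift[where c="of_nat (fst kl) + 1"], rule sum.cong[OF refl],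
          subst sum_bit_shift[where c="of_nat (snd kl) + 1"], rule sum.cong[OF refl], rule hb[OF kl])
  qed
  also have "\<dots> = (\<Sum>a\<in>{0, 1}. \<Sum>t\<in>{0, 1}. \<Sum>(k, l)\<in>arity_pairs (length xs).
     signed (?e a t) (?A \<phi> \<psi> a t k l - signed (a * t) (?A \<psi> \<phi> t a l k)))"
    by (simp add: sum.distrib split_beta)
  also have "\<dots> = (\<Sum>a\<in>{0, 1}. \<Sum>t\<in>{0, 1}. signed (?e a t) (commutator a t \<phi> \<psi> xs))"
  proof (intro sum.cong refl)
    fix a t :: bit
    have "(\<Sum>(k, l)\<in>arity_pairs (length xs). signed (?e a t) (?A \<phi> \<psi> a t k l - signed (a * t) (?A \<psi> \<phi>
        t a l k)))
      = signed (?e a t) ((\<Sum>(k, l)\<in>arity_pairs (length xs). ?A \<phi> \<psi> a t k l)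
         - signed (a * t) (\<Sum>(k, l)\<in>arity_pairs (length xs). ?A \<psi> \<phi> t a l k))"
      by (simp only: signed_sum sum_subtractf case_prod_unfold signed_diff signed_signed add.assoc)
    \<comment> \<open>In the second product k is the arity of the inner factor; renaming makes it
      the outer arity, as \<open>nest_sum_arity_pairs\<close> expects.\<close>
    also have "(\<Sum>(k, l)\<in>arity_pairs (length xs). ?A \<psi> \<phi> t a l k) = (\<Sum>(k, l)\<in>arity_pairs (length xs).
        ?A \<psi> \<phi> t a k l)"
      by (rule sum_arity_pairs_swap)
    finally show "(\<Sum>(k, l)\<in>arity_pairs (length xs). signed (?e a t) (?A \<phi> \<psi> a t k l - signed (a * t)
        (?A \<psi> \<phi> t a l k)))
      = signed (?e a t) (commutator a t \<phi> \<psi> xs)"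
      unfolding commutator_def nest_sum_arity_pairs[OF \<phi> \<psi>] nest_sum_arity_pairs[OF \<psi> \<phi>] .
  qed
  finally show ?thesis .
qed

lemma nest_sum_in:
  assumes "weight u Q"
  shows "nest_sum u (opv a \<phi>) Q xs \<in> V (a + u + wt xs + 1)"
  unfolding nest_sum_def
proof (intro V_split_sum V_signed)
  fix p b y r assume "xs = p @ b" "b = y @ r"
  then have "a + wt (p @ Q y # r) + 1 = a + u + wt xs + 1"
    using assms by (simp add: weight_def ac_simps)
  then show "opv a \<phi> (p @ Q y # r) \<in> V (a + u + wt xs + 1)" using opv_in by metis
qed

lemma commutator_in: "commutator a t \<phi> \<psi> xs \<in> V (a + t + wt xs + 1)"
  unfolding commutator_def diff_conv_add_uminus
  using nest_sum_in[OF weight_operator, of t a \<phi> \<psi> xs] nest_sum_in[OF weight_operator, of a t \<psi> \<phi> xs]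
  by (intro V_add V_uminus V_signed) (simp_all add: ac_simps)

text \<open>The component of arity n of a cochain of total parity t has parity t + n - 1; over the field
  with two elements this is t + n + 1.\<close>

definition pure :: "bit \<Rightarrow> ('v list \<Rightarrow> 'v) \<Rightarrow> bool" where
  "pure t \<psi> \<longleftrightarrow> (\<forall>as vs. homogeneous V as vs \<longrightarrow> \<psi> vs \<in> V (t + sum_list as + of_nat (length vs) + 1))"

lemma pure_proj: "pure t \<psi> \<Longrightarrow> \<psi> (proj xs) \<in> V (t + wt xs + 1)"
  using homogeneous_proj[of xs] unfolding pure_def wt_eq by (metis add.assoc proj_simps(4))

lemma pure_opv:
  assumes "pure t \<psi>"
  shows "opv a \<psi> xs = (if a = t then signed (eps (map fst xs) + t + of_nat (length xs) + 1) (\<psi> (proj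
      xs)) else 0)"
  unfolding operator_def using part_hom[OF pure_proj[OF assms]] by simp

lemma lie_der_pure:
  assumes F: "alinear t' F" and \<psi>: "pure t \<psi>"
  shows "(\<Sum>a\<in>{0, 1}. lie_der (operator a \<psi>) F xs) = lie_der (operator t \<psi>) F xs"
proof (rule sum_bit_single)
  fix a assume "a \<noteq> t"
  then have "F (operator a \<psi> y # z) = 0" for y z
    using hom_0[OF alinear_hom_Cons[OF F]] pure_opv[OF \<psi>, of a y] by (metis prod.collapse)
  then show "lie_der (operator a \<psi>) F xs = 0" by (simp add: lie_der_def)
qed

lemma commutator_pure:
  assumes \<phi>: "multilinear s s \<phi>" "pure a \<phi>" and \<psi>: "multilinear s s \<psi>" "pure t \<psi>"
    and ne: "(a', t') \<noteq> (a, t)"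
  shows "commutator a' t' \<phi> \<psi> xs = 0"
proof -
  have 1: "nest_sum t' (opv a' \<phi>) (operator t' \<psi>) xs = 0"
    if \<phi>: "multilinear s s \<phi>" "pure a \<phi>" and \<psi>: "pure t \<psi>" and ne: "a' \<noteq> a \<or> t' \<noteq> t" for \<phi> \<psi> a t a' t'
  proof -
    have "opv a' \<phi> (p @ operator t' \<psi> y # r) = 0" for p y r
    proof (cases "a' = a")
      case True
      then have "opv t' \<psi> y = 0" using ne by (simp add: pure_opv[OF \<psi>])
      then show ?thesis using hom_0[OF alinear_hom[OF alinear_opv[OF \<phi>(1)]]] by (metis prod.collapse)
    qed (simp add: pure_opv[OF \<phi>(2)])
    then show ?thesis by (simp add: nest_sum_def)
  qed
  show ?thesis
    unfolding commutator_def
    using 1[OF \<phi> \<psi>(2), of a' t'] 1[OF \<psi> \<phi>(2), of t' a'] ne by auto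
qed

lemma bracket_pure:
  assumes \<phi>: "\<phi> \<in> cochains s" "pure a \<phi>" and \<psi>: "\<psi> \<in> cochains s" "pure t \<psi>"
  shows "bracket V \<phi> \<psi> (proj xs) = signed (eps (map fst xs) + a + t + of_nat (length xs) + 1)
      (commutator a t \<phi> \<psi> xs)"
proof -
  note z = commutator_pure[OF cochainsD(1)[OF \<phi>(1)] \<phi>(2) cochainsD(1)[OF \<psi>(1)] \<psi>(2)]
  show ?thesis
    unfolding bracket_commutator[OF \<phi>(1) \<psi>(1)]
    by (subst sum_bit_single[where b=a], simp add: z, subst sum_bit_single[where b=t], simp_all add: z)
qed

lemma pureI: "(\<And>xs. \<psi> (proj xs) \<in> V (t + wt xs + 1)) \<Longrightarrow> pure t \<psi>"
  unfolding pure_def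
  by (metis (no_types, opaque_lifting) proj_zip homogeneous_zip homogeneous_length wt_eq add.assoc
      length_map)

lemma pure_bracket:
  assumes "\<phi> \<in> cochains s" "pure a \<phi>" "\<psi> \<in> cochains s" "pure t \<psi>"
  shows "pure (a + t) (bracket V \<phi> \<psi>)"
  by (rule pureI) (simp add: bracket_pure[OF assms] V_signed commutator_in)

text \<open>The signs of \<open>bracket_pure\<close> are those built into \<open>operator\<close>,
  so they cancel and the twist carries the bracket to the commutator.\<close>

lemma operator_bracket:
  assumes "\<phi> \<in> cochains s" "pure a \<phi>" "\<psi> \<in> cochains s" "pure t \<psi>"
  shows "operator (a + t) (bracket V \<phi> \<psi>) xs = (a + t + wt xs + 1, commutator a t \<phi> \<psi> xs)"
  unfolding operator_def bracket_pure[OF assms] hom_signed_arg[OF part_linear] part_hom[OF commutator_in]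
  by (simp add: bit_ring)

text \<open>The label of the produced letter does not depend on where Q is inserted, so all summands
  share one linear slot of F and the sum can be drawn inside.\<close>

lemma nest_sum_letter:
  assumes h: "\<And>a. module_hom s t' (\<lambda>v. F (a, v))" and Q: "weight u Q"
  shows "nest_sum u (\<lambda>ys. F (operator t \<phi> ys)) Q b = F (t + u + wt b + 1, nest_sum u (opv t \<phi>) Q b)"
proof -
  have "F (operator t \<phi> (p @ Q y # r)) = F (t + u + wt b + 1, opv t \<phi> (p @ Q y # r))"
    if "b = p @ c" "c = y @ r" for p y r c
  proof -
    have "fst (operator t \<phi> (p @ Q y # r)) = t + u + wt b + 1"
      using that Q by (simp add: fst_operator weight_def ac_simps)
    then show ?thesis by (metis prod.collapse)
  qed
  then show ?thesis
    unfolding nest_sum_def hom_split_sum_arg[OF h] hom_signed_arg[OF h]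
    by (intro split_sum_cong) simp
qed

lemma nest_sum_operator:
  assumes F: "alinear t' F" and Q: "weight u Q"
  shows "nest_sum u (\<lambda>ys. F (operator t \<phi> ys # z)) Q b = F ((t + u + wt b + 1, nest_sum u (opv t \<phi>)
      Q b) # z)"
  by (rule nest_sum_letter[of t' "\<lambda>x. F (x # z)", OF alinear_hom_Cons[OF F] Q])

text \<open>In the term with the plus sign \<psi> acts before \<chi>, so cochains act from the right
  on cyclic forms; this fits the action of \<psi> on the form of \<phi> being the form of the
  bracket of \<phi> with \<psi>.\<close>

lemma derivation_commutator:
  assumes f: "f \<in> cyclic_forms s V" and \<psi>: "\<psi> \<in> cochains s" "pure t \<psi>" and \<chi>: "\<chi> \<in> cochains s" "pure u \<chi>"
  shows "derivation \<chi> (derivation \<psi> f) - signed (t * u) (derivation \<psi> (derivation \<chi> f)) = derivation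
      (bracket V \<psi> \<chi>) f"
proof -
  have fc: "f \<in> form_cochains s" using f by (simp add: cyclic_forms_def)
  note ml = form_cochainsD(1)[OF fc]
  note der = koszul_derivation[OF module_mult ml cochainsD(1)]
  note mlg = derivation_multilinear[OF module_mult ml cochainsD(1)]
  have cyc: "koszul_cyclic (koszul f)" using f koszul_cyclic_koszul[OF fc] by simp
  note al = alinear_koszul[OF ml]
  have der1: "koszul (derivation \<psi> f) = lie_der (operator t \<psi>) (koszul f)" if "\<psi> \<in> cochains s" "pure
      t \<psi>" for \<psi> t
    unfolding der[OF that(1)] lie_der_pure[OF al that(2)] ..
  have der2: "koszul (derivation \<chi> (derivation \<psi> f)) = lie_der (operator u \<chi>) (lie_der (operator t
      \<psi>) (koszul f))"
    if "\<psi> \<in> cochains s" "pure t \<psi>" "\<chi> \<in> cochains s" "pure u \<chi>" for \<psi> t \<chi> u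
    unfolding koszul_derivation[OF module_mult mlg[OF that(1)] cochainsD(1)[OF that(3)]]
      lie_der_pure[OF alinear_koszul[OF mlg[OF that(1)]] that(4)]
    unfolding der1[OF that(1,2)] ..
  have mls: "multilinear s (*) (derivation \<chi> (derivation \<psi> f) - signed (t * u) (derivation \<psi>
      (derivation \<chi> f)))"
    using multilinear_homD[OF derivation_multilinear[OF module_mult mlg[OF \<psi>(1)] cochainsD(1)[OF \<chi>(1)]]]
      multilinear_homD[OF derivation_multilinear[OF module_mult mlg[OF \<chi>(1)] cochainsD(1)[OF \<psi>(1)]]]
    unfolding multilinear_def by (cases "t * u") (auto intro: hom_diff hom_add)
  show ?thesis
  proof (rule koszul_inject[OF mls mlg[OF bracket_cochain[OF \<psi>(1) \<chi>(1)]]], rule ext)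
    fix xs
    have "koszul (derivation \<chi> (derivation \<psi> f) - signed (t * u) (derivation \<psi> (derivation \<chi> f))) xs =
       koszul (derivation \<chi> (derivation \<psi> f)) xs - signed (t * u) (koszul (derivation \<psi> (derivation
           \<chi> f)) xs)"
      by (rule koszul_diff_signed)
    also have "\<dots> = cyclic_sum (split_sum (\<lambda>b z. nest_sum u (\<lambda>ys. koszul f (operator t \<psi> ys # z))
        (operator u \<chi>) b
       - signed (t * u) (nest_sum t (\<lambda>ys. koszul f (operator u \<chi> ys # z)) (operator t \<psi>) b))) xs"
      unfolding der2[OF \<psi> \<chi>] der2[OF \<chi> \<psi>]
      by (rule lie_der_commutator[OF cyc weight_operator weight_operator])
    also have "\<dots> = lie_der (operator (t + u) (bracket V \<psi> \<chi>)) (koszul f) xs"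
    proof -
      have "nest_sum u (\<lambda>ys. koszul f (operator t \<psi> ys # z)) (operator u \<chi>) b
       - signed (t * u) (nest_sum t (\<lambda>ys. koszul f (operator u \<chi> ys # z)) (operator t \<psi>) b)
       = koszul f (operator (t + u) (bracket V \<psi> \<chi>) b # z)" for b z
        unfolding nest_sum_operator[OF al weight_operator] operator_bracket[OF \<psi> \<chi>] commutator_def
        by (simp add: module_hom.diff[OF alinear_hom_Cons[OF al]] hom_signed_arg[OF
            alinear_hom_Cons[OF al]] add.commute[of u t])
      then show ?thesis unfolding lie_der_def by simp
    qed
    also have "\<dots> = koszul (derivation (bracket V \<psi> \<chi>) f) xs"
      unfolding der1[OF bracket_cochain[OF \<psi>(1) \<chi>(1)] pure_bracket[OF \<psi> \<chi>]] ..
    finally show "koszul (derivation \<chi> (derivation \<psi> f) - signed (t * u) (derivation \<psi> (derivation \<chi>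
        f))) xs = koszul (derivation (bracket V \<psi> \<chi>) f) xs" .
  qed
qed

lemma bracket_antisym:
  assumes \<phi>: "\<phi> \<in> cochains s" "pure a \<phi>" and \<psi>: "\<psi> \<in> cochains s" "pure t \<psi>"
  shows "bracket V \<phi> \<psi> vs = - signed (a * t) (bracket V \<psi> \<phi> vs)"
proof -
  have "bracket V \<phi> \<psi> = (\<lambda>vs. - signed (a * t) (bracket V \<psi> \<phi> vs))"
  proof (rule multilinear_eqI)
    show "multilinear s s (bracket V \<phi> \<psi>)" using bracket_cochain[OF \<phi>(1) \<psi>(1)] by (rule cochainsD)
    show "multilinear s s (\<lambda>vs. - signed (a * t) (bracket V \<psi> \<phi> vs))"
      using multilinear_homD[OF cochainsD(1)[OF bracket_cochain[OF \<psi>(1) \<phi>(1)]]]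
      unfolding multilinear_def by (intro allI hom_uminus hom_signed)
    fix as vs assume "homogeneous V as vs"
    from proj_zip[OF this] have vs: "vs = proj (zip as vs)" by simp
    show "bracket V \<phi> \<psi> vs = - signed (a * t) (bracket V \<psi> \<phi> vs)"
      by (subst (1 2) vs, unfold bracket_pure[OF \<phi> \<psi>] bracket_pure[OF \<psi> \<phi>] commutator_def)
        (simp add: signed_diff uminus_signed signed_uminus bit_ring)
  qed
  then show ?thesis by (rule fun_cong)
qed

text \<open>The component of arity k has parity k = 1 + k + 1, so m has total parity 1. The signs of
  the A-infinity relations are those of Koszul-signed insertion, and the relations say that m
  inserted into itself is 0; vanishing of the bracket of m with itself would give only twice
  this.\<close>

lemma a_infinityD:
  assumes m: "a_infinity s V m"
  shows "m \<in> cochains s" "pure 1 m" "nest_sum 1 (opv 1 m) (operator 1 m) xs = 0"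
proof -
  show c: "m \<in> cochains s" using m by (simp add: a_infinity_def)
  show p: "pure 1 m"
    unfolding pure_def
  proof (intro allI impI)
    fix as vs assume hom: "homogeneous V as vs"
    show "m vs \<in> V (1 + sum_list as + of_nat (length vs) + 1)"
    proof (cases "vs = []")
      case True
      then show ?thesis using cochainsD(2)[OF c] V_0 by simp
    next
      case False
      then have "has_parity V V (of_nat (length vs)) (arity_part (length vs) m)"
        using m unfolding a_infinity_def by (metis One_nat_def Suc_leI length_greater_0_conv)
      then have "m vs \<in> V (of_nat (length vs) + sum_list as)"
        using hom unfolding has_parity_def arity_part_def by fastforce
      then show ?thesis by (simp add: bit_ring)
    qed
  qed
  let ?S = "\<lambda>as n vs. (\<Sum>(k, l)\<in>arity_pairs n. \<Sum>i\<le>n - k.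
           signed (sum_list (take i as) * of_nat k + of_nat (i * (k - 1)) + of_nat ((n - k) * k))
             (m (take i vs @ m (take k (drop i vs)) # drop (i + k) vs)))"
  show "nest_sum 1 (opv 1 m) (operator 1 m) xs = 0"
  proof (cases "xs = []")
    case True
    then show ?thesis
      using alinear_operator_Nil[OF alinear_opv[OF cochainsD(1)[OF c]] c, of 1 "[]"] by (simp add:
          nest_sum_def)
  next
    case False
    let ?n = "length xs"
    have "1 \<le> ?n" using False by (cases xs) simp_all
    then have "0 = ?S (map fst xs) ?n (proj xs)"
      using m[unfolded a_infinity_def, THEN conjunct2, THEN conjunct2, THEN spec, of ?n, THEN mp,
          THEN spec, THEN spec,
          of "proj xs" "map fst xs"] homogeneous_proj[of xs] by simp
    \<comment> \<open>The relations use k for the inner arity, the bracket for the outer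
      one.\<close>
    also have "\<dots> = (\<Sum>(k, l)\<in>arity_pairs ?n. \<Sum>i\<le>?n - l.
           signed (sum_list (take i (map fst xs)) * of_nat l + of_nat (i * (l - 1)) + of_nat ((?n -
               l) * l))
             (m (take i (proj xs) @ m (take l (drop i (proj xs))) # drop (i + l) (proj xs))))"
      by (rule sum_arity_pairs_swap)
    also have "\<dots> = (\<Sum>(k, l)\<in>arity_pairs ?n. signed (eps (map fst xs) + of_nat ?n + 1) (\<Sum>i<k. signed
        (1 * wt (take i xs))
      (opv 1 m (take i xs @ operator 1 m (take l (drop i xs)) # drop (i + l) xs))))"
      unfolding split_beta
    proof (intro sum.cong[OF refl])
      fix kl assume "kl \<in> arity_pairs ?n"
      then obtain k l where kl: "kl = (k, l)" "1 \<le> k" "1 \<le> l" "k + l = ?n + 1" by (auto simp: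
          arity_pairs_def)
      have "signed (sum_list (take i (map fst xs)) * of_nat l + of_nat (i * (l - 1)) + of_nat ((?n -
          l) * l))
             (m (take i (proj xs) @ m (take l (drop i (proj xs))) # drop (i + l) (proj xs)))
         = signed (eps (map fst xs) + of_nat ?n + 1) (signed (1 * wt (take i xs))
      (opv 1 m (take i xs @ operator 1 m (take l (drop i xs)) # drop (i + l) xs)))" if "i < k" for i
      proof -
        define u y r where uyr: "u = take i xs" "y = take l (drop i xs)" "r = drop (i + l) xs"
        have xs: "xs = u @ y @ r" unfolding uyr by (metis append_take_drop_id drop_drop add.commute)
        have len: "length u = i" "length y = l" "length u + length r = k - 1" "?n - l = k - 1"
          using that kl unfolding uyr by auto
        have my: "m (proj y) \<in> V (of_nat l + sum_list (map fst y))"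
          using pure_proj[OF p, of y] by (simp add: wt_eq len bit_ring)
        let ?x = "(of_nat l + sum_list (map fst y), m (proj y))"
        have px: "proj (u @ ?x # r) = proj u @ m (proj y) # proj r"
          by (simp add: part_hom[OF my])
        have "m (proj (u @ ?x # r)) \<in> V (1 + wt (u @ ?x # r) + 1)"
          by (rule pure_proj[OF p])
        also have "1 + wt (u @ ?x # r) + 1 = 1 + 1 + wt (u @ y @ r) + 1"
          by (simp add: letter_wt_def wt_eq[of y] len bit_ring)
        finally have mm: "m (proj u @ m (proj y) # proj r) \<in> V (1 + 1 + wt (u @ y @ r) + 1)"
            unfolding px .
        have parts: "part V (of_nat l + sum_list (map fst y)) (m (proj y)) = m (proj y)"
          "part V (1 + 1 + wt (u @ y @ r) + 1) (m (proj u @ m (proj y) # proj r)) = m (proj u @ m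
              (proj y) # proj r)"
          by (simp_all only: part_hom[OF my] part_hom[OF mm] if_True refl)
        have lr: "of_nat i + of_nat (length r) = of_nat k + (1::bit)"
          unfolding of_nat_pred[OF kl(2), symmetric] len(3)[symmetric] len(1) by simp
        have q: "of_nat l = 1 + of_nat (length y) + (1::bit)" by (simp add: len bit_ring)
        have t: "take i (proj xs) = proj u" "take l (drop i (proj xs)) = proj y" "drop (i + l) (proj
            xs) = proj r"
          "take i (map fst xs) = map fst u"
          by (simp_all add: uyr proj_def take_map drop_map)
        show ?thesis
          unfolding t uyr[symmetric] opv_insert[OF cochainsD(1)[OF c] q] parts
          unfolding len(1,2,4) of_nat_mult of_nat_add of_nat_pred[OF kl(2)] of_nat_pred[OF kl(3)]
              xs[symmetric] lr
          by simp (rule signed_cong, simp add: bit_ring)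
      qed
      moreover have "{..?n - l} = {..<k}" using kl by auto
      ultimately show "(\<Sum>i\<le>?n - snd kl.
           signed (sum_list (take i (map fst xs)) * of_nat (snd kl) + of_nat (i * (snd kl - 1)) +
               of_nat ((?n - snd kl) * snd kl))
             (m (take i (proj xs) @ m (take (snd kl) (drop i (proj xs))) # drop (i + snd kl) (proj xs))))
        = signed (eps (map fst xs) + of_nat ?n + 1) (\<Sum>i<fst kl. signed (1 * wt (take i xs))
      (opv 1 m (take i xs @ operator 1 m (take (snd kl) (drop i xs)) # drop (i + snd kl) xs)))"
        unfolding kl(1) signed_sum by simp
    qed
    also have "\<dots> = signed (eps (map fst xs) + of_nat ?n + 1) (\<Sum>(k, l)\<in>arity_pairs ?n. \<Sum>i<k. signed
        (1 * wt (take i xs))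
      (opv 1 m (take i xs @ operator 1 m (take l (drop i xs)) # drop (i + l) xs)))"
      by (simp only: signed_sum case_prod_unfold)
    finally have "signed (eps (map fst xs) + of_nat ?n + 1) 0 = signed (eps (map fst xs) + of_nat ?n
        + 1) (nest_sum 1 (opv 1 m) (operator 1 m) xs)"
      unfolding nest_sum_arity_pairs[OF c c] by simp
    then show ?thesis unfolding signed_inject by simp
  qed
qed

lemma derivation_square:
  assumes f: "f \<in> cyclic_forms s V" and m: "a_infinity s V m"
  shows "derivation m (derivation m f) = 0"
proof -
  have fc: "f \<in> form_cochains s" using f by (simp add: cyclic_forms_def)
  note ml = form_cochainsD(1)[OF fc]
  note m' = a_infinityD[OF m]
  note mlg = derivation_multilinear[OF module_mult ml cochainsD(1)[OF m'(1)]]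
  have cyc: "koszul_cyclic (koszul f)" using f koszul_cyclic_koszul[OF fc] by simp
  note al = alinear_koszul[OF ml]
  have 1: "koszul (derivation m f) = lie_der (operator 1 m) (koszul f)"
    unfolding koszul_derivation[OF module_mult ml cochainsD(1)[OF m'(1)]] lie_der_pure[OF al m'(2)] ..
  have "koszul (derivation m (derivation m f)) xs = 0" for xs
  proof -
    have "koszul (derivation m (derivation m f)) xs = lie_der (operator 1 m) (lie_der (operator 1 m)
        (koszul f)) xs"
      unfolding koszul_derivation[OF module_mult mlg cochainsD(1)[OF m'(1)]]
        lie_der_pure[OF alinear_koszul[OF mlg] m'(2)]
      unfolding 1 ..
    also have "\<dots> = 0"
      unfolding lie_der_square[OF cyc weight_operator] nest_sum_operator[OF al weight_operator] m'(3)
        hom_0[OF alinear_hom_Cons[OF al]] by simp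
    finally show ?thesis .
  qed
  then have "koszul (derivation m (derivation m f)) = koszul 0"
    by (simp add: fun_eq_iff koszul_def)
  then show ?thesis
    by (rule koszul_inject[rotated 2])
      (auto simp: multilinear_def intro: hom_zero module_s module_mult multilinear_homD
          derivation_multilinear mlg cochainsD m')
qed

end

section \<open>Cyclic cochains and cyclic forms\<close>

lemma signed_eq_swap: "x = signed c y \<longleftrightarrow> y = signed c x"
  by (cases c) auto

lemma lie_der_sum: "lie_der P (\<lambda>xs. \<Sum>i\<in>I. F i xs) xs = (\<Sum>i\<in>I. lie_der P (F i) xs)"
  unfolding lie_der_def cyclic_sum_sum[symmetric] by (rule cyclic_sum_cong) (rule split_sum_sum)

locale inner_product_space = graded_space s V
  for s :: "'k::comm_ring_1 \<Rightarrow> 'v::ab_group_add \<Rightarrow> 'v" and V :: "bit \<Rightarrow> 'v set" +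
  fixes ip :: "'v \<Rightarrow> 'v \<Rightarrow> 'k"
  assumes ip: "inner_product s V ip"
begin

section \<open>The correspondence of cochains and forms through the inner product\<close>

lemma ip_linear: "module_hom s (*) (ip v)" "module_hom s (*) (\<lambda>v. ip v w)"
  using ip by (auto simp: inner_product_def)

lemma ip_orthogonal: "v \<in> V a \<Longrightarrow> w \<in> V b \<Longrightarrow> a \<noteq> b \<Longrightarrow> ip v w = 0"
  using ip unfolding inner_product_def by blast

lemma ip_sym: "v \<in> V a \<Longrightarrow> w \<in> V b \<Longrightarrow> ip v w = signed (a * b) (ip w v)"
  using ip unfolding inner_product_def by blast

lemma ip_bij: "bij_betw ip UNIV {f. module_hom s (*) f}"
  using ip by (simp add: inner_product_def)

lemma ip_part: "w \<in> V b \<Longrightarrow> ip (part V b v) w = ip v w"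
proof -
  assume w: "w \<in> V b"
  have "ip v w = ip (part V 0 v) w + ip (part V 1 v) w"
    using module_hom.add[OF ip_linear(2)] part_decomp(2)[of v] by metis
  moreover have "ip (part V c v) w = 0" if "c \<noteq> b" for c
    using ip_orthogonal[OF part_decomp(1) w that] .
  ultimately show ?thesis by (cases b) simp_all
qed

lemma ip_eqI:
  assumes "\<And>b w. w \<in> V b \<Longrightarrow> ip u w = ip v w"
  shows "u = v"
proof -
  have "ip u w = ip v w" for w
    using module_hom.add[OF ip_linear(1)] part_decomp(1) part_decomp(2)[of w] assms by metis
  then have "ip u = ip v" by blast
  then show ?thesis using ip_bij by (auto simp: bij_betw_def inj_on_def)
qed

lemma tilde_snoc_cochain: "\<phi> \<in> cochains s \<Longrightarrow> tilde ip \<phi> (xs @ [w]) = ip (\<phi> xs) w"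
  by (cases xs) (simp_all add: tilde_def cochainsD(2) hom_0[OF ip_linear(2)])

lemma tilde_Nil: "tilde ip \<phi> [] = 0"
  by (simp add: tilde_def)

lemma tilde_form:
  assumes "\<phi> \<in> cochains s"
  shows "tilde ip \<phi> \<in> form_cochains s"
proof -
  have "module_hom s (*) (\<lambda>v. tilde ip \<phi> (us @ v # ws))" for us ws
  proof (cases ws rule: rev_cases)
    case Nil
    then show ?thesis using tilde_snoc_cochain[OF assms] ip_linear(1) by simp
  next
    case (snoc ws' w)
    then have "tilde ip \<phi> (us @ v # ws) = ip (\<phi> (us @ v # ws')) w" for v
      using tilde_snoc_cochain[OF assms, of "us @ v # ws'" w] by simp
    then show ?thesis using hom_comp[OF multilinear_homD[OF cochainsD(1)[OF assms]] ip_linear(2)] by simp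
  qed
  then show ?thesis by (simp add: form_cochains_def multilinear_def tilde_def)
qed

lemma tilde_inj: "inj_on (tilde ip) (cochains s)"
proof (rule inj_onI)
  fix \<phi> \<psi> assume *: "\<phi> \<in> cochains s" "\<psi> \<in> cochains s" "tilde ip \<phi> = tilde ip \<psi>"
  have "\<phi> xs = \<psi> xs" for xs
    by (rule ip_eqI) (metis * tilde_snoc_cochain)
  then show "\<phi> = \<psi>" by (rule ext)
qed

lemma tilde_surj:
  assumes f: "f \<in> form_cochains s"
  shows "\<exists>\<phi>\<in>cochains s. tilde ip \<phi> = f"
proof -
  \<comment> \<open>Nondegeneracy provides the vector representing f as a linear form in its last
    argument; uniqueness of this vector then gives linearity of \<phi>.\<close>
  define \<phi> where "\<phi> vs = inv_into UNIV ip (\<lambda>w. f (vs @ [w]))" for vs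
  have \<phi>: "ip (\<phi> vs) w = f (vs @ [w])" for vs w
  proof -
    have "module_hom s (*) (\<lambda>w. f (vs @ [w]))"
      using multilinear_homD[OF form_cochainsD(1)[OF f], of vs "[]"] .
    then have "(\<lambda>w. f (vs @ [w])) \<in> range ip" using ip_bij by (auto simp: bij_betw_def)
    then have "ip (\<phi> vs) = (\<lambda>w. f (vs @ [w]))" unfolding \<phi>_def by (rule f_inv_into_f)
    then show ?thesis by simp
  qed
  have "module_hom s s (\<lambda>v. \<phi> (us @ v # ws))" for us ws
  proof -
    note h = multilinear_homD[OF form_cochainsD(1)[OF f], of us "ws @ [_]"]
    have "\<phi> (us @ (x + y) # ws) = \<phi> (us @ x # ws) + \<phi> (us @ y # ws)" for x y
      by (rule ip_eqI) (simp add: \<phi> module_hom.add[OF ip_linear(2)] module_hom.add[OF h])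
    moreover have "\<phi> (us @ s c x # ws) = s c (\<phi> (us @ x # ws))" for c x
      by (rule ip_eqI) (simp add: \<phi> module_hom.scale[OF ip_linear(2)] module_hom.scale[OF h])
    ultimately show ?thesis by (simp add: module_hom_iff module_s)
  qed
  moreover have "\<phi> [] = 0"
    by (rule ip_eqI) (simp add: \<phi> form_cochainsD(2)[OF f] hom_0[OF ip_linear(2)])
  ultimately have c: "\<phi> \<in> cochains s" by (simp add: cochains_def multilinear_def)
  moreover have "tilde ip \<phi> vs = f vs" for vs
  proof (cases vs rule: rev_cases)
    case (snoc us w)
    then show ?thesis using tilde_snoc_cochain[OF c] \<phi> by simp
  qed (simp add: tilde_Nil form_cochainsD(2)[OF f])
  ultimately show ?thesis by blast
qed

lemma homogeneous_Cons_snoc: "homogeneous V (a # as) (v # us) \<longleftrightarrow> homogeneous V (as @ [a]) (us @ [v])"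
proof -
  have "homogeneous V (as @ [a]) (us @ [v]) \<Longrightarrow> length as = length us"
    using homogeneous_length by fastforce
  moreover have "homogeneous V (a # as) (v # us) \<Longrightarrow> length as = length us"
    using homogeneous_length by fastforce
  ultimately show ?thesis by (auto simp: homogeneous_def list_all2_append)
qed

text \<open>On homogeneous arguments only the component of parity p = a + b +
  \<open>sum_list as\<close> is seen by the inner product; for other p both sides are 0 by evenness.
  For this p, moving v to the second slot costs a * a = a, and a p + a = a (b +
  \<open>sum_list as\<close>) is the exponent of cyclicity for forms.\<close>

lemma cyclic_cochains_iff:
  assumes \<phi>: "\<phi> \<in> cochains s"
  shows "\<phi> \<in> cyclic_cochains s V ip \<longleftrightarrow> tilde ip \<phi> \<in> cyclic_forms s V"
proof -
  let ?f = "tilde ip \<phi>"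
  let ?C = "\<lambda>a as b v us w. ?f (us @ [w] @ [v]) = signed (of_nat (Suc (length us)) + a * (b +
      sum_list as)) (?f (v # us @ [w]))"
  have core: "(ip (parity_part V V p \<phi> (v # us)) w = signed (of_nat (Suc (length us)) + a * p) (ip v
      (parity_part V V p \<phi> (us @ [w]))))
      \<longleftrightarrow> (p = a + b + sum_list as \<longrightarrow> ?C a as b v us w)"
    if hom: "homogeneous V (a # as @ [b]) (v # us @ [w])" for a as b v us w p
  proof -
    have len: "length as = length us" using homogeneous_length[OF hom] by simp
    have h: "homogeneous V (a # as) (v # us)" "homogeneous V (as @ [b]) (us @ [w])" "v \<in> V a" "w \<in> V b"
      using hom len by (auto simp: homogeneous_def list_all2_append)
    note pp = parity_part_homogeneous[OF graded cochainsD(1)[OF \<phi>]]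
    have 1: "parity_part V V p \<phi> (v # us) = part V (p + (a + sum_list as)) (\<phi> (v # us))"
      "parity_part V V p \<phi> (us @ [w]) = part V (p + (b + sum_list as)) (\<phi> (us @ [w]))"
      using pp[OF h(1)] pp[OF h(2)] by (simp_all add: ac_simps)
    show ?thesis
    proof (cases "p = a + b + sum_list as")
      case True
      have b: "p + (a + sum_list as) = b" and a: "p + (b + sum_list as) = a"
        unfolding True by (simp_all add: bit_ring)
      have "ip v (part V a (\<phi> (us @ [w]))) = signed a (ip (\<phi> (us @ [w])) v)"
        using ip_sym[OF h(3) part_decomp(1)[of a]] ip_part[OF h(3)] by (simp add: bit_ring)
      then have "(ip (parity_part V V p \<phi> (v # us)) w = signed (of_nat (Suc (length us)) + a * p)
          (ip v (parity_part V V p \<phi> (us @ [w]))))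
        \<longleftrightarrow> ?f (v # us @ [w]) = signed (of_nat (Suc (length us)) + a * p + a) (?f (us @ [w] @ [v]))"
        unfolding 1 a b using tilde_snoc_cochain[OF \<phi>, of "v # us" w] tilde_snoc_cochain[OF \<phi>, of
            "us @ [w]" v]
        by (simp add: ip_part[OF h(4)])
      also have "of_nat (Suc (length us)) + a * p + a = of_nat (Suc (length us)) + a * (b + sum_list as)"
        unfolding True by (simp add: bit_ring)
      also have "?f (v # us @ [w]) = signed (of_nat (Suc (length us)) + a * (b + sum_list as)) (?f
          (us @ [w] @ [v])) \<longleftrightarrow> ?C a as b v us w"
        by (rule signed_eq_swap)
      finally show ?thesis using True by simp
    next
      case False
      have b: "p + (a + sum_list as) \<noteq> b" and a: "a \<noteq> p + (b + sum_list as)"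
        using False by (cases p; cases a; cases b; cases "sum_list as"; simp)+
      show ?thesis
        unfolding 1 using ip_orthogonal[OF part_decomp(1) h(4) b] ip_orthogonal[OF h(3)
            part_decomp(1) a] False by simp
    qed
  qed
  have "\<phi> \<in> cyclic_cochains s V ip \<longleftrightarrow> (\<forall>a as b v us w. homogeneous V (a # as @ [b]) (v # us @ [w]) \<longrightarrow>
      ?C a as b v us w)"
    unfolding cyclic_cochains_def cyclic_of_parity_def using \<phi> core by auto
  also have "\<dots> \<longleftrightarrow> ?f \<in> cyclic_forms s V"
  proof
    assume C: "\<forall>a as b v us w. homogeneous V (a # as @ [b]) (v # us @ [w]) \<longrightarrow> ?C a as b v us w"
    have "?f (us @ [v]) = signed (of_nat (length us) + a * sum_list as) (?f (v # us))"
      if ne: "us \<noteq> []" and h: "homogeneous V (as @ [a]) (us @ [v])" for as a us v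
    proof -
      obtain us' w where us: "us = us' @ [w]" using ne by (cases us rule: rev_cases) auto
      have "length as = length us" using homogeneous_length[OF h] by simp
      then obtain as' b where as: "as = as' @ [b]" using ne by (cases as rule: rev_cases) auto
      have "homogeneous V (a # as' @ [b]) (v # us' @ [w])"
        using h unfolding us as homogeneous_Cons_snoc .
      with C have "?C a as' b v us' w" by blast
      then show ?thesis by (simp add: us as add.commute)
    qed
    then show "?f \<in> cyclic_forms s V" unfolding cyclic_forms_def using tilde_form[OF \<phi>] by blast
  next
    assume f: "?f \<in> cyclic_forms s V"
    show "\<forall>a as b v us w. homogeneous V (a # as @ [b]) (v # us @ [w]) \<longrightarrow> ?C a as b v us w"
    proof (intro allI impI)
      fix a as b v us w assume "homogeneous V (a # as @ [b]) (v # us @ [w])"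
      then have "homogeneous V ((as @ [b]) @ [a]) ((us @ [w]) @ [v])"
        unfolding homogeneous_Cons_snoc .
      then have "?f ((us @ [w]) @ [v]) = signed (of_nat (length (us @ [w])) + a * sum_list (as @
          [b])) (?f (v # us @ [w]))"
        using f unfolding cyclic_forms_def by blast
      then show "?C a as b v us w" by (simp add: add.commute)
    qed
  qed
  finally show ?thesis .
qed

lemma cyclic_cochains_cochains: "\<phi> \<in> cyclic_cochains s V ip \<Longrightarrow> \<phi> \<in> cochains s"
  by (simp add: cyclic_cochains_def)

lemma cyclic_forms_form: "f \<in> cyclic_forms s V \<Longrightarrow> f \<in> form_cochains s"
  by (simp add: cyclic_forms_def)

lemma tilde_bij: "bij_betw (tilde ip) (cyclic_cochains s V ip) (cyclic_forms s V)"
  unfolding bij_betw_def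
proof
  show "inj_on (tilde ip) (cyclic_cochains s V ip)"
    by (rule inj_on_subset[OF tilde_inj]) (auto simp: cyclic_cochains_def)
  show "tilde ip ` cyclic_cochains s V ip = cyclic_forms s V"
  proof (intro equalityI subsetI)
    fix f assume "f \<in> tilde ip ` cyclic_cochains s V ip"
    then show "f \<in> cyclic_forms s V" using cyclic_cochains_iff cyclic_cochains_cochains by blast
  next
    fix f assume f: "f \<in> cyclic_forms s V"
    then obtain \<phi> where "\<phi> \<in> cochains s" "tilde ip \<phi> = f" using tilde_surj[OF cyclic_forms_form] by blast
    with f show "f \<in> tilde ip ` cyclic_cochains s V ip" using cyclic_cochains_iff by blast
  qed
qed

text \<open>After the shift of parities the inner product becomes graded antisymmetric, that is, symplectic.\<close>

definition sympl :: "bit \<times> 'v \<Rightarrow> bit \<times> 'v \<Rightarrow> 'k" where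
  "sympl x y = signed (fst x) (ip (part V (fst x) (snd x)) (part V (fst y) (snd y)))"

text \<open>For equal labels a the exponent of graded symmetry is a * a = a = (a + 1)(a + 1) + 1;
  for different labels both sides are 0.\<close>

lemma sympl_antisym: "sympl y x = - signed (letter_wt x * letter_wt y) (sympl x y)"
proof (cases "fst x = fst y")
  case True
  then show ?thesis
    unfolding sympl_def
    by (subst ip_sym[OF part_decomp(1) part_decomp(1)]) (simp add: uminus_signed letter_wt_def, rule
        signed_cong, simp add: bit_ring)
next
  case False
  then show ?thesis
    unfolding sympl_def by (simp add: ip_orthogonal[OF part_decomp(1) part_decomp(1)])
qed

text \<open>The part of weight a of the form of \<phi> is a Hamiltonian of
  \<open>operator a \<phi>\<close>: as the inner product pairs equal parities only, restricting the
  weight of words amounts to projecting \<phi> to total parity a.\<close>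

lemma koszul_tilde_snoc:
  assumes \<phi>: "\<phi> \<in> cochains s"
  shows "(if wt (xs @ [w]) = a then koszul (tilde ip \<phi>) (xs @ [w]) else 0) = sympl (operator a \<phi> xs) w"
proof (cases "wt (xs @ [w]) = a")
  case True
  then have a: "a = wt xs + letter_wt w" by simp
  then have b: "a + wt xs + 1 = fst w" by (simp add: letter_wt_def bit_ring)
  show ?thesis
    using True unfolding koszul_def sympl_def operator_def b
    by (simp add: tilde_snoc_cochain[OF \<phi>] hom_signed_arg[OF part_linear] part_part
        hom_signed_arg[OF ip_linear(2)]
        ip_part[OF part_decomp(1)])
      (rule signed_cong, simp add: eps_append a letter_wt_def wt_eq bit_ring)
next
  case False
  then have "fst (operator a \<phi> xs) \<noteq> fst w"
    by (cases a; cases "wt xs"; cases "fst w") (simp_all add: fst_operator letter_wt_def)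
  then show ?thesis using False unfolding sympl_def
    by (simp add: ip_orthogonal[OF part_decomp(1) part_decomp(1)])
qed

lemma sympl_linear: "module_hom s (*) (\<lambda>v. sympl (a, v) w)"
  unfolding sympl_def by (simp add: hom_signed hom_comp[OF part_linear ip_linear(2)])

lemma tilde_bracket:
  assumes \<phi>: "\<phi> \<in> cochains s" "tilde ip \<phi> \<in> cyclic_forms s V"
    and \<psi>: "\<psi> \<in> cochains s" "tilde ip \<psi> \<in> cyclic_forms s V"
  shows "tilde ip (bracket V \<phi> \<psi>) = derivation \<psi> (tilde ip \<phi>)"
proof -
  note br = bracket_cochain[OF \<phi>(1) \<psi>(1)]
  note ml = form_cochainsD(1)[OF tilde_form[OF \<phi>(1)]]
  \<comment> \<open>\<open>lie_der_hamiltonian\<close> asks for operators of a single weight, hence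
    the parts of the forms of fixed weight. They stay cyclic because rotation preserves the weight
    of a word.\<close>
  let ?F = "\<lambda>\<phi> a xs. if wt xs = a then koszul (tilde ip \<phi>) xs else 0"
  have cyc: "koszul_cyclic (?F \<phi> a)" if "\<phi> \<in> cochains s" "tilde ip \<phi> \<in> cyclic_forms s V" for \<phi> a
    using koszul_cyclic_koszul[OF tilde_form[OF that(1)]] that(2)
    by (simp add: koszul_cyclic_def add.commute)
  have sum: "koszul (tilde ip \<phi>) = (\<lambda>xs. \<Sum>a\<in>{0, 1}. ?F \<phi> a xs)"
  proof
    fix xs show "koszul (tilde ip \<phi>) xs = (\<Sum>a\<in>{0, 1}. ?F \<phi> a xs)"
      by (cases "wt xs") simp_all
  qed
  have eq: "koszul (tilde ip (bracket V \<phi> \<psi>)) (xs @ [w]) = koszul (derivation \<psi> (tilde ip \<phi>)) (xs @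
      [w])" for xs w
  proof -
    have "lie_der (operator t \<psi>) (?F \<phi> a) (xs @ [w]) = sympl (a + t + wt xs + 1, commutator a t \<phi> \<psi>
        xs) w" for a t
    proof -
      have "lie_der (operator t \<psi>) (?F \<phi> a) (xs @ [w])
        = nest_sum t (\<lambda>ys. sympl (operator a \<phi> ys) w) (operator t \<psi>) xs
          - signed (a * t) (nest_sum a (\<lambda>ys. sympl (operator t \<psi> ys) w) (operator a \<phi>) xs)"
        by (rule lie_der_hamiltonian[OF cyc[OF \<phi>] cyc[OF \<psi>, of t] weight_operator weight_operator
            koszul_tilde_snoc[OF \<phi>(1)] koszul_tilde_snoc[OF \<psi>(1)] sympl_antisym])
      also have "\<dots> = sympl (a + t + wt xs + 1, commutator a t \<phi> \<psi> xs) w"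
        unfolding nest_sum_letter[of "(*)" "\<lambda>x. sympl x w", OF sympl_linear weight_operator]
            commutator_def
        by (simp add: module_hom.diff[OF sympl_linear] hom_signed_arg[OF sympl_linear]
            add.commute[of t a])
      finally show ?thesis .
    qed
    then have "(\<Sum>t\<in>{0, 1}. \<Sum>a\<in>{0, 1}. sympl (a + t + wt xs + 1, commutator a t \<phi> \<psi> xs) w)
      = (\<Sum>t\<in>{0, 1}. lie_der (operator t \<psi>) (\<lambda>xs. \<Sum>a\<in>{0, 1}. ?F \<phi> a xs) (xs @ [w]))"
      unfolding lie_der_sum by (simp only:)
    then have "koszul (derivation \<psi> (tilde ip \<phi>)) (xs @ [w])
      = (\<Sum>t\<in>{0, 1}. \<Sum>a\<in>{0, 1}. sympl (a + t + wt xs + 1, commutator a t \<phi> \<psi> xs) w)"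
      unfolding koszul_derivation[OF module_mult ml cochainsD(1)[OF \<psi>(1)]] sum[symmetric] by (rule sym)
    also have "\<dots> = (\<Sum>a\<in>{0, 1}. \<Sum>t\<in>{0, 1}. sympl (a + t + wt xs + 1, commutator a t \<phi> \<psi> xs) w)"
      by (rule sum.swap)
    also have "\<dots> = (\<Sum>a\<in>{0, 1}. \<Sum>t\<in>{0, 1}. signed (a + t + wt xs + 1) (ip (commutator a t \<phi> \<psi> xs)
        (part V (fst w) (snd w))))"
      by (simp add: sympl_def part_hom[OF commutator_in])
    also have "\<dots> = koszul (tilde ip (bracket V \<phi> \<psi>)) (xs @ [w])"
      unfolding koszul_def proj_simps(1,2,3) tilde_snoc_cochain[OF br] bracket_commutator[OF \<phi>(1) \<psi>(1)]
        hom_sum_arg[OF ip_linear(2)] hom_signed_arg[OF ip_linear(2)] signed_sum signed_signed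
      by (intro sum.cong refl signed_cong) (simp add: eps_append wt_eq bit_ring)
    finally show ?thesis ..
  qed
  show ?thesis
  proof (rule koszul_inject[OF form_cochainsD(1)[OF tilde_form[OF br]] derivation_multilinear[OF
      module_mult ml cochainsD(1)[OF \<psi>(1)]]], rule ext)
    fix xs
    show "koszul (tilde ip (bracket V \<phi> \<psi>)) xs = koszul (derivation \<psi> (tilde ip \<phi>)) xs"
    proof (cases xs rule: rev_cases)
      case Nil
      have "derivation \<psi> (tilde ip \<phi>) \<in> form_cochains s"
        using derivation_cyclic[OF tilde_form[OF \<phi>(1)] \<psi>(1)] cyclic_forms_form by blast
      then show ?thesis unfolding Nil koszul_def by (simp add: tilde_Nil form_cochainsD(2))
    next
      case (snoc ys y)
      then show ?thesis using eq by simp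
    qed
  qed
qed

lemma bracket_cyclic:
  assumes "\<phi> \<in> cyclic_cochains s V ip" "\<psi> \<in> cyclic_cochains s V ip"
  shows "bracket V \<phi> \<psi> \<in> cyclic_cochains s V ip" "tilde ip (bracket V \<phi> \<psi>) = derivation \<psi> (tilde ip \<phi>)"
proof -
  note c = assms[THEN cyclic_cochains_cochains]
  have t: "tilde ip \<phi> \<in> cyclic_forms s V" "tilde ip \<psi> \<in> cyclic_forms s V"
    using assms cyclic_cochains_iff[OF c(1)] cyclic_cochains_iff[OF c(2)] by simp_all
  show *: "tilde ip (bracket V \<phi> \<psi>) = derivation \<psi> (tilde ip \<phi>)"
    by (rule tilde_bracket[OF c(1) t(1) c(2) t(2)])
  show "bracket V \<phi> \<psi> \<in> cyclic_cochains s V ip"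
    unfolding cyclic_cochains_iff[OF bracket_cochain[OF c]] *
    by (rule derivation_cyclic[OF tilde_form[OF c(1)] c(2)])
qed

text \<open>Unwinds the twists into the explicit rotation formula; stated for arbitrary cochains
  \<psi>, it serves the bracket and D alike.\<close>

lemma derivation_rotation_sum:
  assumes f: "f \<in> form_cochains s" and \<psi>: "\<psi> \<in> cochains s"
    and q: "\<And>l. l \<ge> 1 \<Longrightarrow> has_parity V V (q l) (arity_part l \<psi>)"
    and len: "length vs = n + 1" and hom: "homogeneous V as vs"
  shows "derivation \<psi> f vs = rotation_sum as q f \<psi> vs"
proof -
  define xs where "xs = zip as vs"
  have las: "length as = length vs" by (rule homogeneous_length[OF hom])
  have lxs: "length xs = Suc n" using las len by (simp add: xs_def)
  have fst: "map fst xs = as" and snd: "map snd xs = vs" using las by (simp_all add: xs_def)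
  have homx: "\<And>x. x \<in> set xs \<Longrightarrow> snd x \<in> V (fst x)"
    using hom unfolding homogeneous_def xs_def list_all2_iff by auto
  have proj: "proj ys = map snd ys" if "set ys \<subseteq> set xs" for ys
  proof -
    have "part V (fst x) (snd x) = snd x" if "x \<in> set xs" for x
      using part_hom[OF homx[OF that]] by simp
    then show ?thesis using that by (induction ys) auto
  qed
  let ?K = "\<lambda>t y z. koszul f (operator t \<psi> y # z)"
  \<comment> \<open>A component of parity q l and arity l has total parity q l + l + 1, so only this
    t contributes for a block y of length l.\<close>
  have K: "(\<Sum>t\<in>{0, 1}. ?K t y z) = signed (eps (map fst (y @ z)) + (of_nat (length z) + 1) * q
      (length y))
      (f (\<psi> (map snd y) # map snd z))"
    if y: "y \<noteq> []" and sub: "set (y @ z) \<subseteq> set xs" for y z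
  proof -
    let ?l = "length y" let ?t = "q ?l + of_nat ?l + 1"
    have py: "proj y = map snd y" and pz: "proj z = map snd z" using sub by (simp_all add: proj)
    have "homogeneous V (map fst y) (map snd y)" using homogeneous_proj[of y] py by simp
    moreover have "1 \<le> ?l" using y by (cases y) simp_all
    ultimately have \<psi>y: "\<psi> (map snd y) \<in> V (q ?l + sum_list (map fst y))"
      using q[of ?l] unfolding has_parity_def arity_part_def by fastforce
    have "?K t y z = 0" if "t \<noteq> ?t" for t
    proof -
      have "t + wt y + 1 \<noteq> q ?l + sum_list (map fst y)"
        using that unfolding wt_eq
        by (cases t; cases "q ?l"; cases "sum_list (map fst y)"; cases "of_nat ?l :: bit"; simp)
      then have "opv t \<psi> y = 0" unfolding operator_def by (simp add: py part_hom[OF \<psi>y])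
      then show ?thesis
        using hom_0[OF alinear_hom_Cons[OF alinear_koszul[OF form_cochainsD(1)[OF f]]]] by (metis
            prod.collapse)
    qed
    then have "(\<Sum>t\<in>{0, 1}. ?K t y z) = ?K ?t y z" by (rule sum_bit_single)
    also have "\<dots> = signed (eps (map fst (y @ z)) + (of_nat (length z) + 1) * q ?l) (f (\<psi> (map snd y)
        # map snd z))"
    proof -
      have b: "?t + wt y + 1 = q ?l + sum_list (map fst y)" by (simp add: wt_eq bit_ring)
      show ?thesis
        unfolding koszul_def operator_def b py
        by (simp add: pz part_hom[OF \<psi>y] hom_signed_arg[OF part_linear]
            hom_signed_arg[OF multilinear_homD[OF form_cochainsD(1)[OF f], of "[]", simplified]])
          (rule signed_cong, simp add: eps_append bit_ring)
    qed
    finally show ?thesis .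
  qed
  have inner: "(\<Sum>t\<in>{0, 1}. split_sum (?K t) ys) = (\<Sum>(k, l)\<in>arity_pairs n.
      signed (eps (map fst ys) + of_nat (k - 1) * q l) (f (\<psi> (take l (map snd ys)) # drop l (map snd
          ys))))"
    if ys: "set ys \<subseteq> set xs" "length ys = Suc n" for ys
  proof -
    let ?g = "\<lambda>l. \<Sum>t\<in>{0, 1}. ?K t (take l ys) (drop l ys)"
    have g: "?g l = signed (eps (map fst ys) + (of_nat (Suc n - l) + 1) * q l) (f (\<psi> (take l (map
        snd ys)) # drop l (map snd ys)))"
      if "1 \<le> l" "l \<le> Suc n" for l
    proof -
      have "take l ys \<noteq> []" "length (take l ys) = l" "length (drop l ys) = Suc n - l" using that ys
          by auto
      then show ?thesis using K[of "take l ys" "drop l ys"] ys by (simp add: take_map drop_map)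
    qed
    have "(\<Sum>t\<in>{0, 1}. split_sum (?K t) ys) = (\<Sum>l\<le>Suc n. ?g l)"
      unfolding split_sum_atMost ys(2) by (rule sum.swap)
    \<comment> \<open>The term l = 0 drops out because \<psi> vanishes on the empty list, and l = n
      + 1 because f vanishes on a single argument; the remaining l leave k = n + 1 - l \<ge>
      1.\<close>
    also have "\<dots> = (\<Sum>l\<in>{1..n}. ?g l)"
    proof (rule sum.mono_neutral_right)
      show "\<forall>l\<in>{..Suc n} - {1..n}. ?g l = 0"
      proof
        fix l assume "l \<in> {..Suc n} - {1..n}"
        then consider "l = 0" | "l = Suc n" by (auto simp: not_less_eq_eq)
        then show "?g l = 0"
        proof cases
          case 1
          then show ?thesis
            using alinear_operator_Nil[OF alinear_koszul[OF form_cochainsD(1)[OF f]] \<psi>, of "[]"] by simp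
        next
          case 2
          then show ?thesis using g[of l] ys by (simp add: form_cochainsD(2)[OF f])
        qed
      qed
    qed auto
    also have "\<dots> = (\<Sum>(k, l)\<in>arity_pairs n.
      signed (eps (map fst ys) + of_nat (k - 1) * q l) (f (\<psi> (take l (map snd ys)) # drop l (map snd
          ys))))"
    proof (rule sum.reindex_bij_witness[of _ "snd" "\<lambda>l. (n + 1 - l, l)"])
      fix l assume l: "l \<in> {1..n}"
      have "of_nat (Suc n - l) + 1 = (of_nat (Suc n - l - 1) :: bit)"
        using of_nat_pred[of "Suc n - l"] l by (simp add: le_diff_conv2)
      then show "(case (n + 1 - l, l) of (k, l) \<Rightarrow> signed (eps (map fst ys) + of_nat (k - 1) * q l)
          (f (\<psi> (take l (map snd ys)) # drop l (map snd ys)))) = ?g l"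
        using g[of l] l by simp
    qed (auto simp: arity_pairs_def)
    finally show ?thesis .
  qed
  have "derivation \<psi> f vs = signed (eps as) (\<Sum>t\<in>{0, 1}. \<Sum>i\<le>n. signed (wt (take i xs) * wt (drop i
      xs)) (split_sum (?K t) (rotate i xs)))"
    unfolding derivation_homogeneous[OF module_mult form_cochainsD(1)[OF f] cochainsD(1)[OF \<psi>] hom]
        xs_def[symmetric]
      lie_der_def cyclic_sum_atMost[OF lxs] ..
  also have "\<dots> = (\<Sum>i\<le>n. signed (eps as + wt (take i xs) * wt (drop i xs)) (\<Sum>t\<in>{0, 1}. split_sum (?K
      t) (rotate i xs)))"
    unfolding signed_sum signed_signed by (rule sum.swap)
  also have "\<dots> = (\<Sum>i\<le>n. \<Sum>(k, l)\<in>arity_pairs n.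
      signed (sum_list (take i as) * sum_list (drop i as) + of_nat (i * n) + of_nat (k - 1) * q l)
         (f (\<psi> (take l (rotate i vs)) # drop l (rotate i vs))))"
  proof (rule sum.cong[OF refl])
    fix i assume "i \<in> {..n}"
    then have i: "i \<le> n" by simp
    have rot: "rotate i xs = drop i xs @ take i xs" using i lxs by (simp add: rotate_drop_take)
    have "map snd (rotate i xs) = rotate i vs" by (simp add: rotate_map[symmetric] snd)
    moreover note inn = inner[of "rotate i xs", simplified lxs set_rotate length_rotate, OF
        order_refl refl]
    \<comment> \<open>Let A, B be the parity sums and i, j the lengths of the two blocks. The two
      \<open>eps\<close> terms contribute j A + i B, and the weights multiply to (A + i)(B + j), so
      A B + i j remains; and i j = i (n + 1 - i) equals i n modulo 2.\<close>
    moreover have sg: "eps as + wt (take i xs) * wt (drop i xs) + eps (map fst (rotate i xs)) =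
        sum_list (take i as) * sum_list (drop i as) + of_nat (i * n)"
    proof -
      have l: "length (take i xs) = i" "of_nat (length (drop i xs)) = of_nat n + 1 + (of_nat i :: bit)"
      proof -
        have "of_nat (length (drop i xs)) + of_nat i = (of_nat (Suc n) :: bit)"
          using i lxs unfolding of_nat_add[symmetric] by simp
        then show "of_nat (length (drop i xs)) = of_nat n + 1 + (of_nat i :: bit)"
          by (metis add.commute bit_self(2) of_nat_Suc)
      qed (use i lxs in simp)
      have "eps as = eps (map fst (take i xs @ drop i xs))" by (simp add: fst)
      also have "\<dots> = eps (map fst (take i xs)) + of_nat (length (drop i xs)) * sum_list (take i as)
          + eps (map fst (drop i xs))"
        by (simp only: map_append eps_append length_map) (simp add: fst[symmetric] take_map)
      finally show ?thesis
        unfolding rot map_append eps_append wt_eq length_map l fst[symmetric] take_map drop_map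
            of_nat_mult
        by (simp add: bit_ring)
    qed
    ultimately show "signed (eps as + wt (take i xs) * wt (drop i xs)) (\<Sum>t\<in>{0, 1}. split_sum (?K t)
        (rotate i xs)) =
       (\<Sum>(k, l)\<in>arity_pairs n.
      signed (sum_list (take i as) * sum_list (drop i as) + of_nat (i * n) + of_nat (k - 1) * q l)
         (f (\<psi> (take l (rotate i vs)) # drop l (rotate i vs))))"
      unfolding inn signed_sum case_prod_unfold signed_signed add.assoc[symmetric] sg by simp
  qed
  also have "\<dots> = rotation_sum as q f \<psi> vs"
    unfolding rotation_sum_def Let_def len case_prod_unfold add_diff_cancel_right' by (rule sum.swap)
  finally show ?thesis .
qed

end

section \<open>Bidegrees\<close>

lemma module_form_scale: "module (form_scale :: 'k::comm_ring_1 \<Rightarrow> ('v list \<Rightarrow> 'k) \<Rightarrow> _)"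
  by unfold_locales (simp_all add: form_scale_def fun_eq_iff algebra_simps)

lemma graded_ground: "graded_module (*) (ground :: bit \<Rightarrow> 'k::comm_ring_1 set)"
proof -
  have "module.subspace (*) (ground a :: 'k set)" for a
    by (simp add: module.subspace_def[OF module_mult] ground_def)
  moreover have "\<exists>!p. p \<in> ground 0 \<times> ground 1 \<and> v = fst p + snd p" for v :: 'k
    by (rule ex1I[of _ "(v, 0)"]) (auto simp: ground_def)
  ultimately show ?thesis using module_mult by (simp add: graded_module_def)
qed

lemma part_ground: "part ground a c = (if a = 0 then c else 0)"
  using part_homogeneous[OF graded_ground, of c 0 a] by (simp add: ground_def)

lemma multilinear_add: "multilinear s t f \<Longrightarrow> multilinear s t g \<Longrightarrow> multilinear s t (f + g)"
  by (simp add: multilinear_def hom_add)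

lemma of_nat_eq_of_int: "int n = r \<Longrightarrow> of_nat n = (of_int r :: bit)"
  by auto

context graded_space
begin

definition bidegree_part :: "bit \<times> int \<Rightarrow> ('v list \<Rightarrow> 'k) \<Rightarrow> 'v list \<Rightarrow> 'k" where
  "bidegree_part g f vs = (if int (length vs) = snd g + 2 then parity_part V ground (fst g) f vs else 0)"

lemma bidegree_part_homogeneous:
  assumes "multilinear s (*) f" "homogeneous V as vs"
  shows "bidegree_part g f vs = (if int (length vs) = snd g + 2 \<and> fst g = sum_list as then f vs else 0)"
proof -
  have "fst g + sum_list as = 0 \<longleftrightarrow> fst g = sum_list as" by (cases "fst g"; cases "sum_list as"; simp)
  then show ?thesis
    using parity_part_homogeneous[OF graded_ground assms] by (simp add: bidegree_part_def part_ground)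
qed

text \<open>Varying an argument keeps the length of the list, so the condition is constant along
  each slot.\<close>

lemma multilinear_length_If:
  assumes "\<And>n. P n \<Longrightarrow> multilinear s t (f n)" "module t"
  shows "multilinear s t (\<lambda>vs. if P (length vs) then f (length vs) vs else 0)"
  unfolding multilinear_def
proof (intro allI)
  fix us ws :: "'v list"
  show "module_hom s t (\<lambda>v. if P (length (us @ v # ws)) then f (length (us @ v # ws)) (us @ v # ws)
      else 0)"
    using multilinear_homD[OF assms(1), of "Suc (length us + length ws)" us ws] hom_zero[OF module_s
        assms(2)]
    by (cases "P (Suc (length us + length ws))") simp_all
qed

lemma bidegree_part_multilinear:
  assumes "multilinear s (*) f"
  shows "multilinear s (*) (bidegree_part g f)"
  unfolding bidegree_part_def
  by (rule multilinear_length_If[where P="\<lambda>n. int n = snd g + 2"])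
    (simp_all add: parity_part_multilinear[OF graded_ground assms] module_mult)

lemma subspace_cyclic_forms: "module.subspace form_scale (cyclic_forms s V)"
proof -
  have "x + y \<in> cyclic_forms s V" if "x \<in> cyclic_forms s V" "y \<in> cyclic_forms s V" for x y
  proof -
    have "x + y \<in> form_cochains s"
      using that by (simp add: cyclic_forms_def form_cochains_def multilinear_add)
    then show ?thesis using that unfolding cyclic_forms_def by (auto simp: signed_add)
  qed
  moreover have "form_scale c x \<in> cyclic_forms s V" if "x \<in> cyclic_forms s V" for c x
  proof -
    have "module_hom s (*) (\<lambda>v. c * x (us @ v # ws))" for us ws
      using that unfolding cyclic_forms_def form_cochains_def multilinear_def module_hom_iff
      by (auto simp: algebra_simps)
    then have "form_scale c x \<in> form_cochains s"
      using that unfolding cyclic_forms_def form_cochains_def multilinear_def form_scale_def by auto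
    moreover have "form_scale c x (us @ [w]) = signed (of_nat (length us) + b * sum_list as)
        (form_scale c x (w # us))"
      if "us \<noteq> []" "homogeneous V (as @ [b]) (us @ [w])" for as b us w
      using that \<open>x \<in> cyclic_forms s V\<close> mult_signed[of c] unfolding cyclic_forms_def form_scale_def
          by auto
    ultimately show ?thesis unfolding cyclic_forms_def by blast
  qed
  moreover have "0 \<in> cyclic_forms s V"
    by (simp add: cyclic_forms_def form_cochains_def multilinear_def hom_zero module_s module_mult)
  ultimately show ?thesis by (simp add: module.subspace_def[OF module_form_scale])
qed

lemma cyclic_forms_add: "x \<in> cyclic_forms s V \<Longrightarrow> y \<in> cyclic_forms s V \<Longrightarrow> x + y \<in> cyclic_forms s V"
  and cyclic_forms_scale: "x \<in> cyclic_forms s V \<Longrightarrow> form_scale c x \<in> cyclic_forms s V"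
  using subspace_cyclic_forms by (simp_all add: module.subspace_def[OF module_form_scale])

lemma cyclic_forms_multilinear: "f \<in> cyclic_forms s V \<Longrightarrow> multilinear s (*) f"
  by (simp add: cyclic_forms_def form_cochains_def)

lemma bideg_iff: "f \<in> cyclic_forms_bideg s V g \<longleftrightarrow> f \<in> cyclic_forms s V \<and>
    (\<forall>as vs. homogeneous V as vs \<longrightarrow> \<not> (int (length vs) = snd g + 2 \<and> fst g = sum_list as) \<longrightarrow> f vs = 0)"
  (is "_ \<longleftrightarrow> _ \<and> ?P")
proof (cases "f \<in> cyclic_forms s V")
  case True
  have "has_parity V ground (fst g) f \<and> (\<forall>vs. int (length vs) \<noteq> snd g + 2 \<longrightarrow> f vs = 0) \<longleftrightarrow> ?P"
  proof
    assume *: "has_parity V ground (fst g) f \<and> (\<forall>vs. int (length vs) \<noteq> snd g + 2 \<longrightarrow> f vs = 0)"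
    show ?P
    proof (intro allI impI)
      fix as vs assume h: "homogeneous V as vs" "\<not> (int (length vs) = snd g + 2 \<and> fst g = sum_list as)"
      have "fst g \<noteq> sum_list as \<Longrightarrow> fst g + sum_list as = 1" by (cases "fst g"; cases "sum_list as"; simp)
      moreover have "f vs \<in> ground (fst g + sum_list as)" using * h(1) by (simp add: has_parity_def)
      ultimately show "f vs = 0" using h(2) * by (auto simp: ground_def split: if_splits)
    qed
  next
    assume P: ?P
    have "has_parity V ground (fst g) f"
      unfolding has_parity_def
    proof (intro allI impI)
      fix as vs assume "homogeneous V as vs"
      then show "f vs \<in> ground (fst g + sum_list as)"
        using P by (cases "fst g"; cases "sum_list as") (auto simp: ground_def)
    qed
    \<comment> \<open>The condition speaks of homogeneous arguments only; comparing f with its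
      truncation carries the vanishing in the wrong arities over to all arguments.\<close>
    moreover have "f = (\<lambda>vs. if int (length vs) = snd g + 2 then f vs else 0)"
    proof (rule multilinear_eqI[OF cyclic_forms_multilinear[OF True]])
      show "multilinear s (*) (\<lambda>vs. if int (length vs) = snd g + 2 then f vs else 0)"
        by (rule multilinear_length_If[where P="\<lambda>n. int n = snd g + 2"]) (simp_all add:
            cyclic_forms_multilinear[OF True] module_mult)
    qed (use P in auto)
    ultimately show "has_parity V ground (fst g) f \<and> (\<forall>vs. int (length vs) \<noteq> snd g + 2 \<longrightarrow> f vs = 0)"
        by metis
  qed
  then show ?thesis using True by (simp add: cyclic_forms_bideg_def split_beta)
qed (simp add: cyclic_forms_bideg_def split_beta)

lemma bideg_cyclic: "f \<in> cyclic_forms_bideg s V g \<Longrightarrow> f \<in> cyclic_forms s V"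
  by (simp add: bideg_iff)

lemma koszul_cyclic_cyclic_forms: "f \<in> cyclic_forms s V \<Longrightarrow> koszul_cyclic (koszul f)"
  using koszul_cyclic_koszul by (auto simp: cyclic_forms_def)

lemma bidegree_part_in:
  assumes f: "f \<in> cyclic_forms s V"
  shows "bidegree_part g f \<in> cyclic_forms_bideg s V g"
proof -
  note ml = cyclic_forms_multilinear[OF f]
  have "parity_part V ground p f vs = 0" if "length vs < 2" for p vs
  proof -
    have "f us = 0" if "length us < 2" for us using f that by (simp add: cyclic_forms_def
        form_cochains_def)
    then show ?thesis using that by (simp add: parity_part_def part_ground)
  qed
  then have form: "bidegree_part g f \<in> form_cochains s"
    using bidegree_part_multilinear[OF ml] by (auto simp: form_cochains_def bidegree_part_def)
  have "koszul (bidegree_part g f) xs = (if int (length xs) = snd g + 2 \<and> fst g = sum_list (map fst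
      xs) then koszul f xs else 0)" for xs
    unfolding koszul_def bidegree_part_homogeneous[OF ml homogeneous_proj] by simp
  then have "koszul_cyclic (koszul (bidegree_part g f))"
    using koszul_cyclic_cyclic_forms[OF f] by (auto simp: koszul_cyclic_def add.commute)
  then have "bidegree_part g f \<in> cyclic_forms s V" using koszul_cyclic_koszul[OF form] by simp
  then show ?thesis unfolding bideg_iff using bidegree_part_homogeneous[OF ml] by auto
qed

lemma graded_product_cyclic_forms: "graded_product form_scale (cyclic_forms s V) (cyclic_forms_bideg
    s V)"
proof -
  let ?L = "cyclic_forms s V" and ?H = "cyclic_forms_bideg s V"
  have sub: "module.subspace form_scale (?H g)" for g
    using subspace_cyclic_forms unfolding module.subspace_def[OF module_form_scale]
    by (auto simp: bideg_iff form_scale_def)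
  have lin: "linear_on form_scale ?L (bidegree_part g)" for g
    unfolding linear_on_def
  proof (intro conjI ballI allI)
    fix x y assume x: "x \<in> ?L" and y: "y \<in> ?L"
    show "bidegree_part g (x + y) = bidegree_part g x + bidegree_part g y"
    proof (rule multilinear_eqI)
      show "multilinear s (*) (bidegree_part g (x + y))"
        using x y by (intro bidegree_part_multilinear cyclic_forms_multilinear cyclic_forms_add)
      show "multilinear s (*) (bidegree_part g x + bidegree_part g y)"
        using x y by (intro cyclic_forms_multilinear cyclic_forms_add bideg_cyclic[OF bidegree_part_in])
    qed (simp add: bidegree_part_homogeneous cyclic_forms_multilinear x y cyclic_forms_add)
  next
    fix c x assume x: "x \<in> ?L"
    show "bidegree_part g (form_scale c x) = form_scale c (bidegree_part g x)"
    proof (rule multilinear_eqI)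
      show "multilinear s (*) (bidegree_part g (form_scale c x))"
        using x by (intro bidegree_part_multilinear cyclic_forms_multilinear cyclic_forms_scale)
      show "multilinear s (*) (form_scale c (bidegree_part g x))"
        using x by (intro cyclic_forms_multilinear cyclic_forms_scale bideg_cyclic[OF bidegree_part_in])
    qed (simp add: bidegree_part_homogeneous cyclic_forms_multilinear x cyclic_forms_scale form_scale_def
        bidegree_part_homogeneous[OF cyclic_forms_multilinear[OF cyclic_forms_scale[OF x]], unfolded
            form_scale_def])
  qed
  have id: "bidegree_part h x = (if h = g then x else 0)" if x: "x \<in> ?H g" for g h x
  proof (rule multilinear_eqI)
    note ml = cyclic_forms_multilinear[OF bideg_cyclic[OF x]]
    show "multilinear s (*) (bidegree_part h x)" by (rule bidegree_part_multilinear[OF ml])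
    show "multilinear s (*) (if h = g then x else 0)"
      using ml by (auto simp: multilinear_def hom_zero module_s module_mult)
    fix as vs assume hom: "homogeneous V as vs"
    show "bidegree_part h x vs = (if h = g then x else 0) vs"
      using x[unfolded bideg_iff, THEN conjunct2, rule_format, OF hom]
      by (auto simp: bidegree_part_homogeneous[OF ml hom] prod_eq_iff)
  qed
  have "bij_betw (\<lambda>x g. bidegree_part g x) ?L {x. \<forall>g. x g \<in> ?H g}"
    unfolding bij_betw_def
  proof
    show "inj_on (\<lambda>x g. bidegree_part g x) ?L"
    proof (rule inj_onI)
      fix x y assume x: "x \<in> ?L" and y: "y \<in> ?L" and eq: "(\<lambda>g. bidegree_part g x) = (\<lambda>g.
          bidegree_part g y)"
      show "x = y"
      proof (rule multilinear_eqI[OF cyclic_forms_multilinear[OF x] cyclic_forms_multilinear[OF y]])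
        fix as vs assume hom: "homogeneous V as vs"
        show "x vs = y vs"
          using fun_cong[OF fun_cong[OF eq, of "(sum_list as, int (length vs) - 2)"], of vs]
          by (simp add: bidegree_part_homogeneous[OF _ hom] cyclic_forms_multilinear x y)
      qed
    qed
    show "(\<lambda>x g. bidegree_part g x) ` ?L = {x. \<forall>g. x g \<in> ?H g}"
    proof (intro equalityI subsetI)
      fix X assume "X \<in> {x. \<forall>g. x g \<in> ?H g}"
      then have X: "X g \<in> ?H g" for g by blast
      \<comment> \<open>A list of given length meets only two bidegrees, one for each parity, so
        this sum is finite even if infinitely many members of X are nonzero. The offset 2 reflects
        that degree r means r + 2 arguments.\<close>
      define x where "x vs = (\<Sum>p\<in>{0, 1}. X (p, int (length vs) - 2) vs)" for vs
      have mlX: "multilinear s (*) (X g)" for g by (rule cyclic_forms_multilinear[OF bideg_cyclic[OF X]])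
      have "multilinear s (*) (\<lambda>vs. \<Sum>p\<in>{0, 1}. X (p, int n - 2) vs)" for n
        unfolding multilinear_def by (intro allI hom_sum module_s module_mult multilinear_homD[OF mlX])
      from multilinear_length_If[where P="\<lambda>_. True", OF this module_mult]
      have ml: "multilinear s (*) x" by (simp add: x_def[abs_def])
      have form: "x \<in> form_cochains s"
        using ml bideg_cyclic[OF X] by (simp add: form_cochains_def cyclic_forms_def x_def)
      have "koszul x xs = (\<Sum>p\<in>{0, 1}. koszul (X (p, int (length xs) - 2)) xs)" for xs
        by (simp add: koszul_def x_def signed_add)
      then have "koszul_cyclic (koszul x)"
        using koszul_cyclic_cyclic_forms[OF bideg_cyclic[OF X]]
        by (simp add: koszul_cyclic_def signed_add)
      then have xL: "x \<in> ?L" using koszul_cyclic_koszul[OF form] by simp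
      have "bidegree_part g x = X g" for g
      proof (rule multilinear_eqI[OF bidegree_part_multilinear[OF ml] mlX])
        fix as vs assume hom: "homogeneous V as vs"
        note X0 = X[unfolded bideg_iff, THEN conjunct2, rule_format, OF hom]
        have "x vs = X g vs" if "int (length vs) = snd g + 2" "fst g = sum_list as"
        proof -
          have "x vs = X (sum_list as, int (length vs) - 2) vs"
            unfolding x_def by (rule sum_bit_single) (simp add: X0)
          then show ?thesis using that by (metis add_diff_cancel_right' prod.collapse)
        qed
        then show "bidegree_part g x vs = X g vs"
          using X0[of g] by (auto simp: bidegree_part_homogeneous[OF ml hom])
      qed
      then have "X = (\<lambda>g. bidegree_part g x)" by simp
      then show "X \<in> (\<lambda>x g. bidegree_part g x) ` ?L" using xL by (rule image_eqI)
    qed (auto intro: bidegree_part_in)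
  qed
  then show ?thesis
    unfolding graded_product_def
    using module_form_scale subspace_cyclic_forms sub lin id bideg_cyclic by blast
qed

end

section \<open>The differential graded Lie algebra of cyclic forms\<close>

context inner_product_space
begin

definition untilde :: "('v list \<Rightarrow> 'k) \<Rightarrow> 'v list \<Rightarrow> 'v" where
  "untilde = inv_into (cochains s) (tilde ip)"

lemma untilde:
  assumes "f \<in> cyclic_forms s V"
  shows "untilde f \<in> cochains s" "tilde ip (untilde f) = f" "untilde f \<in> cyclic_cochains s V ip"
proof -
  have "f \<in> tilde ip ` cochains s"
    using tilde_surj[OF cyclic_forms_form[OF assms]] by auto
  then show 1: "untilde f \<in> cochains s" "tilde ip (untilde f) = f"
    unfolding untilde_def by (rule inv_into_into, rule f_inv_into_f)
  then show "untilde f \<in> cyclic_cochains s V ip" using cyclic_cochains_iff assms by simp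
qed

lemma untilde_tilde: "\<phi> \<in> cochains s \<Longrightarrow> untilde (tilde ip \<phi>) = \<phi>"
  unfolding untilde_def by (rule inv_into_f_f[OF tilde_inj])

lemma untilde_add:
  assumes "f \<in> cyclic_forms s V" "g \<in> cyclic_forms s V"
  shows "untilde (f + g) = untilde f + untilde g"
proof -
  have c: "untilde f + untilde g \<in> cochains s"
    using untilde(1)[OF assms(1)] untilde(1)[OF assms(2)]
    by (simp add: cochains_def multilinear_add)
  have "tilde ip (untilde f + untilde g) vs = (tilde ip (untilde f) + tilde ip (untilde g)) vs" for vs
    by (simp add: tilde_def module_hom.add[OF ip_linear(2)])
  then have "tilde ip (untilde f + untilde g) = f + g"
    using untilde(2)[OF assms(1)] untilde(2)[OF assms(2)] by (simp add: fun_eq_iff)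
  then show ?thesis using untilde_tilde[OF c] by simp
qed

lemma untilde_scale:
  assumes "f \<in> cyclic_forms s V"
  shows "untilde (form_scale c f) = (\<lambda>vs. s c (untilde f vs))"
proof -
  have "module_hom s s (\<lambda>v. s c (untilde f (us @ v # ws)))" for us ws
    using multilinear_homD[OF cochainsD(1)[OF untilde(1)[OF assms]], of us ws]
    by (auto simp: module_hom_iff module.scale_right_distrib module.scale_scale mult.commute)
  then have c: "(\<lambda>vs. s c (untilde f vs)) \<in> cochains s"
    using cochainsD(2)[OF untilde(1)[OF assms]]
    by (simp add: cochains_def multilinear_def module.scale_zero_right[OF module_s])
  have "tilde ip (\<lambda>vs. s c (untilde f vs)) vs = c * tilde ip (untilde f) vs" for vs
    by (simp add: tilde_def module_hom.scale[OF ip_linear(2)])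
  then have "tilde ip (\<lambda>vs. s c (untilde f vs)) = form_scale c f"
    using untilde(2)[OF assms] by (simp add: fun_eq_iff form_scale_def)
  then show ?thesis using untilde_tilde[OF c] by simp
qed

lemma form_bracket_derivation:
  assumes "f \<in> cyclic_forms s V" "g \<in> cyclic_forms s V"
  shows "form_bracket s V ip f g = derivation (untilde g) f"
  unfolding form_bracket_def untilde_def[symmetric]
  using bracket_cyclic(2)[OF untilde(3)[OF assms(1)] untilde(3)[OF assms(2)]] untilde(2)[OF
      assms(1)] by simp

lemma form_bracket_in:
  assumes "f \<in> cyclic_forms s V" "g \<in> cyclic_forms s V"
  shows "form_bracket s V ip f g \<in> cyclic_forms s V"
  unfolding form_bracket_derivation[OF assms]
  by (rule derivation_cyclic[OF cyclic_forms_form[OF assms(1)] untilde(1)[OF assms(2)]])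

lemma untilde_support:
  assumes f: "f \<in> cyclic_forms_bideg s V g" and len: "int (length vs) \<noteq> snd g + 1"
  shows "untilde f vs = 0"
proof (rule ip_eqI)
  note c = untilde[OF bideg_cyclic[OF f]]
  fix b w assume "w \<in> V b"
  have "ip (untilde f vs) w = f (vs @ [w])" using tilde_snoc_cochain[OF c(1)] c(2) by metis
  also have "\<dots> = 0"
    using f len by (simp add: cyclic_forms_bideg_def split_beta)
  finally show "ip (untilde f vs) w = ip 0 w" by (simp add: hom_0[OF ip_linear(2)])
qed

lemma untilde_pure:
  assumes f: "f \<in> cyclic_forms_bideg s V g"
  shows "pure (total_parity g) (untilde f)"
  unfolding pure_def
proof (intro allI impI)
  note c = untilde[OF bideg_cyclic[OF f]]
  fix as vs assume hom: "homogeneous V as vs"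
  show "untilde f vs \<in> V (total_parity g + sum_list as + of_nat (length vs) + 1)"
  proof (cases "int (length vs) = snd g + 1")
    case True
    then have "of_nat (length vs) = of_int (snd g) + (1::bit)" using of_nat_eq_of_int[OF True] by simp
    then have *: "total_parity g + sum_list as + of_nat (length vs) + 1 = fst g + sum_list as"
      by (simp add: total_parity_def split_beta bit_ring)
    \<comment> \<open>By nondegeneracy it suffices to pair with homogeneous w; for w of any other
      parity, f vanishes on \<open>vs @ [w]\<close> by its bidegree.\<close>
    have "untilde f vs = part V (fst g + sum_list as) (untilde f vs)"
    proof (rule ip_eqI)
      fix b w assume w: "w \<in> V b"
      show "ip (untilde f vs) w = ip (part V (fst g + sum_list as) (untilde f vs)) w"
      proof (cases "b = fst g + sum_list as")
        case False
        then have "fst g \<noteq> sum_list (as @ [b])" by (cases b; cases "fst g"; cases "sum_list as"; simp)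
        moreover have "homogeneous V (as @ [b]) (vs @ [w])"
          using hom w by (simp add: homogeneous_def list_all2_appendI)
        ultimately have "f (vs @ [w]) = 0" using f unfolding bideg_iff by blast
        then have "ip (untilde f vs) w = 0" using tilde_snoc_cochain[OF c(1)] c(2) by metis
        then show ?thesis using ip_orthogonal[OF part_decomp(1) w] False by metis
      qed (use ip_part[OF w] in simp)
    qed
    then show ?thesis unfolding * using part_decomp(1) by metis
  next
    case False
    then show ?thesis using untilde_support[OF f False] V_0 by simp
  qed
qed

lemma form_bracket_bideg:
  assumes f: "f \<in> cyclic_forms_bideg s V g" and k: "k \<in> cyclic_forms_bideg s V h"
  shows "form_bracket s V ip f k \<in> cyclic_forms_bideg s V (g + h)"
  unfolding bideg_iff
proof (intro conjI allI impI)
  note fc = bideg_cyclic[OF f] and kc = bideg_cyclic[OF k]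
  show "form_bracket s V ip f k \<in> cyclic_forms s V" by (rule form_bracket_in[OF fc kc])
  note F = untilde(1)[OF fc] untilde_pure[OF f] and K = untilde(1)[OF kc] untilde_pure[OF k]
  let ?B = "bracket V (untilde f) (untilde k)"
  fix as vs assume hom: "homogeneous V as vs" and n: "\<not> (int (length vs) = snd (g + h) + 2 \<and> fst (g
      + h) = sum_list as)"
  show "form_bracket s V ip f k vs = 0"
  proof (cases vs rule: rev_cases)
    case Nil
    then show ?thesis by (simp add: form_bracket_def tilde_Nil)
  next
    case (snoc us w)
    obtain bs b where as: "as = bs @ [b]"
      using homogeneous_length[OF hom] snoc by (cases as rule: rev_cases) auto
    have "length bs = length us" using homogeneous_length[OF hom] snoc as by simp
    then have hb: "homogeneous V bs us" "w \<in> V b"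
      using hom unfolding as snoc by (simp_all add: homogeneous_def list_all2_append)
    have val: "form_bracket s V ip f k vs = ip (?B us) w"
      unfolding form_bracket_def untilde_def[symmetric] snoc
      by (rule tilde_snoc_cochain[OF bracket_cochain[OF F(1) K(1)]])
    show ?thesis
    proof (cases "int (length us) = snd g + snd h + 1")
      case True
      have "?B us \<in> V (total_parity g + total_parity h + sum_list bs + of_nat (length us) + 1)"
        using pure_bracket[OF F K] hb(1) unfolding pure_def by blast
      moreover have "of_nat (length us) = of_int (snd g) + of_int (snd h) + (1::bit)"
        using of_nat_eq_of_int[OF True] by simp
      then have "total_parity g + total_parity h + sum_list bs + of_nat (length us) + 1 = fst g +
          fst h + sum_list bs"
        by (simp add: total_parity_def split_beta bit_ring)
      moreover have "fst g + fst h + sum_list bs \<noteq> b"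
        using n True unfolding snoc as by (cases "fst g"; cases "fst h"; cases "sum_list bs"; cases
            b; simp)
      ultimately show ?thesis unfolding val using ip_orthogonal hb(2) by metis
    next
      case False
      define xs where "xs = zip bs us"
      have xs: "proj xs = us" "length xs = length us"
        using proj_zip[OF hb(1)] homogeneous_length[OF hb(1)] by (simp_all add: xs_def)
      \<comment> \<open>A block read by y must have r' + 1 letters, which leaves
        \<open>length xs - r'\<close> arguments for x; this is r + 1 only if xs has r + r' + 1
        letters, the case already excluded.\<close>
      have z: "nest_sum t' (opv t x) (operator t' y) xs = 0"
        if x: "multilinear s s x" "\<And>vs. int (length vs) \<noteq> r + 1 \<Longrightarrow> x vs = 0" and y: "\<And>vs. int (length
            vs) \<noteq> r' + 1 \<Longrightarrow> y vs = 0"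
          and r: "r + r' = snd g + snd h" for x y r r' t t'
      proof -
        have "opv t x (p @ operator t' y u # v) = 0" if e: "xs = p @ c" "c = u @ v" for p c u v
        proof (cases "int (length u) = r' + 1")
          case True
          then have "int (length (p @ operator t' y u # v)) \<noteq> r + 1"
            using False e r xs(2) by simp
          then have "x (proj (p @ operator t' y u # v)) = 0" by (intro x(2)) (simp only:
              proj_simps(4) not_False_eq_True)
          then show ?thesis by (simp only: operator_def snd_conv hom_0[OF part_linear] signed_zero)
        next
          case False
          then have "opv t' y u = 0" using y[of "proj u"] by (simp add: operator_def hom_0[OF
              part_linear])
          then show ?thesis using hom_0[OF alinear_hom[OF alinear_opv[OF x(1)]]] by (metis prod.collapse)
        qed
        then have "nest_sum t' (opv t x) (operator t' y) xs = split_sum (\<lambda>p. split_sum (\<lambda>u v. 0)) xs"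
          unfolding nest_sum_def by (intro split_sum_cong) simp
        then show ?thesis by simp
      qed
      have "nest_sum t' (opv t (untilde f)) (operator t' (untilde k)) xs = 0" for t t'
        by (rule z) (rule cochainsD(1)[OF F(1)], erule untilde_support[OF f], erule
            untilde_support[OF k], simp)
      moreover have "nest_sum t' (opv t (untilde k)) (operator t' (untilde f)) xs = 0" for t t'
        by (rule z) (rule cochainsD(1)[OF K(1)], erule untilde_support[OF k], erule
            untilde_support[OF f], simp)
      ultimately have "commutator (total_parity g) (total_parity h) (untilde f) (untilde k) xs = 0"
        by (simp add: commutator_def)
      then have "?B us = 0" unfolding xs(1)[symmetric] bracket_pure[OF F K] by simp
      then show ?thesis unfolding val by (simp add: hom_0[OF ip_linear(2)])
    qed
  qed
qed

lemma form_bracket_antisym: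
  assumes f: "f \<in> cyclic_forms_bideg s V g" and k: "k \<in> cyclic_forms_bideg s V h"
  shows "form_bracket s V ip f k = - signed (bideg_form g h) (form_bracket s V ip k f)"
proof
  note fc = bideg_cyclic[OF f] and kc = bideg_cyclic[OF k]
  note F = untilde(1)[OF fc] untilde_pure[OF f] and K = untilde(1)[OF kc] untilde_pure[OF k]
  fix vs
  have "ip (- signed c x) w = - signed c (ip x w)" for c x w
    by (simp add: module_hom.neg[OF ip_linear(2)] hom_signed_arg[OF ip_linear(2)])
  then have "form_bracket s V ip f k vs = - signed (bideg_form g h) (form_bracket s V ip k f vs)"
    unfolding form_bracket_def untilde_def[symmetric] tilde_def bracket_antisym[OF F K, of "butlast
        vs"] bideg_form_def
    by simp
  then show "form_bracket s V ip f k vs = (- signed (bideg_form g h) (form_bracket s V ip k f)) vs"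
    by (cases "bideg_form g h") simp_all
qed

text \<open>\<open>derivation_commutator\<close> rewritten with
  \<open>form_bracket_derivation\<close>: as \<chi> is cyclic, its action on k is again the form of
  a bracket. With \<chi> = m this is the Leibniz rule, with \<chi> the cochain of a third form it is
  the Jacobi identity.\<close>

lemma derivation_bracket:
  assumes f: "f \<in> cyclic_forms s V" and k: "k \<in> cyclic_forms s V" "pure t (untilde k)"
    and \<chi>: "\<chi> \<in> cyclic_cochains s V ip" "pure u \<chi>"
  shows "derivation \<chi> (form_bracket s V ip f k) =
    form_bracket s V ip f (derivation \<chi> k) + signed (t * u) (form_bracket s V ip (derivation \<chi> f) k)"
proof -
  note \<chi>c = cyclic_cochains_cochains[OF \<chi>(1)]
  note der = derivation_cyclic[OF cyclic_forms_form \<chi>c]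
  have "derivation \<chi> k = tilde ip (bracket V (untilde k) \<chi>)"
    using bracket_cyclic(2)[OF untilde(3)[OF k(1)] \<chi>(1)] untilde(2)[OF k(1)] by simp
  then have "untilde (derivation \<chi> k) = bracket V (untilde k) \<chi>"
    using untilde_tilde[OF bracket_cochain[OF untilde(1)[OF k(1)] \<chi>c]] by simp
  then show ?thesis
    unfolding form_bracket_derivation[OF f k(1)] form_bracket_derivation[OF f der[OF k(1)]]
        form_bracket_derivation[OF der[OF f] k(1)]
    using derivation_commutator[OF f untilde(1)[OF k(1)] k(2) \<chi>c \<chi>(2)] by (simp add: diff_eq_eq)
qed

lemma total_parity_add: "total_parity (g + h) = total_parity g + total_parity h"
  by (simp add: total_parity_def split_beta ac_simps)

text \<open>\<open>derivation_bracket\<close> for the cochain of w gives the identity with w acting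
  from the right; antisymmetry, applied to its last term, brings it into the required form.\<close>

lemma form_bracket_jacobi:
  assumes u: "u \<in> cyclic_forms_bideg s V g" and v: "v \<in> cyclic_forms_bideg s V h" and w: "w \<in>
      cyclic_forms_bideg s V i"
  shows "form_bracket s V ip u (form_bracket s V ip v w) =
    form_bracket s V ip (form_bracket s V ip u v) w + signed (bideg_form g h) (form_bracket s V ip v
        (form_bracket s V ip u w))"
proof -
  let ?b = "form_bracket s V ip"
  note uc = bideg_cyclic[OF u] and vc = bideg_cyclic[OF v] and wc = bideg_cyclic[OF w]
  have "?b (?b u v) w = ?b u (?b v w) + signed (total_parity h * total_parity i) (?b (?b u w) v)"
    using derivation_bracket[OF uc vc untilde_pure[OF v] untilde(3)[OF wc] untilde_pure[OF w]]
    unfolding form_bracket_derivation[OF form_bracket_in[OF uc vc] wc] form_bracket_derivation[OF vc wc]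
      form_bracket_derivation[OF uc wc] .
  moreover have "?b (?b u w) v = - signed (bideg_form (g + i) h) (?b v (?b u w))"
    by (rule form_bracket_antisym[OF form_bracket_bideg[OF u w] v])
  moreover have "total_parity h * total_parity i + (bideg_form (g + i) h + 1) = bideg_form g h + 1"
    by (simp add: bideg_form_def total_parity_add bit_ring)
  ultimately have "?b (?b u v) w = ?b u (?b v w) + signed (bideg_form g h + 1) (?b v (?b u w))"
    by (simp add: uminus_signed)
  then show ?thesis by (simp add: uminus_signed[symmetric])
qed

lemma graded_lie_algebra_cyclic_forms:
  "graded_lie_algebra form_scale (cyclic_forms s V) (cyclic_forms_bideg s V) bideg_form
      (form_bracket s V ip)"
  unfolding graded_lie_algebra_def
proof (intro conjI allI ballI)
  let ?b = "form_bracket s V ip"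
  show "graded_product form_scale (cyclic_forms s V) (cyclic_forms_bideg s V)" by (rule
      graded_product_cyclic_forms)
  show "bideg_form g h = bideg_form h g" for g h by (simp add: bideg_form_def mult.commute)
  show "bideg_form (g + g') h = bideg_form g h + bideg_form g' h" for g g' h
    by (simp add: bideg_form_def total_parity_add distrib_right)
  fix x assume x: "x \<in> cyclic_forms s V"
  show "?b x y \<in> cyclic_forms s V" if "y \<in> cyclic_forms s V" for y by (rule form_bracket_in[OF x that])
  show "linear_on form_scale (cyclic_forms s V) (?b x)"
    unfolding linear_on_def
    using x by (simp add: form_bracket_derivation cyclic_forms_add cyclic_forms_scale untilde_add
        untilde_scale
        derivation_add_left[OF cyclic_forms_multilinear] derivation_scale_left[OF
            cyclic_forms_multilinear])
  show "linear_on form_scale (cyclic_forms s V) (\<lambda>y. ?b y x)"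
    unfolding linear_on_def
    using x by (simp add: form_bracket_derivation cyclic_forms_add cyclic_forms_scale derivation_add
        derivation_scale)
qed (use form_bracket_bideg form_bracket_antisym form_bracket_jacobi in blast)+

section \<open>The differential of an A-infinity structure\<close>

lemma differential_derivation:
  assumes "a_infinity s V m"
  shows "differential_on form_scale (cyclic_forms s V) (derivation m)"
  using derivation_cyclic[OF cyclic_forms_form a_infinityD(1)[OF assms]] derivation_square[OF _ assms]
  by (simp add: differential_on_def linear_on_def derivation_add derivation_scale)

text \<open>Since m has total parity 1, the sign t * u of \<open>derivation_bracket\<close> is the
  total parity of the second entry.\<close>

lemma dg_lie_algebra_cyclic_forms:
  assumes m: "a_infinity s V m" and c: "m \<in> cyclic_cochains s V ip"
  shows "dg_lie_algebra form_scale (cyclic_forms s V) (cyclic_forms_bideg s V) bideg_form total_parity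
    (form_bracket s V ip) (derivation m)"
proof -
  have "derivation m (form_bracket s V ip u v) = form_bracket s V ip u (derivation m v)
      + signed (total_parity h) (form_bracket s V ip (derivation m u) v)"
    if "u \<in> cyclic_forms_bideg s V g" "v \<in> cyclic_forms_bideg s V h" for u v g h
    using derivation_bracket[OF bideg_cyclic[OF that(1)] bideg_cyclic[OF that(2)] untilde_pure[OF
        that(2)] c a_infinityD(2)[OF m]]
    by simp
  then show ?thesis
    unfolding dg_lie_algebra_def
    using graded_lie_algebra_cyclic_forms differential_derivation[OF m] by blast
qed

end

theorem theorem1:
  fixes s :: "'k::comm_ring_1 \<Rightarrow> 'v::ab_group_add \<Rightarrow> 'v"
    and V :: "bit \<Rightarrow> 'v set"
    and ip :: "'v \<Rightarrow> 'v \<Rightarrow> 'k"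
  assumes "graded_module s V"
    and "inner_product s V ip"
  shows
    "(\<forall>\<phi>\<in>cyclic_cochains s V ip. \<forall>\<psi>\<in>cyclic_cochains s V ip.
        bracket V \<phi> \<psi> \<in> cyclic_cochains s V ip \<and>
        (\<forall>q. (\<forall>l\<ge>1. has_parity V V (q l) (arity_part l \<psi>)) \<longrightarrow>
          (\<forall>n\<ge>1. \<forall>as vs. length vs = n + 1 \<and> homogeneous V as vs \<longrightarrow>
             tilde ip (bracket V \<phi> \<psi>) vs = rotation_sum as q (tilde ip \<phi>) \<psi> vs)))
     \<and> bij_betw (tilde ip) (cyclic_cochains s V ip) (cyclic_forms s V)
     \<and> (\<forall>\<phi>\<in>cyclic_cochains s V ip. \<forall>\<psi>\<in>cyclic_cochains s V ip.
          form_bracket s V ip (tilde ip \<phi>) (tilde ip \<psi>) = tilde ip (bracket V \<phi> \<psi>))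
     \<and> graded_lie_algebra form_scale (cyclic_forms s V) (cyclic_forms_bideg s V) bideg_form
         (form_bracket s V ip)
     \<and> (\<forall>m. a_infinity s V m \<longrightarrow>
          (\<exists>D. (\<forall>\<phi>\<in>cyclic_cochains s V ip. \<forall>n\<ge>1. \<forall>as vs.
                  length vs = n + 1 \<and> homogeneous V as vs \<longrightarrow>
                  D (tilde ip \<phi>) vs = rotation_sum as of_nat (tilde ip \<phi>) m vs)
             \<and> differential_on form_scale (cyclic_forms s V) D
             \<and> (m \<in> cyclic_cochains s V ip \<longrightarrow>
                  (\<forall>\<phi>\<in>cyclic_cochains s V ip.
                     D (tilde ip \<phi>) = form_bracket s V ip (tilde ip \<phi>) (tilde ip m))
                \<and> dg_lie_algebra form_scale (cyclic_forms s V) (cyclic_forms_bideg s V)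
                    bideg_form total_parity (form_bracket s V ip) D)))"
proof -
  interpret inner_product_space s V ip
    using assms by unfold_locales
  have brk: "form_bracket s V ip (tilde ip \<phi>) (tilde ip \<psi>) = tilde ip (bracket V \<phi> \<psi>)"
    if "\<phi> \<in> cyclic_cochains s V ip" "\<psi> \<in> cyclic_cochains s V ip" for \<phi> \<psi>
    using that by (simp add: form_bracket_def untilde_def[symmetric] untilde_tilde cyclic_cochains_cochains)
  have rot: "tilde ip (bracket V \<phi> \<psi>) vs = rotation_sum as q (tilde ip \<phi>) \<psi> vs"
    if "\<phi> \<in> cyclic_cochains s V ip" "\<psi> \<in> cyclic_cochains s V ip"
      "\<forall>l\<ge>1. has_parity V V (q l) (arity_part l \<psi>)" "length vs = n + 1" "homogeneous V as vs" for \<phi> \<psi> q n as vs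
    unfolding bracket_cyclic(2)[OF that(1,2)]
    using that by (intro derivation_rotation_sum tilde_form cyclic_cochains_cochains) auto
  have D: "\<exists>D. (\<forall>\<phi>\<in>cyclic_cochains s V ip. \<forall>n\<ge>1. \<forall>as vs.
                  length vs = n + 1 \<and> homogeneous V as vs \<longrightarrow>
                  D (tilde ip \<phi>) vs = rotation_sum as of_nat (tilde ip \<phi>) m vs)
             \<and> differential_on form_scale (cyclic_forms s V) D
             \<and> (m \<in> cyclic_cochains s V ip \<longrightarrow>
                  (\<forall>\<phi>\<in>cyclic_cochains s V ip.
                     D (tilde ip \<phi>) = form_bracket s V ip (tilde ip \<phi>) (tilde ip m))
                \<and> dg_lie_algebra form_scale (cyclic_forms s V) (cyclic_forms_bideg s V)
                    bideg_form total_parity (form_bracket s V ip) D)"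
    if m: "a_infinity s V m" for m
  \<comment> \<open>D is the action of m; \<open>derivation_rotation_sum\<close> with q l = l yields
    its formula, as the component of m of arity l has parity l.\<close>
  proof (rule exI[of _ "derivation m"], intro conjI ballI allI impI; (elim conjE)?)
    fix \<phi> n as and vs :: "'v list"
    assume "\<phi> \<in> cyclic_cochains s V ip" "length vs = n + 1" "homogeneous V as vs"
    then show "derivation m (tilde ip \<phi>) vs = rotation_sum as of_nat (tilde ip \<phi>) m vs"
      using m by (intro derivation_rotation_sum tilde_form cyclic_cochains_cochains a_infinityD(1)) (auto simp: a_infinity_def)
  next
    fix \<phi> assume "m \<in> cyclic_cochains s V ip" "\<phi> \<in> cyclic_cochains s V ip"
    then show "derivation m (tilde ip \<phi>) = form_bracket s V ip (tilde ip \<phi>) (tilde ip m)"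
      by (simp add: brk bracket_cyclic(2))
  qed (use m differential_derivation dg_lie_algebra_cyclic_forms in auto)
  show ?thesis
    using bracket_cyclic(1) rot tilde_bij brk graded_lie_algebra_cyclic_forms D by (intro conjI) blast+
qed

end
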